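(* Let $\mathcal H$, $J$, $u_0$ satisfy the standing hypotheses (listed in the context), and let $u$ be the solution of the exterior Dirichlet problem with initial datum $u_0$. If $g$ is a function with $\lim_{t\to\infty}g(t)=\infty$, then $$\sup_{|x|\ge g(t)t^{1/2}}t\,u(x,t)\to0\quad\text{as }t\to\infty.$$
   Context: Standing hypotheses. (Hole) $\mathcal H\subset\mathbb R$ is a bounded open set, not necessarily connected, with $(-a_0,a_0)\subset\mathcal H\subset(-a,a)$ for some $0<a_0<a<\infty$. (Kernel) $J\in C^2_c(\mathbb R)$, $J\ge0$, $\operatorname{supp}J=(-d,d)$ with $d>0$ (i.e. $J>0$ exactly on $(-d,d)$), $\int_{\mathbb R}J=1$, $J(x)=J(-x)$, and $J(x_1)\ge J(x_2)$ if $0\le x_1\le x_2$. (Datum) $u_0\ge0$, $u_0\in L^\infty(\mathbb R)$, $u_0=0$ in $\mathcal H$, $\int_{\mathbb R}u_0(x)(1+x^2)\,dx<\infty$. Operator and problem. $Lg:=J*g-g$. The function $u\in C([0,\infty);L^1(\mathbb R,(1+x^2)\,dx))$ is the unique solution of the exterior Dirichlet problem $\partial_tu=Lu$ in $(\mathbb R\setminus\mathcal H)\times(0,\infty)$, $u=0$ in $\mathcal H\times(0,\infty)$, $u(\cdot,0)=u_0$. Suprema involving $u$ are understood up to null sets. *)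

theory Defs
  imports "HOL-Analysis.Analysis" "HOL-Probability.Essential_Supremum"
begin

definition admissible_hole :: "real \<Rightarrow> real \<Rightarrow> real set \<Rightarrow> bool" where
  "admissible_hole a0 a H \<longleftrightarrow>
     0 < a0 \<and> a0 < a \<and> open H \<and> bounded H \<and> {-a0<..<a0} \<subseteq> H \<and> H \<subseteq> {-a<..<a}"

definition C2 :: "(real \<Rightarrow> real) \<Rightarrow> bool" where
  "C2 f \<longleftrightarrow> (\<exists>f' f''.
     (\<forall>x. (f has_real_derivative f' x) (at x)) \<and>
     (\<forall>x. (f' has_real_derivative f'' x) (at x)) \<and>
     continuous_on UNIV f'')"

text \<open>
  The condition \<open>supp J = (-d, d)\<close> is understood as: \<open>J\<close> is positive exactly on \<open>(-d, d)\<close>.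
\<close>

definition admissible_kernel :: "real \<Rightarrow> (real \<Rightarrow> real) \<Rightarrow> bool" where
  "admissible_kernel d J \<longleftrightarrow>
     0 < d \<and> C2 J \<and> compact (closure {x. J x \<noteq> 0}) \<and>
     (\<forall>x. 0 \<le> J x) \<and> {x. 0 < J x} = {-d<..<d} \<and>
     integrable lebesgue J \<and> (LINT x|lebesgue. J x) = 1 \<and>
     (\<forall>x. J x = J (- x)) \<and>
     (\<forall>x1 x2. 0 \<le> x1 \<and> x1 \<le> x2 \<longrightarrow> J x2 \<le> J x1)"

text \<open>
  The measure \<open>(1 + x\<^sup>2) dx\<close>.  Elements of \<open>L\<^sup>1\<close> and \<open>L\<^sup>\<infinity>\<close> are represented by Lebesgue measurable
  functions, and all conditions on them below are insensitive to changes on null sets.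
\<close>

definition weighted_lebesgue :: "real measure" where
  "weighted_lebesgue = density lebesgue (\<lambda>x. ennreal (1 + x\<^sup>2))"

definition admissible_datum :: "real set \<Rightarrow> (real \<Rightarrow> real) \<Rightarrow> bool" where
  "admissible_datum H u0 \<longleftrightarrow>
     u0 \<in> borel_measurable lebesgue \<and>
     (AE x in lebesgue. 0 \<le> u0 x) \<and>
     esssup lebesgue (\<lambda>x. ereal \<bar>u0 x\<bar>) < \<infinity> \<and>
     (AE x in lebesgue. x \<in> H \<longrightarrow> u0 x = 0) \<and>
     integrable weighted_lebesgue u0"

definition convolution :: "(real \<Rightarrow> real) \<Rightarrow> (real \<Rightarrow> real) \<Rightarrow> real \<Rightarrow> real" where
  "convolution J f x = (LINT y|lebesgue. J (x - y) * f y)"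

definition nonlocal_op :: "(real \<Rightarrow> real) \<Rightarrow> (real \<Rightarrow> real) \<Rightarrow> real \<Rightarrow> real" where
  "nonlocal_op J f x = convolution J f x - f x"

text \<open>
  Solutions belong to \<open>C([0,\<infinity>); L\<^sup>1((1 + x\<^sup>2) dx))\<close>, so that \<open>u(\<cdot>,t)\<close> is only determined up to a null
  set for each single \<open>t\<close>.  Accordingly the time derivative in \<open>\<partial>\<^sub>t u = L u\<close> is taken in the norm of
  \<open>L\<^sup>1(\<real> \<setminus> H, (1 + x\<^sup>2) dx)\<close>; pointwise difference quotients would depend on the choice of the
  representatives.
\<close>

definition exterior_Dirichlet_solution ::
    "real set \<Rightarrow> (real \<Rightarrow> real) \<Rightarrow> (real \<Rightarrow> real) \<Rightarrow> (real \<Rightarrow> real \<Rightarrow> real) \<Rightarrow> bool" where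
  "exterior_Dirichlet_solution H J u0 u \<longleftrightarrow>
     (\<forall>t\<ge>0. integrable weighted_lebesgue (\<lambda>x. u x t)) \<and>
     (\<forall>t\<ge>0. ((\<lambda>s. \<integral>\<^sup>+x. ennreal \<bar>u x s - u x t\<bar> \<partial>weighted_lebesgue) \<longlongrightarrow> 0) (at t within {0..})) \<and>
     (\<forall>t>0. ((\<lambda>s. \<integral>\<^sup>+x\<in>-H. ennreal \<bar>(u x s - u x t) / (s - t) - nonlocal_op J (\<lambda>y. u y t) x\<bar>
                 \<partial>weighted_lebesgue) \<longlongrightarrow> 0) (at t)) \<and>
     (\<forall>t>0. AE x in lebesgue. x \<in> H \<longrightarrow> u x t = 0) \<and>
     (AE x in lebesgue. u x 0 = u0 x)"

end

theory Submission
  imports Defs "HOL-Probability.Characteristic_Functions"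
begin

text \<open>
  On the whole line, \<open>J * u\<close> is a classical subsolution of the Cauchy problem, so it is dominated by a
  multiple of \<open>K(t - s) * u(s)\<close>, where \<open>K\<close> is the solution with Gaussian initial datum; its Fourier
  representation gives \<open>K(x,t) \<le> C t^(-1/2)\<close> and \<open>\<bar>x\<bar> K(x,t) \<le> C\<close>.  Because of the hole,
  \<open>(B + \<bar>x\<bar>) 1_{\<bar>x\<bar> \<ge> a0}\<close> is a supersolution of the adjoint problem for large \<open>B\<close>, so the first moment of
  \<open>u\<close> stays bounded.  Combined with smoothing, this forces the mass to decay like \<open>t^(-1/2)\<close>.  For
  \<open>\<bar>x\<bar> \<ge> R = g(t) t^(1/2)\<close> one splits \<open>K(r - t/4) * u(t/4)\<close>, \<open>t/2 < r < t\<close>, at \<open>\<bar>y\<bar> = R/2\<close>: the near part is at most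
  (\<open>C/R\<close>) times the mass, the far part at most (\<open>C t^(-1/2)\<close>) times (first moment \<open>/ R\<close>).  Both are
  \<open>O(1 / (t g(t)))\<close>, and Duhamel's formula transfers this from \<open>J * u\<close> to \<open>u\<close>.
\<close>

section \<open>Elementary bounds\<close>

text \<open>The equation determines \<open>u\<close> only as a curve in a weighted L^1 space,
  differentiable in norm, so \<open>u\<close> itself admits no pointwise comparison in time.
  Information is therefore extracted by pairing with test functions of at most quadratic growth: a
  nonnegative supersolution of the adjoint problem has a decreasing pairing with \<open>u\<close>.
  The convolution of \<open>J\<close> with \<open>u\<close>, in contrast, is defined at every point
  and not changed by null sets, so pointwise estimates are proved for it first. The second obstacle
  is that L does not regularize: its symbol is bounded, and a share exp(-t) of the datum survives
  unsmoothed. Starting the comparison kernel from a Gaussian removes the singular part of the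
  fundamental solution, and Duhamel's formula over [t/2, t] leaves only a factor exp(-t/2) on the
  unsmoothed share of \<open>u\<close>. The hole is decisive for the first moment: on the whole line
  |x| is a subsolution near the origin and its moment grows, while here the loss inside (-a0, a0)
  compensates the excess.\<close>

lemma abs_le_one_plus_square: "\<bar>x\<bar> \<le> 1 + x^2" for x :: real
proof -
  have "0 \<le> (\<bar>x\<bar> - 1)^2" by simp
  then have "2 * \<bar>x\<bar> \<le> 1 + x^2" by (simp add: power2_eq_square algebra_simps)
  then show ?thesis by simp
qed

lemma abs_sin_diff_le: "\<bar>sin a - sin b\<bar> \<le> \<bar>a - b\<bar>" for a b :: real
proof -
  have "\<bar>sin a - sin b\<bar> = 2 * \<bar>sin ((a - b) / 2)\<bar> * \<bar>cos ((a + b) / 2)\<bar>"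
    by (simp add: sin_diff_sin abs_mult)
  also have "\<dots> \<le> 2 * \<bar>(a - b) / 2\<bar> * 1"
    by (intro mult_mono abs_sin_x_le_abs_x) auto
  finally show ?thesis by simp
qed

text \<open>With increment e the error is cos a (cos e - 1) - sin a (sin e - e), and both brackets
  are at most e^2/2. Integrated against \<open>J\<close>, this replaces differentiation under the
  integral sign for \<open>symbol\<close>.\<close>

lemma cos_taylor1_bound: "\<bar>cos b - cos a + (b - a) * sin a\<bar> \<le> (b - a)^2" for a b :: real
proof -
  define e where "e = b - a"
  have b: "b = a + e" by (simp add: e_def)
  have 1: "\<bar>sin e - e\<bar> \<le> e^2 / 2"
    using Maclaurin_sin_bound[of e 2] by (simp add: numeral_2_eq_2 sin_coeff_def)
  have "1 - cos e = 2 * (sin (e/2))^2"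
    using cos_double_sin[of "e/2"] by simp
  moreover have "(sin (e/2))^2 \<le> (e/2)^2"
    using abs_sin_x_le_abs_x[of "e/2"] by (rule abs_le_square_iff[THEN iffD1])
  ultimately have 2: "\<bar>cos e - 1\<bar> \<le> e^2 / 2"
    using cos_le_one[of e] by (auto simp: power_divide)
  have "cos b - cos a + (b - a) * sin a = cos a * (cos e - 1) - sin a * (sin e - e)"
    by (simp add: b cos_add algebra_simps)
  also have "\<bar>\<dots>\<bar> \<le> \<bar>cos a\<bar> * \<bar>cos e - 1\<bar> + \<bar>sin a\<bar> * \<bar>sin e - e\<bar>"
    unfolding abs_mult[symmetric] by (rule abs_triangle_ineq4)
  also have "\<dots> \<le> 1 * (e^2/2) + 1 * (e^2/2)"
    by (intro add_mono mult_mono 1 2) auto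
  finally show ?thesis by (simp add: e_def)
qed

text \<open>Convexity gives a tangent inequality at each endpoint: one makes the error nonnegative,
  the other bounds it by the increment times a difference of exponentials. On the nonnegative
  half-line exp(-x) is 1-Lipschitz, hence the constant 1 whatever a and b are.\<close>

lemma exp_taylor1_bound:
  fixes a b :: real
  assumes "0 \<le> a" "0 \<le> b"
  shows "\<bar>exp (- b) - exp (- a) + (b - a) * exp (- a)\<bar> \<le> (b - a)^2"
proof -
  have 1: "exp (-b) \<ge> exp (-a) * (1 - (b - a))"
    using exp_ge_add_one_self[of "-(b-a)"] by (simp add: exp_diff exp_minus field_simps)
  have 2: "exp (-a) \<ge> exp (-b) * (1 + (b - a))"
    using exp_ge_add_one_self[of "b-a"] by (simp add: exp_diff exp_minus field_simps)
  have 3: "\<bar>exp (-b) - exp (-a)\<bar> \<le> \<bar>b - a\<bar>"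
  proof (cases "a \<le> b")
    case True
    have "exp (-a) * (b - a) \<le> 1 * (b - a)"
      using True assms by (intro mult_right_mono) auto
    then show ?thesis using True 1 by (auto simp: algebra_simps abs_if)
  next
    case False
    have "exp (-b) * (a - b) \<le> 1 * (a - b)"
      using False assms by (intro mult_right_mono) auto
    then show ?thesis using False 2 by (auto simp: algebra_simps abs_if)
  qed
  have "exp (-b) - exp (-a) + (b - a) * exp (-a) \<le> (b - a) * (exp (-a) - exp (-b))"
    using 2 by (simp add: algebra_simps)
  also have "\<dots> \<le> \<bar>b - a\<bar> * \<bar>exp (-b) - exp (-a)\<bar>"
    by (metis abs_ge_self abs_minus_commute abs_mult)
  also have "\<dots> \<le> \<bar>b - a\<bar> * \<bar>b - a\<bar>"
    by (intro mult_left_mono 3) auto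
  finally show ?thesis using 1 by (simp add: algebra_simps power2_eq_square)
qed

text \<open>Taylor's formula settles y <= 2, where 1/6 - 4/120 is at least 1/8; beyond 2, sin y <= 1
  <= y/2 gives the factor 4/8. The truncated shape anticipates the symbol: quadratic at low
  frequency, bounded at high frequency.\<close>

lemma sin_le_cubic:
  fixes y :: real
  assumes "0 \<le> y"
  shows "y - sin y \<ge> y * min (y^2) 4 / 8"
proof (cases "y \<le> 2")
  case True
  have "\<bar>sin y - (y - y^3/6)\<bar> \<le> y^5 / 120"
    using Maclaurin_sin_bound[of y 5] assms
    by (simp add: sin_coeff_def lessThan_nat_numeral fact_numeral field_simps)
  then have "y - sin y \<ge> y^3/6 - y^5/120" by linarith
  moreover have y4: "y^2 \<le> 4" using True assms power_mono[of y 2 2] by simp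
  have "y^5 \<le> y^3 * 4"
    using mult_left_mono[OF y4, of "y^3"] assms by (simp add: power_add[symmetric])
  moreover have "0 \<le> y^3" using assms by simp
  ultimately have "y - sin y \<ge> y^3/8" by linarith
  then show ?thesis using y4 by (simp add: min_def power_def)
next
  case False
  then have "4 \<le> y^2" using power_mono[of 2 y 2] by simp
  moreover have "2 * sin y \<le> y" using False sin_le_one[of y] by linarith
  ultimately show ?thesis using False by (simp add: min_def)
qed

text \<open>The common route to the derivatives of \<open>symbol\<close> and \<open>heat\<close>;
  the set \<open>S\<close> permits the one-sided derivative at time 0.\<close>

lemma has_real_derivative_quadratic_error:
  fixes f :: "real \<Rightarrow> real"
  assumes "\<And>s. s \<in> S \<Longrightarrow> \<bar>f s - f t - (s - t) * D\<bar> \<le> C * (s - t)^2"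
  shows "(f has_real_derivative D) (at t within S)"
proof -
  have lim: "((\<lambda>s. C * \<bar>s - t\<bar>) \<longlongrightarrow> 0) (at t within S)"
    by (auto intro!: tendsto_eq_intros)
  have "\<forall>\<^sub>F s in at t within S. norm ((f s - f t) / (s - t) - D) \<le> C * \<bar>s - t\<bar>"
    unfolding eventually_at_filter
  proof (intro always_eventually allI impI)
    fix s assume s: "s \<noteq> t" "s \<in> S"
    then have "(f s - f t) / (s - t) - D = (f s - f t - (s - t) * D) / (s - t)"
      by (simp add: field_simps)
    also have "norm \<dots> \<le> C * (s - t)^2 / \<bar>s - t\<bar>"
      unfolding real_norm_def abs_divide using s by (intro divide_right_mono assms) auto
    also have "\<dots> = C * \<bar>s - t\<bar>"
      using s by (simp add: power2_eq_square field_simps abs_if)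
    finally show "norm ((f s - f t) / (s - t) - D) \<le> C * \<bar>s - t\<bar>" .
  qed
  from Lim_null_comparison[OF this lim] show ?thesis
    by (simp add: has_field_derivative_iff LIM_zero_iff)
qed

lemma abs_integral_le_integrable:
  fixes f g :: "'a::euclidean_space \<Rightarrow> real"
  assumes "integrable M g" "f \<in> borel_measurable M" "\<And>x. \<bar>f x\<bar> \<le> g x"
  shows "\<bar>integral\<^sup>L M f\<bar> \<le> integral\<^sup>L M g"
proof -
  have "integrable M f"
    using assms(1,2)
  proof (rule Bochner_Integration.integrable_bound)
    show "AE x in M. norm (f x) \<le> norm (g x)"
      using assms(3) by (intro AE_I2) (metis real_norm_def abs_ge_self order_trans)
  qed
  then show ?thesis
    using assms(1,3) by (intro integral_abs_bound_integral) auto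
qed

lemma DERIV_power_over_fact:
  "((\<lambda>r. r ^ Suc n / fact (Suc n)) has_real_derivative r ^ n / fact n) (at r)" for r :: real
proof -
  have "((\<lambda>r. r ^ Suc n / fact (Suc n)) has_real_derivative real (Suc n) * r ^ n / fact (Suc n)) (at r)"
    using DERIV_cdivide[OF DERIV_pow[of "Suc n" r], of "fact (Suc n)"] by (simp only: diff_Suc_Suc diff_zero)
  moreover have "real (Suc n) * r ^ n / fact (Suc n) = r ^ n / fact n"
    unfolding fact_Suc by (subst mult_divide_mult_cancel_left) auto
  ultimately show ?thesis by simp
qed

text \<open>The real part of the characteristic function of the standard normal law. It identifies
  the initial value of \<open>heat\<close>.\<close>

lemma integral_std_normal_cos:
  "(LINT \<xi>|lborel. std_normal_density \<xi> * cos (x * \<xi>)) = exp (- (x^2) / 2)"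
proof -
  have int: "integrable lborel (\<lambda>\<xi>. std_normal_density \<xi> *\<^sub>R iexp (x * \<xi>))"
    by (rule Bochner_Integration.integrable_bound[OF integrable_normal_density[where \<mu> = 0 and \<sigma> = 1]]) auto
  have "complex_of_real (exp (- (x^2) / 2)) = char std_normal_distribution x"
    by (simp add: char_std_normal_distribution)
  also have "\<dots> = (CLINT \<xi>|lborel. std_normal_density \<xi> *\<^sub>R iexp (x * \<xi>))"
    unfolding char_def by (intro integral_density) auto
  finally have "exp (- (x^2) / 2) = Re (CLINT \<xi>|lborel. std_normal_density \<xi> *\<^sub>R iexp (x * \<xi>))"
    by (metis Re_complex_of_real)
  also have "\<dots> = (LINT \<xi>|lborel. Re (std_normal_density \<xi> *\<^sub>R iexp (x * \<xi>)))"
    using int by (rule integral_Re[symmetric])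
  also have "\<dots> = (LINT \<xi>|lborel. std_normal_density \<xi> * cos (x * \<xi>))"
    by (simp add: Re_exp)
  finally show ?thesis ..
qed

section \<open>The symbol of the kernel\<close>

locale dispersal_kernel =
  fixes d :: real and J :: "real \<Rightarrow> real"
  assumes admissible: "admissible_kernel d J"
begin

lemma d_pos: "0 < d" and J_nonneg: "0 \<le> J x" and J_minus: "J (- x) = J x"
  and J_antimono: "0 \<le> x \<Longrightarrow> x \<le> y \<Longrightarrow> J y \<le> J x"
  using admissible by (auto simp: admissible_kernel_def)

lemma J_pos_iff: "0 < J x \<longleftrightarrow> \<bar>x\<bar> < d"
proof -
  have "{x. 0 < J x} = {-d<..<d}" using admissible by (simp add: admissible_kernel_def)
  then have "0 < J x \<longleftrightarrow> x \<in> {-d<..<d}" by blast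
  then show ?thesis by auto
qed

lemma J_eq_0: "d \<le> \<bar>x\<bar> \<Longrightarrow> J x = 0"
  using J_pos_iff[of x] J_nonneg[of x] by auto

lemma J_abs: "J \<bar>x\<bar> = J x"
  using J_minus[of x] by (auto simp: abs_if)

lemma J_le: "J x \<le> J 0"
  using J_antimono[of 0 "\<bar>x\<bar>"] by (simp add: J_abs)

lemma J0_pos: "0 < J 0"
  using J_pos_iff[of 0] d_pos by simp

lemma J_diff_commute: "J (x - y) = J (y - x)"
  using J_minus[of "x - y"] by simp

lemma continuous_J: "continuous_on UNIV J"
proof -
  obtain J' where "\<forall>x. (J has_real_derivative J' x) (at x)"
    using admissible by (auto simp: admissible_kernel_def C2_def)
  then show ?thesis
    by (auto intro!: DERIV_continuous_on)
qed

lemma borel_measurable_J [measurable]: "J \<in> borel_measurable borel"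
  by (intro borel_measurable_continuous_onI continuous_J)

lemma integrable_J: "integrable lborel J" and integral_J: "(LINT z|lborel. J z) = 1"
  using admissible
  by (auto simp: admissible_kernel_def integral_completion integrable_completion)

lemma integrable_J_mult:
  assumes [measurable]: "f \<in> borel_measurable borel" and "\<And>z. \<bar>z\<bar> < d \<Longrightarrow> \<bar>f z\<bar> \<le> C"
  shows "integrable lborel (\<lambda>z. J z * f z)"
proof (rule Bochner_Integration.integrable_bound)
  show "integrable lborel (\<lambda>z. C * J z)" using integrable_J by simp
  show "AE z in lborel. norm (J z * f z) \<le> norm (C * J z)"
  proof (intro AE_I2)
    fix z
    show "norm (J z * f z) \<le> norm (C * J z)"
    proof (cases "\<bar>z\<bar> < d")
      case True
      then have "\<bar>f z\<bar> \<le> \<bar>C\<bar>" using assms(2)[of z] by linarith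
      then have "J z * \<bar>f z\<bar> \<le> J z * \<bar>C\<bar>" by (intro mult_left_mono J_nonneg)
      then show ?thesis using J_nonneg[of z] by (simp add: abs_mult mult.commute)
    qed (simp add: J_eq_0)
  qed
qed measurable

lemma integral_J_mult_le:
  assumes [measurable]: "f \<in> borel_measurable borel" and b: "\<And>z. \<bar>z\<bar> < d \<Longrightarrow> \<bar>f z\<bar> \<le> C"
  shows "\<bar>LINT z|lborel. J z * f z\<bar> \<le> C"
proof -
  have "\<bar>LINT z|lborel. J z * f z\<bar> \<le> (LINT z|lborel. C * J z)"
  proof (rule integral_abs_bound_integral[OF integrable_J_mult[OF assms]])
    show "integrable lborel (\<lambda>z. C * J z)" using integrable_J by simp
    fix z
    show "\<bar>J z * f z\<bar> \<le> C * J z"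
    proof (cases "\<bar>z\<bar> < d")
      case True
      show ?thesis using mult_left_mono[OF b[OF True] J_nonneg[of z]] J_nonneg[of z]
        by (simp add: abs_mult mult.commute)
    qed (simp add: J_eq_0)
  qed
  then show ?thesis using integral_J by simp
qed

text \<open>The Fourier symbol of -L, that is, one minus the Fourier transform of \<open>J\<close>;
  evenness of \<open>J\<close> reduces the transform to its cosine part.\<close>

definition symbol :: "real \<Rightarrow> real" where
  "symbol \<xi> = (LINT z|lborel. J z * (1 - cos (z * \<xi>)))"

text \<open>The derivative of \<open>symbol\<close> taken formally under the integral;
  \<open>DERIV_symbol\<close> justifies it.\<close>

definition symbol' :: "real \<Rightarrow> real" where
  "symbol' \<xi> = (LINT z|lborel. J z * (z * sin (z * \<xi>)))"

lemma borel_measurable_symbol [measurable]: "symbol \<in> borel_measurable borel"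
  unfolding symbol_def[abs_def] by measurable

lemma integrable_J_cos: "integrable lborel (\<lambda>z. J z * cos (z * \<xi>))"
  and integrable_J_sin: "integrable lborel (\<lambda>z. J z * sin (z * \<xi>))"
  by (rule integrable_J_mult[where C = 1]; simp)+

lemma integrable_J_cos1: "integrable lborel (\<lambda>z. J z * (1 - cos (z * \<xi>)))"
  using Bochner_Integration.integrable_diff[OF integrable_J integrable_J_cos, of \<xi>]
  by (simp add: algebra_simps)

lemma symbol_nonneg: "0 \<le> symbol \<xi>"
  unfolding symbol_def by (intro integral_nonneg_AE AE_I2 mult_nonneg_nonneg J_nonneg) simp

lemma symbol_le_2: "symbol \<xi> \<le> 2"
proof -
  have "\<bar>1 - cos (z * \<xi>)\<bar> \<le> 2" for z
    using cos_ge_minus_one[of "z * \<xi>"] cos_le_one[of "z * \<xi>"] by simp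
  then have "\<bar>symbol \<xi>\<bar> \<le> 2"
    unfolding symbol_def by (intro integral_J_mult_le) auto
  then show ?thesis by simp
qed

lemma integral_J_cos: "(LINT z|lborel. J z * cos (z * \<xi>)) = 1 - symbol \<xi>"
  using integrable_J integrable_J_cos[of \<xi>] by (simp add: symbol_def right_diff_distrib integral_J)

lemma integral_J_sin: "(LINT z|lborel. J z * sin (z * \<xi>)) = 0"
  using lborel_integral_real_affine[of "-1" "\<lambda>z. J z * sin (z * \<xi>)" 0] by (simp add: J_minus)

text \<open>The diffusive behaviour of L: quadratic growth near frequency 0 and a spectral gap away
  from it. On [-d/2, d/2] monotonicity keeps \<open>J\<close> above the positive number J(d/2), and
  the integral of 1 - cos over that interval is explicit.\<close>

lemma symbol_lower_bound:
  obtains \<alpha> \<beta> where "0 < \<alpha>" "0 < \<beta>" "\<And>\<xi>. min (\<alpha> * \<xi>^2) \<beta> \<le> symbol \<xi>"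
proof -
  define e where "e = d / 2"
  have e: "0 < e" using d_pos by (simp add: e_def)
  have Je: "0 < J e" using d_pos by (simp add: J_pos_iff e_def)
  have main: "2 * J e * e * (min ((e*\<xi>)^2) 4 / 8) \<le> symbol \<xi>" for \<xi>
  proof (cases "\<xi> = 0")
    case True
    then show ?thesis using symbol_nonneg[of \<xi>] by simp
  next
    case False
    define y where "y = e * \<bar>\<xi>\<bar>"
    have y: "0 < y" using e False by (simp add: y_def)
    have y2: "y^2 = (e*\<xi>)^2" by (simp add: y_def power_mult_distrib)
    have FTC: "(LBINT z=-e..e. (1 - cos (z * \<bar>\<xi>\<bar>))) = (e - sin (e * \<bar>\<xi>\<bar>) / \<bar>\<xi>\<bar>) - (- e - sin (- e * \<bar>\<xi>\<bar>) / \<bar>\<xi>\<bar>)"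
      using e False
      by (intro interval_integral_FTC_finite[where F = "\<lambda>z. z - sin (z * \<bar>\<xi>\<bar>) / \<bar>\<xi>\<bar>"])
        (auto intro!: continuous_intros derivative_eq_intros
          simp: power2_eq_square field_simps abs_if simp flip: has_real_derivative_iff_has_vector_derivative)
    have "J e * (e * min (y^2) 4 / 8 * 2) \<le> J e * ((y - sin y) / \<bar>\<xi>\<bar> * 2)"
    proof (intro mult_left_mono mult_right_mono)
      have "e * min (y^2) 4 / 8 = (y * min (y^2) 4 / 8) / \<bar>\<xi>\<bar>"
        using False by (simp add: y_def)
      also have "\<dots> \<le> (y - sin y) / \<bar>\<xi>\<bar>"
        using sin_le_cubic[of y] y by (intro divide_right_mono) auto
      finally show "e * min (y^2) 4 / 8 \<le> (y - sin y) / \<bar>\<xi>\<bar>" .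
    qed (use Je in auto)
    also have "(y - sin y) / \<bar>\<xi>\<bar> * 2 = (LBINT z=-e..e. (1 - cos (z * \<bar>\<xi>\<bar>)))"
      using False unfolding FTC by (simp add: y_def field_simps)
    also have "J e * \<dots> = (LINT z|lborel. J e * (indicator {-e..e} z * (1 - cos (z * \<bar>\<xi>\<bar>))))"
      using e by (simp add: interval_integral_Icc set_lebesgue_integral_def)
    also have "\<dots> \<le> symbol \<xi>"
      unfolding symbol_def
    proof (rule integral_mono)
      have "set_integrable lborel {-e..e} (\<lambda>z. 1 - cos (z * \<bar>\<xi>\<bar>))"
        by (intro borel_integrable_atLeastAtMost') (auto intro!: continuous_intros)
      then show "integrable lborel (\<lambda>z. J e * (indicator {-e..e} z * (1 - cos (z * \<bar>\<xi>\<bar>))))"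
        by (simp add: set_integrable_def)
      show "integrable lborel (\<lambda>z. J z * (1 - cos (z * \<xi>)))" by (rule integrable_J_cos1)
      fix z :: real
      have c: "cos (z * \<bar>\<xi>\<bar>) = cos (z * \<xi>)" by (auto simp: abs_if)
      show "J e * (indicator {-e..e} z * (1 - cos (z * \<bar>\<xi>\<bar>))) \<le> J z * (1 - cos (z * \<xi>))"
        using J_antimono[of "\<bar>z\<bar>" e] J_nonneg[of z]
        by (auto simp: c J_abs indicator_def intro!: mult_right_mono)
    qed
    finally show ?thesis by (simp add: y2 algebra_simps)
  qed
  show ?thesis
  \<comment> \<open>The minimum from \<open>sin_le_cubic\<close> multiplied out: 2 J(e) e / 8 times
    (e xi)^2, respectively times 4.\<close>
  proof (rule that[of "2 * J e * e * e^2 / 8" "J e * e"])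
    fix \<xi> :: real
    have "2 * J e * e * (min ((e*\<xi>)^2) 4 / 8) = (2 * J e * e / 8) * min ((e*\<xi>)^2) 4" by simp
    also have "\<dots> = min ((2 * J e * e / 8) * (e*\<xi>)^2) ((2 * J e * e / 8) * 4)"
      using e Je by (subst min_mult_distrib_left) (auto simp: not_le mult_pos_pos)
    finally show "min (2 * J e * e * e^2 / 8 * \<xi>^2) (J e * e) \<le> symbol \<xi>"
      using main[of \<xi>] by (simp add: power_mult_distrib mult_ac)
  qed (use e Je in auto)
qed

lemma integrable_J_zsin: "integrable lborel (\<lambda>z. J z * (z * sin (z * \<xi>)))"
proof (rule integrable_J_mult[where C = d])
  fix z assume "\<bar>z\<bar> < d"
  then have "\<bar>z\<bar> * \<bar>sin (z * \<xi>)\<bar> \<le> d * 1" by (intro mult_mono) auto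
  then show "\<bar>z * sin (z * \<xi>)\<bar> \<le> d" by (simp add: abs_mult)
qed simp

text \<open>Since |z| < d on the support, z sin (z xi) is d^2-Lipschitz in xi. This yields both the
  continuity of \<open>symbol'\<close>, needed for the fundamental theorem of calculus, and, with
  second argument 0, the linear bound that controls the integration by parts.\<close>

lemma abs_symbol'_diff_le: "\<bar>symbol' \<xi> - symbol' \<eta>\<bar> \<le> d^2 * \<bar>\<xi> - \<eta>\<bar>"
proof -
  have "symbol' \<xi> - symbol' \<eta> = (LINT z|lborel. J z * (z * sin (z * \<xi>) - z * sin (z * \<eta>)))"
    using integrable_J_zsin by (simp add: symbol'_def right_diff_distrib)
  also have "\<bar>\<dots>\<bar> \<le> d^2 * \<bar>\<xi> - \<eta>\<bar>"
  proof (rule integral_J_mult_le)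
    fix z assume z: "\<bar>z\<bar> < d"
    have "\<bar>z * sin (z * \<xi>) - z * sin (z * \<eta>)\<bar> = \<bar>z\<bar> * \<bar>sin (z * \<xi>) - sin (z * \<eta>)\<bar>"
      by (simp add: abs_mult right_diff_distrib[symmetric])
    also have "\<dots> \<le> \<bar>z\<bar> * \<bar>z * \<xi> - z * \<eta>\<bar>"
      by (intro mult_left_mono abs_sin_diff_le) auto
    also have "\<dots> = \<bar>z\<bar>^2 * \<bar>\<xi> - \<eta>\<bar>"
      by (simp add: power2_eq_square right_diff_distrib[symmetric] abs_mult)
    also have "\<dots> \<le> d^2 * \<bar>\<xi> - \<eta>\<bar>"
      using z by (intro mult_right_mono power_mono) auto
    finally show "\<bar>z * sin (z * \<xi>) - z * sin (z * \<eta>)\<bar> \<le> d^2 * \<bar>\<xi> - \<eta>\<bar>" .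
  qed measurable
  finally show ?thesis .
qed

lemma abs_symbol'_le: "\<bar>symbol' \<xi>\<bar> \<le> d^2 * \<bar>\<xi>\<bar>"
  using abs_symbol'_diff_le[of \<xi> 0] by (simp add: symbol'_def)

lemma continuous_symbol': "isCont symbol' \<xi>"
proof -
  have "((\<lambda>\<eta>. d^2 * \<bar>\<eta> - \<xi>\<bar>) \<longlongrightarrow> 0) (at \<xi>)" by (auto intro!: tendsto_eq_intros)
  then have "((\<lambda>\<eta>. symbol' \<eta> - symbol' \<xi>) \<longlongrightarrow> 0) (at \<xi>)"
    by (rule Lim_null_comparison[rotated]) (use abs_symbol'_diff_le in simp)
  then show ?thesis by (simp add: isCont_def LIM_zero_iff)
qed

lemma borel_measurable_symbol' [measurable]: "symbol' \<in> borel_measurable borel"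
  by (intro borel_measurable_continuous_onI continuous_at_imp_continuous_on ballI continuous_symbol')

lemma symbol_taylor1_bound:
  "\<bar>symbol \<eta> - symbol \<xi> - (\<eta> - \<xi>) * symbol' \<xi>\<bar> \<le> d^2 * (\<eta> - \<xi>)^2"
proof -
  have "symbol \<eta> - symbol \<xi> - (\<eta> - \<xi>) * symbol' \<xi>
     = (LINT z|lborel. J z * (1 - cos (z * \<eta>)) - J z * (1 - cos (z * \<xi>)) - (\<eta> - \<xi>) * (J z * (z * sin (z * \<xi>))))"
    using integrable_J_zsin[of \<xi>] integrable_J_cos1
    by (simp add: symbol'_def symbol_def)
  also have "\<dots> = (LINT z|lborel. J z * - (cos (z * \<eta>) - cos (z * \<xi>) + (z * \<eta> - z * \<xi>) * sin (z * \<xi>)))"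
    by (intro Bochner_Integration.integral_cong refl) (simp add: algebra_simps)
  also have "\<bar>\<dots>\<bar> \<le> d^2 * (\<eta> - \<xi>)^2"
  proof (rule integral_J_mult_le)
    fix z assume z: "\<bar>z\<bar> < d"
    have "\<bar>- (cos (z * \<eta>) - cos (z * \<xi>) + (z * \<eta> - z * \<xi>) * sin (z * \<xi>))\<bar> \<le> (z * \<eta> - z * \<xi>)^2"
      using cos_taylor1_bound[of "z * \<eta>" "z * \<xi>"] by simp
    also have "\<dots> = \<bar>z\<bar>^2 * (\<eta> - \<xi>)^2"
      by (simp add: right_diff_distrib[symmetric] power_mult_distrib)
    also have "\<dots> \<le> d^2 * (\<eta> - \<xi>)^2"
      using z by (intro mult_right_mono power_mono) auto
    finally show "\<bar>- (cos (z * \<eta>) - cos (z * \<xi>) + (z * \<eta> - z * \<xi>) * sin (z * \<xi>))\<bar> \<le> d^2 * (\<eta> - \<xi>)^2" .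
  qed measurable
  finally show ?thesis .
qed

lemma DERIV_symbol: "(symbol has_real_derivative symbol' \<xi>) (at \<xi>)"
  by (rule has_real_derivative_quadratic_error) (rule symbol_taylor1_bound)

abbreviation conv :: "(real \<Rightarrow> real) \<Rightarrow> real \<Rightarrow> real" where
  "conv \<equiv> Defs.convolution J"

section \<open>The heat kernel of the whole line\<close>

text \<open>The frequency profile of the comparison kernel. The Gaussian factor supplies all the
  decay at infinity: by \<open>symbol_le_2\<close>, exp(-t symbol) stays above exp(-2t), the trace
  of the atom in the fundamental solution.\<close>

definition damp :: "real \<Rightarrow> real \<Rightarrow> real" where
  "damp t \<xi> = std_normal_density \<xi> * exp (- (t * symbol \<xi>))"

lemma borel_measurable_damp [measurable]: "damp t \<in> borel_measurable borel"
  unfolding damp_def[abs_def] by measurable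

lemma damp_pos: "0 < damp t \<xi>"
  by (simp add: damp_def normal_density_pos)

lemma damp_le: "0 \<le> t \<Longrightarrow> damp t \<xi> \<le> std_normal_density \<xi>"
  using symbol_nonneg[of \<xi>] by (simp add: damp_def mult_left_le)

lemma integrable_damp_mult:
  assumes "0 \<le> t" and [measurable]: "f \<in> borel_measurable borel" and "\<And>\<xi>. \<bar>f \<xi>\<bar> \<le> C"
  shows "integrable lborel (\<lambda>\<xi>. damp t \<xi> * f \<xi>)"
proof (rule Bochner_Integration.integrable_bound)
  show "integrable lborel (\<lambda>\<xi>. std_normal_density \<xi> * C)" by simp
  have "\<bar>damp t \<xi> * f \<xi>\<bar> \<le> std_normal_density \<xi> * C" for \<xi>
    unfolding abs_mult using assms(3)[of \<xi>] damp_le[OF assms(1), of \<xi>] damp_pos[of t \<xi>]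
    by (intro mult_mono) auto
  then show "AE \<xi> in lborel. norm (damp t \<xi> * f \<xi>) \<le> norm (std_normal_density \<xi> * C)"
    by (intro AE_I2) (metis real_norm_def abs_ge_self order_trans)
qed measurable

lemma integrable_damp: "0 \<le> t \<Longrightarrow> integrable lborel (damp t)"
  using integrable_damp_mult[of t "\<lambda>_. 1" 1] by simp

text \<open>
  The solution of \<open>v\<^sub>t = J * v - v\<close> with Gaussian initial datum, written as an inverse
  Fourier transform; a Gaussian datum is chosen because it dominates a multiple of \<^term>\<open>J\<close>.
\<close>

definition heat :: "real \<Rightarrow> real \<Rightarrow> real" where
  "heat x t = (LINT \<xi>|lborel. damp t \<xi> * cos (x * \<xi>))"

lemma borel_measurable_heat [measurable]: "(\<lambda>x. heat x t) \<in> borel_measurable borel"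
  unfolding heat_def by measurable

lemma integrable_damp_cos: "0 \<le> t \<Longrightarrow> integrable lborel (\<lambda>\<xi>. damp t \<xi> * cos (x * \<xi>))"
  by (rule integrable_damp_mult[where C = 1]) auto

lemma integrable_damp_symbol_cos:
  assumes "0 \<le> t"
  shows "integrable lborel (\<lambda>\<xi>. damp t \<xi> * (symbol \<xi> * cos (x * \<xi>)))"
proof (rule integrable_damp_mult[where C = 2, OF assms])
  fix \<xi>
  have "\<bar>symbol \<xi>\<bar> * \<bar>cos (x * \<xi>)\<bar> \<le> 2 * 1"
    using symbol_nonneg[of \<xi>] symbol_le_2[of \<xi>] by (intro mult_mono) auto
  then show "\<bar>symbol \<xi> * cos (x * \<xi>)\<bar> \<le> 2" by (simp add: abs_mult)
qed measurable

lemma heat_0: "heat x 0 = exp (- (x^2) / 2)"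
  by (simp add: heat_def damp_def integral_std_normal_cos)

lemma heat_le_integral_damp: "0 \<le> t \<Longrightarrow> \<bar>heat x t\<bar> \<le> (LINT \<xi>|lborel. damp t \<xi>)"
  unfolding heat_def
  by (rule abs_integral_le_integrable[OF integrable_damp])
    (auto simp: abs_mult abs_of_pos[OF damp_pos] mult_left_le less_imp_le[OF damp_pos])

lemma heat_le_1: "0 \<le> t \<Longrightarrow> \<bar>heat x t\<bar> \<le> 1"
proof -
  assume t: "0 \<le> t"
  have "(LINT \<xi>|lborel. damp t \<xi>) \<le> (LINT \<xi>|lborel. std_normal_density \<xi>)"
    by (rule integral_mono) (use t in \<open>simp_all add: integrable_damp damp_le\<close>)
  then show ?thesis using heat_le_integral_damp[OF t, of x] by simp
qed

lemma integrable_J_diff_heat: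
  "0 \<le> t \<Longrightarrow> integrable lborel (\<lambda>y. J (x - y) * heat y t)"
proof (rule Bochner_Integration.integrable_bound)
  assume t: "0 \<le> t"
  show "integrable lborel (\<lambda>y. J (x - y))"
    using lborel_integrable_real_affine[OF integrable_J, of "-1" x] by simp
  show "AE y in lborel. norm (J (x - y) * heat y t) \<le> norm (J (x - y))"
    using heat_le_1[OF t] by (simp add: abs_mult mult_left_le J_nonneg)
qed measurable

text \<open>Convolution with \<open>J\<close> multiplies cos (y xi) by 1 - symbol xi, the sine part
  cancelling by evenness; hence L acts on \<open>heat\<close> as multiplication by -symbol under the
  integral.\<close>

lemma conv_heat:
  assumes t: "0 \<le> t"
  shows "conv (\<lambda>y. heat y t) x - heat x t = - (LINT \<xi>|lborel. damp t \<xi> * (symbol \<xi> * cos (x * \<xi>)))"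
proof -
  have inner: "(LINT y|lborel. J (x - y) * cos (y * \<xi>)) = (1 - symbol \<xi>) * cos (x * \<xi>)" for \<xi>
  proof -
    have "(LINT y|lborel. J (x - y) * cos (y * \<xi>)) = (LINT z|lborel. J z * cos ((x - z) * \<xi>))"
      using lborel_integral_real_affine[of "-1" "\<lambda>y. J (x - y) * cos (y * \<xi>)" x] by simp
    also have "\<dots> = (LINT z|lborel. cos (x * \<xi>) * (J z * cos (z * \<xi>)) + sin (x * \<xi>) * (J z * sin (z * \<xi>)))"
      by (intro Bochner_Integration.integral_cong refl) (simp add: cos_diff algebra_simps)
    also have "\<dots> = (1 - symbol \<xi>) * cos (x * \<xi>)"
      using integrable_J_cos[of \<xi>] integrable_J_sin[of \<xi>]
      by (simp add: integral_J_cos integral_J_sin)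
    finally show ?thesis .
  qed
  have J_int: "integrable lborel (\<lambda>y. J (x - y))"
    using lborel_integrable_real_affine[OF integrable_J, of "-1" x] by simp
  \<comment> \<open>For Fubini, the cosine is dropped and a product of integrable functions of y and
    of xi remains.\<close>
  have int: "integrable (lborel \<Otimes>\<^sub>M lborel) (\<lambda>(y, \<xi>). J (x - y) * (damp t \<xi> * cos (y * \<xi>)))"
  proof (rule Bochner_Integration.integrable_bound)
    show "integrable (lborel \<Otimes>\<^sub>M lborel) (\<lambda>(y, \<xi>). J (x - y) * damp t \<xi>)"
    proof (rule lborel_pair.Fubini_integrable)
      show "integrable lborel (\<lambda>y. LBINT \<xi>. norm (case (y, \<xi>) of (y, \<xi>) \<Rightarrow> J (x - y) * damp t \<xi>))"
        using J_int by (simp add: abs_mult)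
    qed (use integrable_damp[OF t] in \<open>auto simp: split_beta\<close>)
    show "AE p in lborel \<Otimes>\<^sub>M lborel. norm (case p of (y, \<xi>) \<Rightarrow> J (x - y) * (damp t \<xi> * cos (y * \<xi>)))
        \<le> norm (case p of (y, \<xi>) \<Rightarrow> J (x - y) * damp t \<xi>)"
      by (intro AE_I2) (auto simp: abs_mult mult_left_le intro!: mult_left_mono)
  qed (simp add: split_beta)
  have "conv (\<lambda>y. heat y t) x = (LINT y|lborel. J (x - y) * heat y t)"
    unfolding Defs.convolution_def by (rule integral_completion) measurable
  also have "\<dots> = (LINT y|lborel. LINT \<xi>|lborel. J (x - y) * (damp t \<xi> * cos (y * \<xi>)))"
    by (simp add: heat_def)
  also have "\<dots> = (LINT \<xi>|lborel. LINT y|lborel. J (x - y) * (damp t \<xi> * cos (y * \<xi>)))"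
    using int by (rule lborel_pair.Fubini_integral[symmetric])
  also have "\<dots> = (LINT \<xi>|lborel. damp t \<xi> * ((1 - symbol \<xi>) * cos (x * \<xi>)))"
  proof (intro Bochner_Integration.integral_cong refl)
    fix \<xi>
    have "(LINT y|lborel. J (x - y) * (damp t \<xi> * cos (y * \<xi>)))
        = (LINT y|lborel. damp t \<xi> * (J (x - y) * cos (y * \<xi>)))"
      by (simp add: mult_ac)
    then show "(LINT y|lborel. J (x - y) * (damp t \<xi> * cos (y * \<xi>))) = damp t \<xi> * ((1 - symbol \<xi>) * cos (x * \<xi>))"
      by (simp add: inner)
  qed
  also have "\<dots> = heat x t - (LINT \<xi>|lborel. damp t \<xi> * (symbol \<xi> * cos (x * \<xi>)))"
    using integrable_damp_cos[OF t, of x] integrable_damp_symbol_cos[OF t, of x]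
    by (simp add: heat_def algebra_simps)
  finally show ?thesis by simp
qed

text \<open>The Taylor error of exp is at most (s - t)^2 symbol^2, and symbol <= 2 gives the 4. The
  bound is uniform in x and admits time 0, as \<open>test_family\<close> will demand of the backward
  kernel.\<close>

lemma heat_taylor1_bound:
  assumes t: "0 \<le> t" and s: "0 \<le> s"
  shows "\<bar>heat x s - heat x t - (s - t) * nonlocal_op J (\<lambda>y. heat y t) x\<bar> \<le> 4 * (s - t)^2"
proof -
  have eq: "heat x s - heat x t - (s - t) * nonlocal_op J (\<lambda>y. heat y t) x
     = (LINT \<xi>|lborel. damp s \<xi> * cos (x * \<xi>) - damp t \<xi> * cos (x * \<xi>)
          + (s - t) * (damp t \<xi> * (symbol \<xi> * cos (x * \<xi>))))"
    unfolding nonlocal_op_def conv_heat[OF t]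
    using integrable_damp_cos[OF t, of x] integrable_damp_cos[OF s, of x]
      integrable_damp_symbol_cos[OF t, of x]
    by (simp add: heat_def)
  have "\<bar>LINT \<xi>|lborel. damp s \<xi> * cos (x * \<xi>) - damp t \<xi> * cos (x * \<xi>)
          + (s - t) * (damp t \<xi> * (symbol \<xi> * cos (x * \<xi>)))\<bar> \<le> (LINT \<xi>|lborel. std_normal_density \<xi> * (4 * (s - t)^2))"
  proof (rule abs_integral_le_integrable)
    fix \<xi>
    let ?a = "t * symbol \<xi>" and ?b = "s * symbol \<xi>"
    have "damp s \<xi> * cos (x * \<xi>) - damp t \<xi> * cos (x * \<xi>) + (s - t) * (damp t \<xi> * (symbol \<xi> * cos (x * \<xi>)))
      = std_normal_density \<xi> * ((exp (- ?b) - exp (- ?a) + (?b - ?a) * exp (- ?a)) * cos (x * \<xi>))"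
      by (simp add: damp_def algebra_simps)
    also have "\<bar>\<dots>\<bar> \<le> std_normal_density \<xi> * ((?b - ?a)^2 * 1)"
      unfolding abs_mult using s t symbol_nonneg[of \<xi>]
      by (intro mult_mono exp_taylor1_bound) auto
    also have "(?b - ?a)^2 = (symbol \<xi>)^2 * (s - t)^2"
      by (simp add: left_diff_distrib[symmetric] power_mult_distrib)
    also have "std_normal_density \<xi> * (\<dots> * 1) \<le> std_normal_density \<xi> * (2^2 * (s - t)^2 * 1)"
      by (intro mult_left_mono mult_right_mono power_mono symbol_le_2 symbol_nonneg) auto
    also have "2^2 * (s - t)^2 * 1 = 4 * (s - t)^2" by simp
    finally show "\<bar>damp s \<xi> * cos (x * \<xi>) - damp t \<xi> * cos (x * \<xi>) + (s - t) * (damp t \<xi> * (symbol \<xi> * cos (x * \<xi>)))\<bar>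
        \<le> std_normal_density \<xi> * (4 * (s - t)^2)" .
  next
    show "integrable lborel (\<lambda>\<xi>. std_normal_density \<xi> * (4 * (s - t)^2))"
      by (intro integrable_mult_left integrable_normal_density) simp
    show "(\<lambda>\<xi>. damp s \<xi> * cos (x * \<xi>) - damp t \<xi> * cos (x * \<xi>)
        + (s - t) * (damp t \<xi> * (symbol \<xi> * cos (x * \<xi>)))) \<in> borel_measurable lborel"
      by measurable
  qed
  also have "(LINT \<xi>|lborel. std_normal_density \<xi> * (4 * (s - t)^2)) = 4 * (s - t)^2"
    by (simp only: integral_mult_left_zero integral_normal_density[OF zero_less_one] mult_1)
  finally show ?thesis by (simp only: eq)
qed

lemma DERIV_heat:
  assumes "0 < t"
  shows "((\<lambda>t. heat x t) has_real_derivative nonlocal_op J (\<lambda>y. heat y t) x) (at t)"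
proof -
  have "((\<lambda>t. heat x t) has_real_derivative nonlocal_op J (\<lambda>y. heat y t) x) (at t within {0<..})"
    by (rule has_real_derivative_quadratic_error[where C = 4]) (use assms heat_taylor1_bound in auto)
  then show ?thesis using assms by (simp add: at_within_open[of _ "{0<..}"])
qed

lemma continuous_on_heat: "continuous_on {0..} (heat x)"
proof -
  have "(heat x has_real_derivative nonlocal_op J (\<lambda>y. heat y t) x) (at t within {0..})" if "0 \<le> t" for t
    by (rule has_real_derivative_quadratic_error[where C = 4]) (use that heat_taylor1_bound in auto)
  then show ?thesis by (auto intro!: DERIV_continuous_on)
qed

text \<open>
  Positivity is the comparison principle: \<^term>\<open>exp t * heat x t\<close> has time derivative
  \<^term>\<open>exp t * conv (\<lambda>y. heat y t) x\<close>, so a lower bound of the form \<open>- B t^n / n!\<close>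
  improves to the next \<open>n\<close>.
\<close>

lemma heat_nonneg:
  assumes "0 \<le> t"
  shows "0 \<le> heat x t"
proof -
  define B where "B = exp t"
  have bound: "- (B * (s^n / fact n)) \<le> exp s * heat x s" if "0 \<le> s" "s \<le> t" for n s x
    using that
  proof (induction n arbitrary: s x)
    case 0
    have "exp s * \<bar>heat x s\<bar> \<le> B * 1"
      unfolding B_def using 0 by (intro mult_mono heat_le_1) auto
    then have "\<bar>exp s * heat x s\<bar> \<le> B" by (simp add: abs_mult)
    then show ?case by simp
  next
    case (Suc n)
    define F where "F r = exp r * heat x r + B * (r ^ Suc n / fact (Suc n))" for r
    have "F 0 \<le> F s"
    proof (rule DERIV_nonneg_imp_increasing_open[OF Suc.prems(1)])
      fix r assume r: "0 < r" "r < s"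
      have "(F has_real_derivative exp r * nonlocal_op J (\<lambda>y. heat y r) x + exp r * heat x r
          + B * (r ^ n / fact n)) (at r)"
        unfolding F_def by (rule DERIV_add DERIV_mult' DERIV_exp DERIV_heat DERIV_cmult DERIV_power_over_fact r)+
      moreover have "exp r * nonlocal_op J (\<lambda>y. heat y r) x + exp r * heat x r
          = exp r * conv (\<lambda>y. heat y r) x"
        by (simp add: nonlocal_op_def algebra_simps)
      ultimately have D: "(F has_real_derivative exp r * conv (\<lambda>y. heat y r) x + B * (r ^ n / fact n)) (at r)"
        by simp
      have "- (B * (r ^ n / fact n)) = (LINT y|lborel. J (x - y) * - (B * (r ^ n / fact n)))"
        using lborel_integral_real_affine[of "-1" J x] integral_J by simp
      also have "\<dots> \<le> (LINT y|lborel. exp r * (J (x - y) * heat y r))"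
      proof (rule integral_mono)
        show "integrable lborel (\<lambda>y. J (x - y) * - (B * (r ^ n / fact n)))"
          using lborel_integrable_real_affine[OF integrable_J, of "-1" x] by simp
        show "integrable lborel (\<lambda>y. exp r * (J (x - y) * heat y r))"
          using integrable_J_diff_heat[of r x] r by simp
        fix y
        have "J (x - y) * - (B * (r ^ n / fact n)) \<le> J (x - y) * (exp r * heat y r)"
          using r Suc.prems by (intro mult_left_mono Suc.IH J_nonneg) auto
        then show "J (x - y) * - (B * (r ^ n / fact n)) \<le> exp r * (J (x - y) * heat y r)"
          by (simp add: mult_ac)
      qed
      also have "\<dots> = exp r * conv (\<lambda>y. heat y r) x"
        unfolding Defs.convolution_def by (simp add: integral_completion)
      finally show "\<exists>D. (F has_real_derivative D) (at r) \<and> 0 \<le> D"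
        using D by (intro exI[of _ "exp r * conv (\<lambda>y. heat y r) x + B * (r ^ n / fact n)"]) auto
    next
      show "continuous_on {0..s} F"
        unfolding F_def
        by (intro continuous_intros continuous_on_subset[OF continuous_on_heat]) auto
    qed
    moreover have "0 \<le> F 0" by (simp add: F_def heat_0)
    ultimately show ?case by (simp add: F_def)
  qed
  have "(\<lambda>n. - (B * (t^n / fact n))) \<longlonglongrightarrow> - (B * 0)"
    using summable_LIMSEQ_zero[OF summable_exp[of t]]
    by (intro tendsto_intros) (simp add: divide_inverse mult.commute)
  then have "- (B * 0) \<le> exp t * heat x t"
    by (rule LIMSEQ_le_const2) (use bound[OF assms order_refl] in auto)
  then show ?thesis by (simp add: zero_le_mult_iff)
qed

section \<open>Decay of the heat kernel in time and space\<close>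

text \<open>By \<open>symbol_lower_bound\<close>, \<open>damp\<close> is below a Gaussian of width
  t^(-1/2) at low frequencies and below exp(-(\<beta> t)) times the normal density at the others.
  The total mass of the Gaussian scales as t^(-1/2), its absolute first moment as t^(-1), and the
  exponential is below both powers up to constants.\<close>

lemma damp_gaussian_bound:
  obtains c where "0 < c"
    "\<And>t. 0 < t \<Longrightarrow> (LINT \<xi>|lborel. damp t \<xi>) \<le> c / sqrt t"
    "\<And>t. 0 < t \<Longrightarrow> integrable lborel (\<lambda>\<xi>. \<bar>\<xi>\<bar> * damp t \<xi>)"
    "\<And>t. 0 < t \<Longrightarrow> (LINT \<xi>|lborel. \<bar>\<xi>\<bar> * damp t \<xi>) \<le> c / t"
proof -
  obtain \<alpha> \<beta> where ab: "0 < \<alpha>" "0 < \<beta>" and sym: "\<And>\<xi>. min (\<alpha> * \<xi>^2) \<beta> \<le> symbol \<xi>"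
    by (rule symbol_lower_bound) blast
  \<comment> \<open>Chosen so that exp(-(\<alpha> t xi^2)) is the exponential in a centred normal
    density of deviation \<open>\<sigma> t\<close>.\<close>
  define \<sigma> where "\<sigma> t = 1 / sqrt (2 * \<alpha> * t)" for t
  have \<sigma>_pos: "0 < \<sigma> t" if "0 < t" for t using that ab by (simp add: \<sigma>_def)
  have \<sigma>2: "(\<sigma> t)^2 = 1 / (2 * \<alpha> * t)" if "0 < t" for t using that ab by (simp add: \<sigma>_def power_divide)
  have gauss: "std_normal_density \<xi> * exp (- (\<alpha> * t * \<xi>^2)) \<le> \<sigma> t * normal_density 0 (\<sigma> t) \<xi>"
    if t: "0 < t" for t \<xi>
  proof -
    have "\<sigma> t * normal_density 0 (\<sigma> t) \<xi> = 1 / sqrt (2 * pi) * exp (- (\<alpha> * t * \<xi>^2))"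
    proof -
      have "sqrt (2 * pi * (\<sigma> t)^2) = sqrt (2 * pi) * \<sigma> t"
        using \<sigma>_pos[OF t] by (simp add: real_sqrt_mult)
      moreover have "- ((\<xi> - 0)^2) / (2 * (\<sigma> t)^2) = - (\<alpha> * t * \<xi>^2)"
        using t ab by (simp add: \<sigma>2 field_simps)
      ultimately show ?thesis
        unfolding normal_density_def using \<sigma>_pos[OF t] by simp
    qed
    moreover have "std_normal_density \<xi> \<le> 1 / sqrt (2 * pi)"
      unfolding std_normal_density_def by (simp add: mult_left_le divide_right_mono)
    ultimately show ?thesis by (simp only: mult_right_mono exp_ge_zero)
  qed
  have damp_split: "damp t \<xi> \<le> \<sigma> t * normal_density 0 (\<sigma> t) \<xi> + exp (- (\<beta> * t)) * std_normal_density \<xi>"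
    if t: "0 < t" for t \<xi>
  proof (cases "\<alpha> * \<xi>^2 \<le> \<beta>")
    case True
    then have "t * (\<alpha> * \<xi>^2) \<le> t * symbol \<xi>"
      using sym[of \<xi>] t by (intro mult_left_mono) auto
    then have "damp t \<xi> \<le> std_normal_density \<xi> * exp (- (\<alpha> * t * \<xi>^2))"
      unfolding damp_def by (intro mult_left_mono) (auto simp: mult_ac)
    then show ?thesis using gauss[OF t, of \<xi>] by (simp add: add_increasing2)
  next
    case False
    then have "t * \<beta> \<le> t * symbol \<xi>"
      using sym[of \<xi>] t by (intro mult_left_mono) auto
    then have "damp t \<xi> \<le> std_normal_density \<xi> * exp (- (\<beta> * t))"
      unfolding damp_def by (intro mult_left_mono) (auto simp: mult_ac)
    moreover have "0 \<le> \<sigma> t * normal_density 0 (\<sigma> t) \<xi>" using \<sigma>_pos[OF t] by simp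
    ultimately show ?thesis by (simp add: mult_ac)
  qed
  have e1: "exp (- (\<beta> * t)) \<le> 1 / (\<beta> * t)" if "0 < t" for t
  proof -
    have "\<beta> * t \<le> exp (\<beta> * t)" using exp_ge_add_one_self[of "\<beta> * t"] by linarith
    then show ?thesis using that ab by (simp add: exp_minus field_simps)
  qed
  have e2: "exp (- (\<beta> * t)) \<le> 1 / sqrt (\<beta> * t)" if t: "0 < t" for t
  proof -
    have "sqrt (\<beta> * t) \<le> (1 + \<beta> * t) / 2"
      using arith_geo_mean_sqrt[of 1 "\<beta> * t"] t ab by simp
    also have "\<dots> \<le> exp (\<beta> * t) / 2"
      by (intro divide_right_mono exp_ge_add_one_self) simp
    also have "\<dots> \<le> exp (\<beta> * t)" by simp
    finally show ?thesis using t ab by (simp add: exp_minus field_simps)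
  qed
  \<comment> \<open>The absolute first moment of the standard normal law, at most 1 because 2 <=
    pi.\<close>
  define m where "m = sqrt (2 / pi)"
  have m: "0 \<le> m" "m \<le> 1" using pi_ge_two by (simp_all add: m_def)
  have abs_moment: "integrable lborel (\<lambda>\<xi>. normal_density 0 s \<xi> * \<bar>\<xi>\<bar>)"
      "(LINT \<xi>|lborel. normal_density 0 s \<xi> * \<bar>\<xi>\<bar>) = s * m" if "0 < s" for s :: real
    using normal_moment_abs_odd[OF that, of 0 0]
    by (auto simp: has_bochner_integral_iff m_def)
  define c where "c = 1 / (2 * \<alpha>) + 1 / \<beta> + 1 / sqrt (2 * \<alpha>) + 1 / sqrt \<beta>"
  have c: "0 < c" "1 / (2 * \<alpha>) + 1 / \<beta> \<le> c" "1 / sqrt (2 * \<alpha>) + 1 / sqrt \<beta> \<le> c"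
    using ab by (auto simp: c_def intro!: add_pos_pos)
  show ?thesis
  proof (rule that[of c])
    fix t :: real assume t: "0 < t"
    note s = \<sigma>_pos[OF t]
    have "(LINT \<xi>|lborel. damp t \<xi>)
        \<le> (LINT \<xi>|lborel. \<sigma> t * normal_density 0 (\<sigma> t) \<xi> + exp (- (\<beta> * t)) * std_normal_density \<xi>)"
      using t s by (intro integral_mono damp_split integrable_damp) auto
    also have "\<dots> = \<sigma> t + exp (- (\<beta> * t))"
      using s by simp
    also have "\<dots> \<le> (1 / sqrt (2 * \<alpha>) + 1 / sqrt \<beta>) / sqrt t"
      using e2[OF t] by (simp add: \<sigma>_def real_sqrt_mult add_divide_distrib)
    also have "\<dots> \<le> c / sqrt t"
      using c t by (intro divide_right_mono) auto
    finally show "(LINT \<xi>|lborel. damp t \<xi>) \<le> c / sqrt t" .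
    let ?g = "\<lambda>\<xi>. \<sigma> t * (normal_density 0 (\<sigma> t) \<xi> * \<bar>\<xi>\<bar>) + exp (- (\<beta> * t)) * (std_normal_density \<xi> * \<bar>\<xi>\<bar>)"
    have g: "integrable lborel ?g"
      using abs_moment[OF s] abs_moment[of 1] by simp
    have le: "\<bar>\<xi>\<bar> * damp t \<xi> \<le> ?g \<xi>" for \<xi>
      using mult_left_mono[OF damp_split[OF t, of \<xi>], of "\<bar>\<xi>\<bar>"] by (simp add: algebra_simps)
    show int: "integrable lborel (\<lambda>\<xi>. \<bar>\<xi>\<bar> * damp t \<xi>)"
    proof (rule Bochner_Integration.integrable_bound[OF g])
      have "norm (\<bar>\<xi>\<bar> * damp t \<xi>) \<le> norm (?g \<xi>)" for \<xi>
      proof -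
        have "norm (\<bar>\<xi>\<bar> * damp t \<xi>) = \<bar>\<xi>\<bar> * damp t \<xi>"
          using damp_pos[of t \<xi>] by (simp add: abs_mult)
        also have "\<dots> \<le> ?g \<xi>" by (rule le)
        also have "?g \<xi> \<le> norm (?g \<xi>)" by simp
        finally show ?thesis .
      qed
      then show "AE \<xi> in lborel. norm (\<bar>\<xi>\<bar> * damp t \<xi>) \<le> norm (?g \<xi>)" by simp
    qed measurable
    have "(LINT \<xi>|lborel. \<bar>\<xi>\<bar> * damp t \<xi>) \<le> (LINT \<xi>|lborel. ?g \<xi>)"
      using int g le by (rule integral_mono)
    also have "\<dots> = \<sigma> t * (\<sigma> t * m) + exp (- (\<beta> * t)) * m"
      using abs_moment[OF s] abs_moment[of 1] by simp
    also have "\<dots> = ((\<sigma> t)^2 + exp (- (\<beta> * t))) * m" by (simp add: power2_eq_square algebra_simps)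
    also have "\<dots> \<le> ((\<sigma> t)^2 + exp (- (\<beta> * t))) * 1" using m by (intro mult_left_mono) auto
    also have "\<dots> \<le> (1 / (2 * \<alpha>) + 1 / \<beta>) / t"
      using e1[OF t] t by (simp add: \<sigma>2 add_divide_distrib)
    also have "\<dots> \<le> c / t" using c t by (intro divide_right_mono) auto
    finally show "(LINT \<xi>|lborel. \<bar>\<xi>\<bar> * damp t \<xi>) \<le> c / t" .
  qed (rule c)
qed

lemma DERIV_damp: "(damp t has_real_derivative damp t \<xi> * (- \<xi> - t * symbol' \<xi>)) (at \<xi>)"
proof -
  define c where "c = 1 / sqrt (2 * pi)"
  have damp: "damp t = (\<lambda>\<xi>. c * (exp (- (\<xi>^2 / 2)) * exp (- (t * symbol \<xi>))))"
    unfolding damp_def[abs_def] std_normal_density_def c_def minus_divide_left[symmetric]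
    by (simp only: mult.assoc)
  show ?thesis
    unfolding damp by (auto intro!: derivative_eq_intros DERIV_symbol simp: algebra_simps)
qed

text \<open>x cos (x xi) is the xi-derivative of sin (x xi); it is moved onto \<open>damp\<close>,
  whose logarithmic derivative is -(xi + t symbol' xi). The linear bound
  \<open>abs_symbol'_le\<close> makes the new integrand integrable, and the Gaussian factor removes
  the boundary terms.\<close>

lemma heat_integration_by_parts:
  assumes t: "0 \<le> t" and int: "integrable lborel (\<lambda>\<xi>. \<bar>\<xi>\<bar> * damp t \<xi>)"
  shows "x * heat x t = (LINT \<xi>|lborel. damp t \<xi> * (\<xi> + t * symbol' \<xi>) * sin (x * \<xi>))"
proof -
  define f where "f \<xi> = x * (damp t \<xi> * cos (x * \<xi>)) - damp t \<xi> * (\<xi> + t * symbol' \<xi>) * sin (x * \<xi>)" for \<xi>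
  define F where "F \<xi> = damp t \<xi> * sin (x * \<xi>)" for \<xi>
  have cont_damp: "isCont (damp t) \<xi>" for \<xi>
    using DERIV_damp by (rule DERIV_isCont)
  have int1: "integrable lborel (\<lambda>\<xi>. x * (damp t \<xi> * cos (x * \<xi>)))"
    using integrable_damp_cos[OF t] by simp
  have int2: "integrable lborel (\<lambda>\<xi>. damp t \<xi> * (\<xi> + t * symbol' \<xi>) * sin (x * \<xi>))"
  proof (rule Bochner_Integration.integrable_bound)
    show "integrable lborel (\<lambda>\<xi>. (1 + t * d^2) * (\<bar>\<xi>\<bar> * damp t \<xi>))" using int by simp
    have "\<bar>damp t \<xi> * (\<xi> + t * symbol' \<xi>) * sin (x * \<xi>)\<bar> \<le> (1 + t * d^2) * (\<bar>\<xi>\<bar> * damp t \<xi>)" for \<xi>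
    proof -
      have "\<bar>\<xi> + t * symbol' \<xi>\<bar> \<le> \<bar>\<xi>\<bar> + t * (d^2 * \<bar>\<xi>\<bar>)"
        using abs_symbol'_le[of \<xi>] t
        by (intro order_trans[OF abs_triangle_ineq] add_mono) (auto simp: abs_mult intro!: mult_left_mono)
      then have "\<bar>damp t \<xi> * (\<xi> + t * symbol' \<xi>) * sin (x * \<xi>)\<bar> \<le> damp t \<xi> * (\<bar>\<xi>\<bar> + t * (d^2 * \<bar>\<xi>\<bar>)) * 1"
        unfolding abs_mult using damp_pos[of t \<xi>] t by (intro mult_mono) auto
      then show ?thesis by (simp add: algebra_simps)
    qed
    then show "AE \<xi> in lborel. norm (damp t \<xi> * (\<xi> + t * symbol' \<xi>) * sin (x * \<xi>))
        \<le> norm ((1 + t * d^2) * (\<bar>\<xi>\<bar> * damp t \<xi>))"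
      by (intro AE_I2) (metis abs_ge_self order_trans real_norm_def)
  qed measurable
  \<comment> \<open>One argument for both ends of the line: the majorant depends on xi only through
    xi^2.\<close>
  have lim: "(F \<longlongrightarrow> 0) G" if G: "filterlim (\<lambda>\<xi>. \<xi>^2) at_top G" for G
  proof (rule Lim_null_comparison)
    show "\<forall>\<^sub>F \<xi> in G. norm (F \<xi>) \<le> exp (- (\<xi>^2 / 2))"
    proof (intro always_eventually allI)
      fix \<xi>
      have "std_normal_density \<xi> \<le> exp (- (\<xi>^2 / 2))"
        unfolding std_normal_density_def using pi_ge_two by (simp add: field_simps real_le_rsqrt)
      then have "damp t \<xi> \<le> exp (- (\<xi>^2 / 2))"
        using damp_le[OF t, of \<xi>] by simp
      then have "\<bar>damp t \<xi>\<bar> * \<bar>sin (x * \<xi>)\<bar> \<le> exp (- (\<xi>^2 / 2)) * 1"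
        using damp_pos[of t \<xi>] by (intro mult_mono) auto
      then show "norm (F \<xi>) \<le> exp (- (\<xi>^2 / 2))"
        by (simp add: F_def abs_mult)
    qed
    have "filterlim (\<lambda>\<xi>. 1/2 * \<xi>^2) at_top G"
      using G by (rule filterlim_tendsto_pos_mult_at_top[rotated 2]) auto
    then have "filterlim (\<lambda>\<xi>. - (\<xi>^2 / 2)) at_bot G"
      by (simp add: filterlim_uminus_at_bot)
    then show "((\<lambda>\<xi>. exp (- (\<xi>^2 / 2))) \<longlongrightarrow> 0) G"
      by (rule filterlim_compose[OF exp_at_bot])
  qed
  have "(LBINT \<xi>=-\<infinity>..\<infinity>. f \<xi>) = 0 - 0"
  proof (rule interval_integral_FTC_integrable[where F = F])
    show "(F has_vector_derivative f \<xi>) (at \<xi>)" for \<xi>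
      unfolding F_def f_def has_real_derivative_iff_has_vector_derivative[symmetric]
      by (auto intro!: derivative_eq_intros DERIV_damp simp: algebra_simps)
    show "isCont f \<xi>" for \<xi>
      unfolding f_def by (intro continuous_intros cont_damp continuous_symbol')
    show "set_integrable lborel (einterval (- \<infinity>) \<infinity>) f"
      using int1 int2 by (simp add: set_integrable_def f_def einterval_def)
    show "((F \<circ> real_of_ereal) \<longlongrightarrow> 0) (at_left \<infinity>)" "((F \<circ> real_of_ereal) \<longlongrightarrow> 0) (at_right (- \<infinity>))"
      by (simp_all add: ereal_tendsto_simps filterlim_pow_at_bot_even filterlim_pow_at_top filterlim_ident lim)
  qed simp
  then have "(LINT \<xi>|lborel. f \<xi>) = 0"
    by (simp add: interval_lebesgue_integral_def set_lebesgue_integral_def einterval_def)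
  then show ?thesis
    using int1 int2 by (simp add: f_def heat_def)
qed

text \<open>
  The second bound, which gives the decay away from the diffusive scale, is one integration by
  parts in the Fourier variable.
\<close>

lemma heat_bounds:
  obtains C where "0 < C" "\<And>x t. 0 < t \<Longrightarrow> heat x t \<le> C / sqrt t"
    "\<And>x t. 1 \<le> t \<Longrightarrow> \<bar>x\<bar> * heat x t \<le> C"
proof -
  obtain c where c: "0 < c"
    "\<And>t. 0 < t \<Longrightarrow> (LINT \<xi>|lborel. damp t \<xi>) \<le> c / sqrt t"
    "\<And>t. 0 < t \<Longrightarrow> integrable lborel (\<lambda>\<xi>. \<bar>\<xi>\<bar> * damp t \<xi>)"
    "\<And>t. 0 < t \<Longrightarrow> (LINT \<xi>|lborel. \<bar>\<xi>\<bar> * damp t \<xi>) \<le> c / t"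
    by (rule damp_gaussian_bound) blast
  show ?thesis
  proof (rule that[of "(1 + d^2) * c"])
    show "0 < (1 + d^2) * c" using c by (simp add: add_pos_nonneg)
    fix x t :: real
    {
      assume t: "0 < t"
      have "heat x t \<le> c / sqrt t"
        using heat_le_integral_damp[of t x] c(2)[OF t] t by simp
      also have "\<dots> \<le> (1 + d^2) * c / sqrt t"
        using c(1) t by (intro divide_right_mono) auto
      finally show "heat x t \<le> (1 + d^2) * c / sqrt t" .
    next
      assume t1: "1 \<le> t"
      then have t: "0 < t" by simp
      have "\<bar>x\<bar> * heat x t = \<bar>x * heat x t\<bar>"
        using heat_nonneg[of t x] t by (simp add: abs_mult)
      also have "\<dots> = \<bar>LINT \<xi>|lborel. damp t \<xi> * (\<xi> + t * symbol' \<xi>) * sin (x * \<xi>)\<bar>"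
        using heat_integration_by_parts[of t x] c(3)[OF t] t by simp
      also have "\<dots> \<le> (LINT \<xi>|lborel. (1 + t * d^2) * (\<bar>\<xi>\<bar> * damp t \<xi>))"
      proof (rule abs_integral_le_integrable)
        show "(\<lambda>\<xi>. damp t \<xi> * (\<xi> + t * symbol' \<xi>) * sin (x * \<xi>)) \<in> borel_measurable lborel" by measurable
        fix \<xi>
        have "\<bar>\<xi> + t * symbol' \<xi>\<bar> \<le> \<bar>\<xi>\<bar> + t * (d^2 * \<bar>\<xi>\<bar>)"
          using abs_symbol'_le[of \<xi>] t
          by (intro order_trans[OF abs_triangle_ineq] add_mono) (auto simp: abs_mult intro!: mult_left_mono)
        then have "\<bar>damp t \<xi> * (\<xi> + t * symbol' \<xi>) * sin (x * \<xi>)\<bar> \<le> damp t \<xi> * (\<bar>\<xi>\<bar> + t * (d^2 * \<bar>\<xi>\<bar>)) * 1"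
          unfolding abs_mult using damp_pos[of t \<xi>] t by (intro mult_mono) auto
        then show "\<bar>damp t \<xi> * (\<xi> + t * symbol' \<xi>) * sin (x * \<xi>)\<bar> \<le> (1 + t * d^2) * (\<bar>\<xi>\<bar> * damp t \<xi>)"
          by (simp add: algebra_simps)
      qed (use c(3)[OF t] in simp)
      also have "\<dots> \<le> (1 + t * d^2) * (c / t)"
        unfolding integral_mult_right_zero using c(4)[OF t] t by (intro mult_left_mono) auto
      \<comment> \<open>The factor t created by differentiating exp(-t symbol) is cancelled by the
        1/t of the frequency moment; 1 <= t absorbs the remaining 1/t.\<close>
      also have "\<dots> = (1 / t + d^2) * c" using t by (simp add: field_simps)
      also have "\<dots> \<le> (1 + d^2) * c"
        using t1 c(1) by (intro mult_right_mono add_mono) auto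
      finally show "\<bar>x\<bar> * heat x t \<le> (1 + d^2) * c" .
    }
  qed
qed

end

section \<open>Convolution on the weighted space\<close>

text \<open>Fubini is needed for the completed measure because \<open>u\<close> is only Lebesgue
  measurable; a countable Borel cover by sets of finite measure serves the completion as
  well.\<close>

lemma sigma_finite_lebesgue: "sigma_finite_measure (lebesgue :: 'a::euclidean_space measure)"
proof
  obtain A :: "'a set set" where "countable A" "A \<subseteq> sets lborel" "\<Union>A = space lborel"
    "\<forall>a\<in>A. emeasure lborel a \<noteq> \<infinity>"
    using lborel.sigma_finite_countable by blast
  then show "\<exists>A::'a set set. countable A \<and> A \<subseteq> sets lebesgue \<and> \<Union>A = space lebesgue
      \<and> (\<forall>a\<in>A. emeasure lebesgue a \<noteq> \<infinity>)"
    by (intro exI[of _ A]) (auto simp: subset_iff)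
qed

lemma integrable_weighted_lebesgue_iff:
  "integrable weighted_lebesgue f \<longleftrightarrow> f \<in> borel_measurable lebesgue \<and> integrable lebesgue (\<lambda>x. (1 + x^2) * f x)"
proof -
  have [measurable]: "(\<lambda>x::real. 1 + x^2) \<in> borel_measurable lebesgue"
    by (rule measurable_completion) measurable
  have "integrable weighted_lebesgue f \<longleftrightarrow> integrable lebesgue (\<lambda>x. (1 + x^2) * f x)"
    if "f \<in> borel_measurable lebesgue"
    unfolding weighted_lebesgue_def using that by (subst integrable_density) auto
  moreover have "f \<in> borel_measurable lebesgue" if "integrable weighted_lebesgue f"
    using borel_measurable_integrable[OF that] by (simp add: weighted_lebesgue_def cong: measurable_cong_sets)
  ultimately show ?thesis by blast
qed

text \<open>The weight of the solution space pays for quadratic growth; this is the growth condition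
  imposed on every test function \<open>k\<close> below.\<close>

lemma integrable_lebesgue_weight_bound:
  assumes "integrable weighted_lebesgue f" "k \<in> borel_measurable lebesgue"
    "\<And>x. \<bar>k x\<bar> \<le> C * (1 + x^2)"
  shows "integrable lebesgue (\<lambda>x. k x * f x)"
proof (rule Bochner_Integration.integrable_bound)
  show "integrable lebesgue (\<lambda>x. C * ((1 + x^2) * f x))"
    using assms(1) by (simp add: integrable_weighted_lebesgue_iff)
  show "(\<lambda>x. k x * f x) \<in> borel_measurable lebesgue"
    using assms(1,2) by (auto simp: integrable_weighted_lebesgue_iff)
  have "\<bar>k x * f x\<bar> \<le> \<bar>C * ((1 + x^2) * f x)\<bar>" for x
  proof -
    have "\<bar>k x\<bar> * \<bar>f x\<bar> \<le> \<bar>C * (1 + x^2)\<bar> * \<bar>f x\<bar>"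
      using assms(3)[of x] by (intro mult_right_mono) auto
    then show ?thesis by (simp add: abs_mult mult_ac)
  qed
  then show "AE x in lebesgue. norm (k x * f x) \<le> norm (C * ((1 + x^2) * f x))"
    by simp
qed

lemma integral_lebesgue_weight_bound:
  assumes f: "integrable weighted_lebesgue f" and "k \<in> borel_measurable lebesgue"
    and "\<And>x. \<bar>k x\<bar> \<le> C * (1 + x^2)"
  shows "\<bar>LINT x|lebesgue. k x * f x\<bar> \<le> C * (LINT x|lebesgue. (1 + x^2) * \<bar>f x\<bar>)"
proof -
  have "\<bar>LINT x|lebesgue. k x * f x\<bar> \<le> (LINT x|lebesgue. C * ((1 + x^2) * \<bar>f x\<bar>))"
  proof (rule integral_abs_bound_integral)
    show "integrable lebesgue (\<lambda>x. k x * f x)" by (rule integrable_lebesgue_weight_bound) fact+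
    have "integrable lebesgue (\<lambda>x. \<bar>(1 + x^2) * f x\<bar>)"
      using f by (simp add: integrable_weighted_lebesgue_iff)
    then show "integrable lebesgue (\<lambda>x. C * ((1 + x^2) * \<bar>f x\<bar>))" by (simp add: abs_mult)
    fix x
    have "\<bar>k x\<bar> * \<bar>f x\<bar> \<le> (C * (1 + x^2)) * \<bar>f x\<bar>"
      using assms(3)[of x] by (intro mult_right_mono) auto
    then show "\<bar>k x * f x\<bar> \<le> C * ((1 + x^2) * \<bar>f x\<bar>)" by (simp add: abs_mult mult_ac)
  qed
  then show ?thesis by simp
qed

lemma integrable_weighted_lebesgue_integrable:
  fixes f :: "real \<Rightarrow> real"
  assumes "integrable weighted_lebesgue f"
  shows "integrable lebesgue f"
  using integrable_lebesgue_weight_bound[OF assms, of "\<lambda>_. 1" 1] by simp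

context dispersal_kernel begin

lemma integrable_J_shift: "integrable lebesgue (\<lambda>y. J (x - y))"
  and integral_J_shift: "(LINT y|lebesgue. J (x - y)) = 1"
proof -
  have "integrable lborel (\<lambda>y. J (x - y))"
    using lborel_integrable_real_affine[OF integrable_J, of "-1" x] by simp
  then show "integrable lebesgue (\<lambda>y. J (x - y))" by (simp add: integrable_completion)
  have "(LINT y|lborel. J (x - y)) = 1"
    using lborel_integral_real_affine[of "-1" J x] integral_J by simp
  then show "(LINT y|lebesgue. J (x - y)) = 1" by (simp add: integral_completion)
qed

lemma measurable_J_shift [measurable]: "(\<lambda>y. J (x - y)) \<in> borel_measurable lebesgue"
  by (rule measurable_completion) measurable

text \<open>Within the range d of the kernel, y^2 <= 2 d^2 + 2 x^2, so convolution preserves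
  quadratic growth up to a constant.\<close>

lemma J_weight_le:
  assumes "\<bar>k y\<bar> \<le> C * (1 + y^2)"
  shows "\<bar>J (x - y) * k y\<bar> \<le> C * (2 + 2 * d^2) * (1 + x^2) * J (x - y)"
proof (cases "\<bar>x - y\<bar> < d")
  case True
  have C: "0 \<le> C"
    using assms by (metis abs_ge_zero order_trans add_nonneg_pos zero_less_one zero_le_power2
        zero_le_mult_iff add.commute not_le)
  have "\<bar>y - x\<bar>^2 \<le> d^2" using True by (intro power_mono) auto
  then have 1: "(y - x)^2 \<le> d^2" by simp
  have "y^2 \<le> 2 * (y - x)^2 + 2 * x^2"
    using zero_le_power2[of "y - 2 * x"] by (simp add: power2_eq_square algebra_simps)
  then have "1 + y^2 \<le> 1 + 2 * d^2 + 2 * x^2" using 1 by simp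
  also have "\<dots> \<le> (2 + 2 * d^2) * (1 + x^2)"
    by (simp add: algebra_simps)
  finally have "C * (1 + y^2) \<le> C * ((2 + 2 * d^2) * (1 + x^2))" using C by (rule mult_left_mono)
  then have "\<bar>k y\<bar> \<le> C * (2 + 2 * d^2) * (1 + x^2)" using assms by simp
  then have "J (x - y) * \<bar>k y\<bar> \<le> J (x - y) * (C * (2 + 2 * d^2) * (1 + x^2))"
    by (rule mult_left_mono) (rule J_nonneg)
  then show ?thesis using J_nonneg[of "x - y"] by (simp add: abs_mult mult_ac)
qed (simp add: J_eq_0)

lemma integrable_J_weight:
  assumes "k \<in> borel_measurable lebesgue" "\<And>y. \<bar>k y\<bar> \<le> C * (1 + y^2)"
  shows "integrable lebesgue (\<lambda>y. J (x - y) * k y)"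
proof (rule Bochner_Integration.integrable_bound)
  show "integrable lebesgue (\<lambda>y. C * (2 + 2 * d^2) * (1 + x^2) * J (x - y))"
    using integrable_J_shift by simp
  show "AE y in lebesgue. norm (J (x - y) * k y) \<le> norm (C * (2 + 2 * d^2) * (1 + x^2) * J (x - y))"
    unfolding real_norm_def
    by (intro AE_I2 order_trans[OF J_weight_le[of k, OF assms(2)] abs_ge_self])
qed (use assms(1) in measurable)

lemma integral_abs_J_weight_le:
  assumes "k \<in> borel_measurable lebesgue" "\<And>y. \<bar>k y\<bar> \<le> C * (1 + y^2)"
  shows "(LINT y|lebesgue. \<bar>J (x - y) * k y\<bar>) \<le> C * (2 + 2 * d^2) * (1 + x^2)"
proof -
  have "(LINT y|lebesgue. \<bar>J (x - y) * k y\<bar>)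
      \<le> (LINT y|lebesgue. C * (2 + 2 * d^2) * (1 + x^2) * J (x - y))"
  proof (rule integral_mono)
    show "integrable lebesgue (\<lambda>y. \<bar>J (x - y) * k y\<bar>)"
      using integrable_J_weight[OF assms, of x] by (rule integrable_abs)
    show "integrable lebesgue (\<lambda>y. C * (2 + 2 * d^2) * (1 + x^2) * J (x - y))"
      using integrable_J_shift by simp
  qed (rule J_weight_le[of k, OF assms(2)])
  also have "\<dots> = C * (2 + 2 * d^2) * (1 + x^2)" by (simp add: integral_J_shift)
  finally show ?thesis .
qed

lemma conv_weight_le:
  assumes "k \<in> borel_measurable lebesgue" "\<And>y. \<bar>k y\<bar> \<le> C * (1 + y^2)"
  shows "\<bar>conv k x\<bar> \<le> C * (2 + 2 * d^2) * (1 + x^2)"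
  unfolding Defs.convolution_def
  using integral_abs_bound integral_abs_J_weight_le[OF assms, of x] by (rule order_trans)

text \<open>Convolution with an even kernel is symmetric. Fubini applies because the convolution of
  |k| with \<open>J\<close> still grows at most quadratically and can be paired with
  \<open>f\<close>.\<close>

lemma
  assumes f: "integrable weighted_lebesgue f"
    and k: "k \<in> borel_measurable lebesgue" "\<And>x. \<bar>k x\<bar> \<le> C * (1 + x^2)"
  shows integrable_mult_conv: "integrable lebesgue (\<lambda>x. k x * conv f x)"
    and integral_mult_conv: "(LINT x|lebesgue. k x * conv f x) = (LINT x|lebesgue. conv k x * f x)"
proof -
  interpret sigma_finite_measure "lebesgue :: real measure" by (rule sigma_finite_lebesgue)
  interpret P: pair_sigma_finite "lebesgue :: real measure" "lebesgue :: real measure" ..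
  note k(1)[measurable]
  have f_meas[measurable]: "f \<in> borel_measurable lebesgue"
    using f by (simp add: integrable_weighted_lebesgue_iff)
  have [measurable]: "(\<lambda>x::real. x) \<in> borel_measurable lebesgue"
    by (rule measurable_completion) measurable
  define G where "G x y = k x * (J (x - y) * f y)" for x y
  have G_meas: "(\<lambda>(y, x). G x y) \<in> borel_measurable (lebesgue \<Otimes>\<^sub>M lebesgue)"
    unfolding G_def by measurable
  have inner: "(LINT x|lebesgue. norm (G x y)) = (LINT x|lebesgue. \<bar>J (y - x) * k x\<bar>) * \<bar>f y\<bar>" for y
    by (simp add: G_def abs_mult J_diff_commute[of y] mult_ac flip: integral_mult_left_zero)
  have "integrable (lebesgue \<Otimes>\<^sub>M lebesgue) (\<lambda>(y, x). G x y)"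
  proof (rule P.Fubini_integrable[OF G_meas])
    have "integrable lebesgue (\<lambda>y. (LINT x|lebesgue. \<bar>J (y - x) * k x\<bar>) * \<bar>f y\<bar>)"
    proof (rule integrable_lebesgue_weight_bound)
      show "integrable weighted_lebesgue (\<lambda>y. \<bar>f y\<bar>)" using f by simp
      show "(\<lambda>y. LINT x|lebesgue. \<bar>J (y - x) * k x\<bar>) \<in> borel_measurable lebesgue"
        by measurable
      show "\<bar>LINT x|lebesgue. \<bar>J (y - x) * k x\<bar>\<bar> \<le> C * (2 + 2 * d^2) * (1 + y^2)" for y
        using integral_abs_J_weight_le[OF k, of y] by simp
    qed
    then show "integrable lebesgue (\<lambda>y. LINT x|lebesgue. norm (case (y, x) of (y, x) \<Rightarrow> G x y))"
      by (simp add: inner[unfolded real_norm_def])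
    have "integrable lebesgue (\<lambda>x. G x y)" for y
      using integrable_mult_left[OF integrable_J_weight[OF k, of y], of "f y"]
      by (simp add: G_def J_diff_commute[of y] mult_ac)
    then show "AE y in lebesgue. integrable lebesgue (\<lambda>x. case (y, x) of (y, x) \<Rightarrow> G x y)"
      by simp
  qed
  then have int: "integrable (lebesgue \<Otimes>\<^sub>M lebesgue) (\<lambda>(x, y). G x y)"
    using P.integrable_product_swap_iff[of "\<lambda>(x, y). G x y"] by (simp add: split_beta)
  have fst: "(LINT y|lebesgue. G x y) = k x * conv f x" for x
    by (simp add: G_def Defs.convolution_def)
  show "integrable lebesgue (\<lambda>x. k x * conv f x)"
    using P.integrable_fst[OF int] by (simp add: fst)
  have snd: "(LINT x|lebesgue. G x y) = conv k y * f y" for y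
    by (simp add: G_def Defs.convolution_def J_diff_commute[of y] mult_ac flip: integral_mult_left_zero)
  show "(LINT x|lebesgue. k x * conv f x) = (LINT x|lebesgue. conv k x * f x)"
    using P.Fubini_integral[OF int] by (simp add: fst snd)
qed

lemma integrable_mult_nonlocal_op:
  assumes f: "integrable weighted_lebesgue f"
    and k: "k \<in> borel_measurable lebesgue" "\<And>x. \<bar>k x\<bar> \<le> C * (1 + x^2)"
  shows "integrable lebesgue (\<lambda>x. k x * nonlocal_op J f x)"
  unfolding nonlocal_op_def right_diff_distrib
  using integrable_mult_conv[OF assms] integrable_lebesgue_weight_bound[OF assms] by simp

lemma abs_conv_le:
  assumes "integrable lebesgue f"
  shows "\<bar>conv f x\<bar> \<le> J 0 * (LINT y|lebesgue. \<bar>f y\<bar>)"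
proof -
  have "\<bar>conv f x\<bar> \<le> (LINT y|lebesgue. J 0 * \<bar>f y\<bar>)"
    unfolding Defs.convolution_def
  proof (rule integral_abs_bound_integral)
    show le: "\<bar>J (x - y) * f y\<bar> \<le> J 0 * \<bar>f y\<bar>" for y
      using J_le[of "x - y"] J_nonneg[of "x - y"] by (simp add: abs_mult mult_right_mono)
    show int: "integrable lebesgue (\<lambda>y. J 0 * \<bar>f y\<bar>)" using assms by simp
    show "integrable lebesgue (\<lambda>y. J (x - y) * f y)"
      by (rule Bochner_Integration.integrable_bound[OF int])
        (use le borel_measurable_integrable[OF assms] J0_pos in \<open>auto simp: abs_mult\<close>)
  qed
  then show ?thesis by simp
qed

lemma borel_measurable_conv:
  assumes f: "integrable weighted_lebesgue f"
  shows "conv f \<in> borel_measurable lebesgue"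
  using borel_measurable_integrable[OF integrable_mult_conv[OF f, of "\<lambda>_. 1" 1]] by simp

text \<open>\<open>J\<close> is a probability density, so averaging preserves upper bounds; moreover
  an almost-everywhere bound becomes one at every point.\<close>

lemma conv_le_AE:
  assumes f: "integrable weighted_lebesgue f" and le: "AE y in lebesgue. f y \<le> c"
  shows "conv f x \<le> c"
proof -
  have "conv f x \<le> (LINT y|lebesgue. J (x - y) * c)"
    unfolding Defs.convolution_def
  proof (rule integral_mono_AE)
    show "integrable lebesgue (\<lambda>y. J (x - y) * f y)"
    proof (rule integrable_lebesgue_weight_bound[OF f])
      show "\<bar>J (x - y)\<bar> \<le> J 0 * (1 + y^2)" for y
        using J_le[of "x - y"] J_nonneg[of "x - y"] J0_pos
        by (simp add: distrib_left add_increasing2)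
    qed measurable
    show "integrable lebesgue (\<lambda>y. J (x - y) * c)" using integrable_J_shift by simp
    show "AE y in lebesgue. J (x - y) * f y \<le> J (x - y) * c"
      using le by eventually_elim (intro mult_left_mono J_nonneg)
  qed
  then show ?thesis by (simp add: integral_J_shift)
qed

section \<open>Action of the kernel on explicit functions\<close>

lemma integral_J_shift_lborel:
  "f \<in> borel_measurable borel \<Longrightarrow> (LINT y|lebesgue. J (x - y) * f y) = (LINT z|lborel. J z * f (x - z))"
  using lborel_integral_real_affine[of "-1" "\<lambda>y. J (x - y) * f y" x] by (simp add: integral_completion)

lemma integral_J_z: "(LINT z|lborel. J z * z) = 0"
  using lborel_integral_real_affine[of "-1" "\<lambda>z. J z * z" 0] by (simp add: J_minus)

lemma integrable_J_z: "integrable lborel (\<lambda>z. J z * z)"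
  by (rule integrable_J_mult[where C = d]) auto

text \<open>For |z| < d <= |x| the point x - z stays on the side of x, so the absolute value is
  linear over the range of the kernel, and \<open>J\<close> has first moment zero.\<close>

lemma conv_abs_eq:
  assumes "d \<le> \<bar>x\<bar>"
  shows "conv abs x = \<bar>x\<bar>"
proof -
  have "conv abs x = (LINT z|lborel. J z * \<bar>x - z\<bar>)"
    unfolding Defs.convolution_def by (rule integral_J_shift_lborel) measurable
  also have "\<dots> = (LINT z|lborel. \<bar>x\<bar> * J z - sgn x * (J z * z))"
  proof (intro Bochner_Integration.integral_cong refl)
    fix z
    show "J z * \<bar>x - z\<bar> = \<bar>x\<bar> * J z - sgn x * (J z * z)"
    proof (cases "\<bar>z\<bar> < d")
      case True
      then have eq: "\<bar>x - z\<bar> = \<bar>x\<bar> - sgn x * z" using assms by (auto simp: sgn_if abs_if split: if_splits)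
      show ?thesis unfolding eq by (simp add: algebra_simps)
    qed (simp add: J_eq_0)
  qed
  also have "\<dots> = \<bar>x\<bar>"
    using integrable_J integrable_J_z by (simp add: integral_J integral_J_z)
  finally show ?thesis .
qed

text \<open>Near the origin the kink makes convolution raise |x|, by at most d. This is the excess
  that the barrier has to compensate.\<close>

lemma conv_abs_le: "conv abs x \<le> \<bar>x\<bar> + d"
proof -
  have "conv abs x = (LINT z|lborel. J z * \<bar>x - z\<bar>)"
    unfolding Defs.convolution_def by (rule integral_J_shift_lborel) measurable
  also have "\<bar>\<dots>\<bar> \<le> \<bar>x\<bar> + d"
    by (rule integral_J_mult_le) auto
  finally show ?thesis by simp
qed

lemma conv_translate: 
  assumes "f \<in> borel_measurable borel"
  shows "conv (\<lambda>z. f (z - x)) y = conv f (y - x)"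
proof -
  note assms[measurable]
  have "conv (\<lambda>z. f (z - x)) y = (LINT z|lborel. J z * f (y - z - x))"
    unfolding Defs.convolution_def by (rule integral_J_shift_lborel) measurable
  also have "\<dots> = (LINT z|lborel. J z * f (y - x - z))" by (simp add: algebra_simps)
  also have "\<dots> = conv f (y - x)"
    unfolding Defs.convolution_def by (rule integral_J_shift_lborel[symmetric]) measurable
  finally show ?thesis .
qed

text \<open>On the support z^2 <= d^2, so the factor exp (d^2 / 2) lifts the Gaussian above 1. This
  lets the kernel be exchanged for \<open>heat\<close> at time 0.\<close>

lemma J_le_gaussian: "J z \<le> J 0 * exp (d^2 / 2) * exp (- (z^2) / 2)"
proof (cases "\<bar>z\<bar> < d")
  case True
  then have "\<bar>z\<bar>^2 \<le> d^2" by (intro power_mono) auto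
  then have "1 \<le> exp (d^2 / 2 + - (z^2) / 2)" by simp
  then have "J 0 * 1 \<le> J 0 * (exp (d^2 / 2) * exp (- (z^2) / 2))"
    unfolding exp_add[symmetric] using J0_pos by (intro mult_left_mono) auto
  then show ?thesis using J_le[of z] by simp
next
  case False
  then show ?thesis using J0_pos by (simp add: J_eq_0)
qed

end

section \<open>Testing the equation\<close>

lemma measurable_weight [measurable]: "(\<lambda>x::real. 1 + x^2) \<in> borel_measurable lebesgue"
  by (rule measurable_completion) measurable

text \<open>Admissible time-dependent test functions, \<open>k'\<close> being the time derivative of
  \<open>k\<close>. The expansion is required with a quadratic error uniform in x relative to 1 +
  x^2, so that it survives pairing with a solution known only in the weighted L^1 norm.\<close>

definition test_family :: "real set \<Rightarrow> (real \<Rightarrow> real \<Rightarrow> real) \<Rightarrow> (real \<Rightarrow> real \<Rightarrow> real) \<Rightarrow> bool" where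
  "test_family S k k' \<longleftrightarrow> (\<exists>C.
     (\<forall>s\<in>S. k s \<in> borel_measurable lebesgue \<and> k' s \<in> borel_measurable lebesgue) \<and>
     (\<forall>s\<in>S. \<forall>x. \<bar>k s x\<bar> \<le> C * (1 + x^2) \<and> \<bar>k' s x\<bar> \<le> C * (1 + x^2)) \<and>
     (\<forall>s\<in>S. \<forall>t\<in>S. \<forall>x. \<bar>k s x - k t x - (s - t) * k' t x\<bar> \<le> C * (s - t)^2 * (1 + x^2)))"

lemma test_family_const:
  assumes "f \<in> borel_measurable lebesgue" "\<And>x. \<bar>f x\<bar> \<le> C * (1 + x^2)"
  shows "test_family S (\<lambda>s. f) (\<lambda>s x. 0)"
proof -
  have C: "0 \<le> C" using assms(2)[of 0] by simp
  then have "0 \<le> C * (1 + x^2)" for x :: real by (simp add: add_nonneg_nonneg)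
  then show ?thesis unfolding test_family_def using assms C by (intro exI[of _ C]) simp
qed

locale exterior_problem = dispersal_kernel d J for d :: real and J :: "real \<Rightarrow> real" +
  fixes a0 a :: real and H :: "real set" and u0 :: "real \<Rightarrow> real" and u :: "real \<Rightarrow> real \<Rightarrow> real"
  assumes hole: "admissible_hole a0 a H"
    and datum: "admissible_datum H u0"
    and solution: "exterior_Dirichlet_solution H J u0 u"
begin

lemma a0_pos: "0 < a0" and hole_superset: "\<bar>x\<bar> < a0 \<Longrightarrow> x \<in> H"
proof -
  show "0 < a0" using hole by (simp add: admissible_hole_def)
  have "{-a0<..<a0} \<subseteq> H" using hole by (simp add: admissible_hole_def)
  then show "\<bar>x\<bar> < a0 \<Longrightarrow> x \<in> H" by (rule subsetD) auto
qed

lemma sets_H [measurable]: "H \<in> sets lebesgue"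
  using hole by (auto simp: admissible_hole_def)

lemma u_integrable: "0 \<le> t \<Longrightarrow> integrable weighted_lebesgue (\<lambda>x. u x t)"
  using solution by (simp add: exterior_Dirichlet_solution_def)

lemma u_measurable: "0 \<le> t \<Longrightarrow> (\<lambda>x. u x t) \<in> borel_measurable lebesgue"
  using u_integrable by (simp add: integrable_weighted_lebesgue_iff)

lemma u_initial: "AE x in lebesgue. u x 0 = u0 x"
  using solution by (simp add: exterior_Dirichlet_solution_def)

lemma u_hole:
  assumes "0 \<le> t"
  shows "AE x in lebesgue. x \<in> H \<longrightarrow> u x t = 0"
proof (cases "t = 0")
  case True
  have "AE x in lebesgue. x \<in> H \<longrightarrow> u0 x = 0" using datum by (simp add: admissible_datum_def)
  with u_initial show ?thesis unfolding True by eventually_elim simp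
next
  case False
  then show ?thesis using assms solution by (simp add: exterior_Dirichlet_solution_def)
qed

text \<open>The solution predicate uses extended nonnegative integrals; integrability turns them
  into the real integrals in which the estimates are made. \<open>u_derivative\<close> does the same
  for the equation, the restriction to the complement of the hole becoming an indicator.\<close>

lemma u_continuous:
  assumes t: "0 \<le> t"
  shows "((\<lambda>s. LINT x|lebesgue. (1 + x^2) * \<bar>u x s - u x t\<bar>) \<longlongrightarrow> 0) (at t within {0..})"
proof -
  have lim: "((\<lambda>s. \<integral>\<^sup>+x. ennreal \<bar>u x s - u x t\<bar> \<partial>weighted_lebesgue) \<longlongrightarrow> 0) (at t within {0..})"
    using solution t by (simp add: exterior_Dirichlet_solution_def)
  have eq: "(\<integral>\<^sup>+x. ennreal \<bar>u x s - u x t\<bar> \<partial>weighted_lebesgue)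
      = ennreal (LINT x|lebesgue. (1 + x^2) * \<bar>u x s - u x t\<bar>)" if s: "0 \<le> s" for s
  proof -
    have "integrable weighted_lebesgue (\<lambda>x. \<bar>u x s - u x t\<bar>)"
      using u_integrable[OF s] u_integrable[OF t] by simp
    then have int: "(\<lambda>x. \<bar>u x s - u x t\<bar>) \<in> borel_measurable lebesgue"
      "integrable lebesgue (\<lambda>x. (1 + x^2) * \<bar>u x s - u x t\<bar>)"
      by (auto simp: integrable_weighted_lebesgue_iff)
    have "(\<integral>\<^sup>+x. ennreal \<bar>u x s - u x t\<bar> \<partial>weighted_lebesgue)
        = (\<integral>\<^sup>+x. ennreal (1 + x^2) * ennreal \<bar>u x s - u x t\<bar> \<partial>lebesgue)"
      unfolding weighted_lebesgue_def using int(1)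
      by (intro nn_integral_density) (auto intro!: measurable_completion)
    also have "\<dots> = (\<integral>\<^sup>+x. ennreal ((1 + x^2) * \<bar>u x s - u x t\<bar>) \<partial>lebesgue)"
      by (intro nn_integral_cong) (simp add: ennreal_mult)
    also have "\<dots> = ennreal (LINT x|lebesgue. (1 + x^2) * \<bar>u x s - u x t\<bar>)"
      by (intro nn_integral_eq_integral int) simp
    finally show ?thesis .
  qed
  have "((\<lambda>s. ennreal (LINT x|lebesgue. (1 + x^2) * \<bar>u x s - u x t\<bar>)) \<longlongrightarrow> ennreal 0) (at t within {0..})"
    unfolding ennreal_0
    by (rule Lim_transform_eventually[OF lim]) (auto simp: eventually_at_filter eq)
  then show ?thesis
    by (subst (asm) tendsto_ennreal_iff) (auto intro!: integral_nonneg_AE always_eventually)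
qed

lemma u_derivative:
  assumes t: "0 < t"
  shows "((\<lambda>s. LINT x|lebesgue. (1 + x^2) * \<bar>indicator (- H) x * ((u x s - u x t) / (s - t) - nonlocal_op J (\<lambda>y. u y t) x)\<bar>)
    \<longlongrightarrow> 0) (at t)"
proof -
  let ?q = "\<lambda>s x. (u x s - u x t) / (s - t) - nonlocal_op J (\<lambda>y. u y t) x"
  have lim: "((\<lambda>s. \<integral>\<^sup>+x\<in>-H. ennreal \<bar>?q s x\<bar> \<partial>weighted_lebesgue) \<longlongrightarrow> 0) (at t)"
    using solution t by (simp add: exterior_Dirichlet_solution_def)
  have eq: "(\<integral>\<^sup>+x\<in>-H. ennreal \<bar>?q s x\<bar> \<partial>weighted_lebesgue)
      = ennreal (LINT x|lebesgue. (1 + x^2) * \<bar>indicator (- H) x * ?q s x\<bar>)" if s: "0 < s" for s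
  proof -
    have "integrable weighted_lebesgue (nonlocal_op J (\<lambda>y. u y t))"
      unfolding integrable_weighted_lebesgue_iff
    proof
      have "integrable lebesgue (\<lambda>x. (1 + x^2) * nonlocal_op J (\<lambda>y. u y t) x)"
        using u_integrable t by (intro integrable_mult_nonlocal_op[where C = 1]) (auto intro!: measurable_completion)
      then show "integrable lebesgue (\<lambda>x. (1 + x^2) * nonlocal_op J (\<lambda>y. u y t) x)" .
      show "nonlocal_op J (\<lambda>y. u y t) \<in> borel_measurable lebesgue"
        unfolding nonlocal_op_def[abs_def]
        using borel_measurable_conv[OF u_integrable[of t]] u_measurable[of t] t by auto
    qed
    then have "integrable weighted_lebesgue (?q s)"
      using u_integrable[of s] u_integrable[of t] s t by simp
    then have q: "?q s \<in> borel_measurable lebesgue" "integrable lebesgue (\<lambda>x. (1 + x^2) * ?q s x)"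
      by (auto simp: integrable_weighted_lebesgue_iff)
    have int: "integrable lebesgue (\<lambda>x. (1 + x^2) * \<bar>indicator (- H) x * ?q s x\<bar>)"
    proof (rule Bochner_Integration.integrable_bound[OF q(2)])
      show "(\<lambda>x. (1 + x^2) * \<bar>indicator (- H) x * ?q s x\<bar>) \<in> borel_measurable lebesgue"
        using q(1) by measurable
    qed (auto simp: indicator_def abs_mult)
    have "(\<integral>\<^sup>+x\<in>-H. ennreal \<bar>?q s x\<bar> \<partial>weighted_lebesgue)
        = (\<integral>\<^sup>+x. ennreal (1 + x^2) * (ennreal \<bar>?q s x\<bar> * indicator (- H) x) \<partial>lebesgue)"
      unfolding weighted_lebesgue_def using q(1)
      by (intro nn_integral_density) (auto intro!: measurable_completion)
    also have "\<dots> = (\<integral>\<^sup>+x. ennreal ((1 + x^2) * \<bar>indicator (- H) x * ?q s x\<bar>) \<partial>lebesgue)"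
      by (intro nn_integral_cong) (auto simp: ennreal_mult abs_mult indicator_def)
    also have "\<dots> = ennreal (LINT x|lebesgue. (1 + x^2) * \<bar>indicator (- H) x * ?q s x\<bar>)"
      by (intro nn_integral_eq_integral int) simp
    finally show ?thesis .
  qed
  have ev: "\<forall>\<^sub>F s in at t. 0 < s" using order_tendstoD(1)[OF tendsto_ident_at t] .
  have "((\<lambda>s. ennreal (LINT x|lebesgue. (1 + x^2) * \<bar>indicator (- H) x * ?q s x\<bar>)) \<longlongrightarrow> ennreal 0) (at t)"
    unfolding ennreal_0
    by (rule Lim_transform_eventually[OF lim eventually_mono[OF ev eq]])
  then show ?thesis
    by (subst (asm) tendsto_ennreal_iff) (auto intro!: integral_nonneg_AE always_eventually)
qed

text \<open>In \<open>testing_derivative\<close> the remainder of the test function is paired with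
  u(s), not u(t); this controls that pairing for s near t.\<close>

lemma weighted_norm_bounded:
  assumes t: "0 \<le> t"
  shows "\<forall>\<^sub>F s in at t within {0..}.
    (LINT x|lebesgue. (1 + x^2) * \<bar>u x s\<bar>) \<le> (LINT x|lebesgue. (1 + x^2) * \<bar>u x t\<bar>) + 1"
proof -
  have "\<forall>\<^sub>F s in at t within {0..}. (LINT x|lebesgue. (1 + x^2) * \<bar>u x s - u x t\<bar>) < 1"
    using u_continuous[OF t] by (rule order_tendstoD) simp
  moreover have "\<forall>\<^sub>F s in at t within {0..}. 0 \<le> s"
    by (simp add: eventually_at_filter)
  ultimately show ?thesis
  proof eventually_elim
    case (elim s)
    have int: "integrable lebesgue (\<lambda>x. (1 + x^2) * \<bar>f x\<bar>)" if "integrable weighted_lebesgue f" for f :: "real \<Rightarrow> real"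
      using integrable_abs[OF that] by (simp add: integrable_weighted_lebesgue_iff)
    note ints = int[OF u_integrable[OF t]] int[OF u_integrable[OF elim(2)]]
      int[OF Bochner_Integration.integrable_diff[OF u_integrable[OF elim(2)] u_integrable[OF t]]]
    have "(LINT x|lebesgue. (1 + x^2) * \<bar>u x s\<bar>)
        \<le> (LINT x|lebesgue. (1 + x^2) * \<bar>u x t\<bar> + (1 + x^2) * \<bar>u x s - u x t\<bar>)"
    proof (intro integral_mono Bochner_Integration.integrable_add ints)
      fix x
      have "(1 + x^2) * \<bar>u x s\<bar> \<le> (1 + x^2) * (\<bar>u x t\<bar> + \<bar>u x s - u x t\<bar>)"
        by (intro mult_left_mono) (auto simp: add_nonneg_nonneg)
      then show "(1 + x^2) * \<bar>u x s\<bar> \<le> (1 + x^2) * \<bar>u x t\<bar> + (1 + x^2) * \<bar>u x s - u x t\<bar>"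
        by (simp add: distrib_left)
    qed
    also have "\<dots> = (LINT x|lebesgue. (1 + x^2) * \<bar>u x t\<bar>) + (LINT x|lebesgue. (1 + x^2) * \<bar>u x s - u x t\<bar>)"
      by (intro Bochner_Integration.integral_add ints)
    finally show ?case using elim(1) by simp
  qed
qed

text \<open>It includes t = 0, where the equation provides no derivative, so that comparisons can
  start from the datum.\<close>

lemma testing_continuous:
  assumes k: "test_family S k k'" and S: "S \<subseteq> {0..}" "bounded S" and t: "t \<in> S"
  shows "((\<lambda>s. LINT x|lebesgue. k s x * u x s) \<longlongrightarrow> (LINT x|lebesgue. k t x * u x t)) (at t within S)"
proof -
  obtain C where C: "\<And>s. s \<in> S \<Longrightarrow> k s \<in> borel_measurable lebesgue"
    "\<And>s x. s \<in> S \<Longrightarrow> \<bar>k s x\<bar> \<le> C * (1 + x^2)" "\<And>s x. s \<in> S \<Longrightarrow> \<bar>k' s x\<bar> \<le> C * (1 + x^2)"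
    "\<And>s t x. s \<in> S \<Longrightarrow> t \<in> S \<Longrightarrow> \<bar>k s x - k t x - (s - t) * k' t x\<bar> \<le> C * (s - t)^2 * (1 + x^2)"
    using k unfolding test_family_def by blast
  have t0: "0 \<le> t" using S t by auto
  define N where "N s = (LINT x|lebesgue. (1 + x^2) * \<bar>u x s\<bar>)" for s
  define D where "D s = (LINT x|lebesgue. (1 + x^2) * \<bar>u x s - u x t\<bar>)" for s
  have "\<forall>\<^sub>F s in at t within S. norm ((LINT x|lebesgue. k s x * u x s) - (LINT x|lebesgue. k t x * u x t))
      \<le> C * (\<bar>s - t\<bar> + \<bar>s - t\<bar>^2) * N t + C * D s"
    unfolding eventually_at_filter
  proof (intro always_eventually allI impI)
    fix s assume "s \<noteq> t" and s: "s \<in> S"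
    have s0: "0 \<le> s" using S s by auto
    have int: "integrable lebesgue (\<lambda>x. k r x * u x q)" if "r \<in> S" "0 \<le> q" for r q
      by (rule integrable_lebesgue_weight_bound[OF u_integrable[OF that(2)] C(1)[OF that(1)] C(2)[OF that(1)]])
    have diff: "\<bar>k s x - k t x\<bar> \<le> (C * (\<bar>s - t\<bar> + \<bar>s - t\<bar>^2)) * (1 + x^2)" for x
    proof -
      have "\<bar>k s x - k t x\<bar> \<le> \<bar>k s x - k t x - (s - t) * k' t x\<bar> + \<bar>s - t\<bar> * \<bar>k' t x\<bar>"
        using abs_triangle_ineq[of "k s x - k t x - (s - t) * k' t x" "(s - t) * k' t x"]
        by (simp add: abs_mult)
      also have "\<dots> \<le> C * (s - t)^2 * (1 + x^2) + \<bar>s - t\<bar> * (C * (1 + x^2))"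
        by (intro add_mono mult_left_mono C s t) simp
      finally show ?thesis by (simp add: algebra_simps)
    qed
    have "(LINT x|lebesgue. k s x * u x s) - (LINT x|lebesgue. k t x * u x t)
       = (LINT x|lebesgue. (k s x - k t x) * u x t) + (LINT x|lebesgue. k s x * (u x s - u x t))"
      using int[OF s s0] int[OF s t0] int[OF t t0] by (simp add: algebra_simps)
    also have "norm \<dots> \<le> C * (\<bar>s - t\<bar> + \<bar>s - t\<bar>^2) * N t + C * D s"
      unfolding real_norm_def N_def D_def
      by (intro order_trans[OF abs_triangle_ineq] add_mono integral_lebesgue_weight_bound
          borel_measurable_diff C Bochner_Integration.integrable_diff u_integrable diff s t s0 t0)
    finally show "norm ((LINT x|lebesgue. k s x * u x s) - (LINT x|lebesgue. k t x * u x t))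
      \<le> C * (\<bar>s - t\<bar> + \<bar>s - t\<bar>^2) * N t + C * D s" .
  qed
  moreover have "((\<lambda>s. C * (\<bar>s - t\<bar> + \<bar>s - t\<bar>^2) * N t + C * D s) \<longlongrightarrow> 0) (at t within S)"
    using tendsto_within_subset[OF u_continuous[OF t0] S(1)]
    by (auto intro!: tendsto_eq_intros simp: D_def)
  ultimately have "((\<lambda>s. (LINT x|lebesgue. k s x * u x s) - (LINT x|lebesgue. k t x * u x t)) \<longlongrightarrow> 0) (at t within S)"
    by (rule Lim_null_comparison)
  then show ?thesis by (simp add: LIM_zero_iff)
qed

text \<open>A product rule in weak form: the increment splits into the Taylor remainder of
  \<open>k\<close>, \<open>k'\<close> against \<open>u\<close>, and \<open>k\<close> at time t
  against the increment of \<open>u\<close>. Each error is bounded by a weighted L^1 quantity that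
  vanishes as s tends to t.\<close>

lemma testing_derivative:
  assumes k: "test_family S k k'" and S: "S \<subseteq> {0..}" and t: "t \<in> S" "0 < t"
  shows "((\<lambda>s. LINT x|lebesgue. k s x * u x s) has_real_derivative
    (LINT x|lebesgue. k' t x * u x t) + (LINT x|lebesgue. indicator (- H) x * k t x * nonlocal_op J (\<lambda>y. u y t) x))
    (at t within S)"
proof -
  obtain C where C: "\<And>s. s \<in> S \<Longrightarrow> k s \<in> borel_measurable lebesgue" "\<And>s. s \<in> S \<Longrightarrow> k' s \<in> borel_measurable lebesgue"
    "\<And>s x. s \<in> S \<Longrightarrow> \<bar>k s x\<bar> \<le> C * (1 + x^2)" "\<And>s x. s \<in> S \<Longrightarrow> \<bar>k' s x\<bar> \<le> C * (1 + x^2)"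
    "\<And>s t x. s \<in> S \<Longrightarrow> t \<in> S \<Longrightarrow> \<bar>k s x - k t x - (s - t) * k' t x\<bar> \<le> C * (s - t)^2 * (1 + x^2)"
    using k unfolding test_family_def by blast
  have C0: "0 \<le> C" using C(3)[OF t(1), of 0] by simp
  have t0: "0 \<le> t" using t by simp
  define Lu where "Lu = nonlocal_op J (\<lambda>y. u y t)"
  define q where "q s x = (u x s - u x t) / (s - t) - Lu x" for s x
  define N where "N s = (LINT x|lebesgue. (1 + x^2) * \<bar>u x s\<bar>)" for s
  define D where "D s = (LINT x|lebesgue. (1 + x^2) * \<bar>u x s - u x t\<bar>)" for s
  define R where "R s = (LINT x|lebesgue. (1 + x^2) * \<bar>indicator (- H) x * q s x\<bar>)" for s
  define T where "T s = (LINT x|lebesgue. k s x * u x s)" for s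
  define T' where "T' = (LINT x|lebesgue. k' t x * u x t) + (LINT x|lebesgue. indicator (- H) x * k t x * Lu x)"
  have Lu: "integrable weighted_lebesgue Lu"
    unfolding integrable_weighted_lebesgue_iff
  proof
    show "integrable lebesgue (\<lambda>x. (1 + x^2) * Lu x)"
      unfolding Lu_def using u_integrable t by (intro integrable_mult_nonlocal_op[where C = 1]) (auto intro!: measurable_completion)
    show "Lu \<in> borel_measurable lebesgue"
      unfolding Lu_def nonlocal_op_def[abs_def]
      using borel_measurable_conv[OF u_integrable[of t]] u_measurable[of t] t by auto
  qed
  have int: "integrable lebesgue (\<lambda>x. k r x * u x q)" if "r \<in> S" "0 \<le> q" for r q
    by (rule integrable_lebesgue_weight_bound[OF u_integrable[OF that(2)] C(1)[OF that(1)] C(3)[OF that(1)]])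
  have int': "integrable lebesgue (\<lambda>x. k' r x * u x q)" if "r \<in> S" "0 \<le> q" for r q
    by (rule integrable_lebesgue_weight_bound[OF u_integrable[OF that(2)] C(2)[OF that(1)] C(4)[OF that(1)]])
  have "\<forall>\<^sub>F s in at t within S. norm ((T s - T t) / (s - t) - T') \<le> C * \<bar>s - t\<bar> * N s + C * D s + C * R s"
    unfolding eventually_at_filter
  proof (intro always_eventually allI impI)
    fix s assume st: "s \<noteq> t" and s: "s \<in> S"
    have s0: "0 \<le> s" using S s by auto
    have q: "integrable weighted_lebesgue (\<lambda>x. indicator (- H) x * q s x)"
    proof (rule Bochner_Integration.integrable_bound)
      show "integrable weighted_lebesgue (q s)"
        unfolding q_def using Lu u_integrable[OF s0] u_integrable[OF t0] by simp
      then have "q s \<in> borel_measurable lebesgue" by (simp add: integrable_weighted_lebesgue_iff)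
      then show "(\<lambda>x. indicator (- H) x * q s x) \<in> borel_measurable weighted_lebesgue"
        by (auto simp: weighted_lebesgue_def)
    qed (auto simp: indicator_def)
    have "T s - T t = (LINT x|lebesgue. (k s x - k t x - (s - t) * k' t x) * u x s)
        + (s - t) * (LINT x|lebesgue. k' t x * u x s) + (LINT x|lebesgue. k t x * (u x s - u x t))"
      using int[OF s s0] int[OF t(1) s0] int[OF t(1) t0] int'[OF t(1) s0]
      by (simp add: T_def algebra_simps)
    \<comment> \<open>On the hole both values of \<open>u\<close> vanish almost everywhere, so only
      the complement contributes; there the increment is (s - t) times Lu plus the error
      \<open>q s\<close>.\<close>
    moreover have "(LINT x|lebesgue. k t x * (u x s - u x t))
        = (LINT x|lebesgue. (s - t) * (k t x * (indicator (- H) x * q s x) + indicator (- H) x * k t x * Lu x))"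
    proof (rule integral_cong_AE)
      show "AE x in lebesgue. k t x * (u x s - u x t)
          = (s - t) * (k t x * (indicator (- H) x * q s x) + indicator (- H) x * k t x * Lu x)"
        using u_hole[OF s0] u_hole[OF t0]
      proof eventually_elim
        case (elim x)
        then show ?case using st by (cases "x \<in> H") (auto simp: q_def field_simps)
      qed
    qed (use C(1)[OF t(1)] u_measurable[OF s0] u_measurable[OF t0] q Lu in
        \<open>auto simp: integrable_weighted_lebesgue_iff intro!: borel_measurable_times borel_measurable_add\<close>)
    moreover have "\<dots> = (s - t) * ((LINT x|lebesgue. k t x * (indicator (- H) x * q s x))
        + (LINT x|lebesgue. indicator (- H) x * k t x * Lu x))"
    proof -
      have "integrable lebesgue (\<lambda>x. k t x * (indicator (- H) x * q s x))"
        by (rule integrable_lebesgue_weight_bound[OF q C(1)[OF t(1)] C(3)[OF t(1)]])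
      moreover have "integrable lebesgue (\<lambda>x. indicator (- H) x * k t x * Lu x)"
      proof (rule integrable_lebesgue_weight_bound[OF Lu])
        show "(\<lambda>x. indicator (- H) x * k t x) \<in> borel_measurable lebesgue"
          using C(1)[OF t(1)] by (intro borel_measurable_times) auto
        show "\<bar>indicator (- H) x * k t x\<bar> \<le> C * (1 + x^2)" for x
          using C(3)[OF t(1), of x] C0 by (auto simp: indicator_def add_nonneg_nonneg)
      qed
      ultimately show ?thesis by simp
    qed
    ultimately have "(T s - T t) / (s - t)
        = (LINT x|lebesgue. (k s x - k t x - (s - t) * k' t x) * u x s) / (s - t)
        + (LINT x|lebesgue. k' t x * u x s) + (LINT x|lebesgue. k t x * (indicator (- H) x * q s x))
        + (LINT x|lebesgue. indicator (- H) x * k t x * Lu x)"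
      using st by (simp add: field_simps)
    moreover have "(LINT x|lebesgue. k' t x * (u x s - u x t))
        = (LINT x|lebesgue. k' t x * u x s) - (LINT x|lebesgue. k' t x * u x t)"
      using int'[OF t(1) s0] int'[OF t(1) t0] by (simp add: algebra_simps)
    ultimately have eq: "(T s - T t) / (s - t) - T'
        = (LINT x|lebesgue. (k s x - k t x - (s - t) * k' t x) * u x s) / (s - t)
        + (LINT x|lebesgue. k' t x * (u x s - u x t)) + (LINT x|lebesgue. k t x * (indicator (- H) x * q s x))"
      by (simp add: T'_def)
    have "\<bar>LINT x|lebesgue. (k s x - k t x - (s - t) * k' t x) * u x s\<bar> \<le> C * (s - t)^2 * N s"
      unfolding N_def using C(1)[OF s] C(1)[OF t(1)] C(2)[OF t(1)]
      by (intro integral_lebesgue_weight_bound u_integrable s0 C(5) s t) auto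
    then have "\<bar>LINT x|lebesgue. (k s x - k t x - (s - t) * k' t x) * u x s\<bar> / \<bar>s - t\<bar>
        \<le> C * (s - t)^2 * N s / \<bar>s - t\<bar>"
      by (rule divide_right_mono) simp
    also have "\<dots> = C * \<bar>s - t\<bar> * N s"
      using st by (simp add: power2_eq_square field_simps abs_if)
    finally have 1: "\<bar>(LINT x|lebesgue. (k s x - k t x - (s - t) * k' t x) * u x s) / (s - t)\<bar> \<le> C * \<bar>s - t\<bar> * N s"
      by simp
    have 2: "\<bar>LINT x|lebesgue. k' t x * (u x s - u x t)\<bar> \<le> C * D s"
      unfolding D_def
      by (intro integral_lebesgue_weight_bound Bochner_Integration.integrable_diff u_integrable s0 t0 C t)
    have 3: "\<bar>LINT x|lebesgue. k t x * (indicator (- H) x * q s x)\<bar> \<le> C * R s"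
      unfolding R_def by (intro integral_lebesgue_weight_bound q C t)
    show "norm ((T s - T t) / (s - t) - T') \<le> C * \<bar>s - t\<bar> * N s + C * D s + C * R s"
      unfolding eq real_norm_def using 1 2 3 by linarith
  qed
  moreover have "\<forall>\<^sub>F s in at t within S. C * \<bar>s - t\<bar> * N s \<le> C * \<bar>s - t\<bar> * (N t + 1)"
    using filter_leD[OF at_le[OF S] weighted_norm_bounded[OF t0]]
    by eventually_elim (simp add: N_def C0 mult_left_mono)
  ultimately have "\<forall>\<^sub>F s in at t within S. norm ((T s - T t) / (s - t) - T')
      \<le> C * \<bar>s - t\<bar> * (N t + 1) + C * D s + C * R s"
    by eventually_elim simp
  moreover
  have "((\<lambda>s. C * \<bar>s - t\<bar> * (N t + 1) + C * D s + C * R s)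
      \<longlongrightarrow> C * \<bar>t - t\<bar> * (N t + 1) + C * 0 + C * 0) (at t within S)"
  proof (intro tendsto_intros)
    show "(D \<longlongrightarrow> 0) (at t within S)"
      unfolding D_def by (rule tendsto_within_subset[OF u_continuous[OF t0] S])
    show "(R \<longlongrightarrow> 0) (at t within S)"
      unfolding R_def q_def Lu_def by (rule tendsto_within_subset[OF u_derivative[OF t(2)] subset_UNIV])
  qed
  then have "((\<lambda>s. C * \<bar>s - t\<bar> * (N t + 1) + C * D s + C * R s) \<longlongrightarrow> 0) (at t within S)"
    by (simp only: diff_self abs_zero mult_zero_left mult_zero_right add_0_left)
  ultimately have "((\<lambda>s. (T s - T t) / (s - t) - T') \<longlongrightarrow> 0) (at t within S)"
    by (rule Lim_null_comparison)
  then have "((\<lambda>s. (T s - T t) / (s - t)) \<longlongrightarrow> T') (at t within S)"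
    by (rule LIM_zero_cancel)
  then show ?thesis
    unfolding has_field_derivative_iff T_def T'_def Lu_def .
qed

text \<open>The pairing minus \<open>\<Phi>\<close> is nonincreasing: its derivative is needed only
  inside the interval, and continuity reaches the endpoints, in particular time 0.\<close>

lemma testing_mono:
  assumes ab: "0 \<le> \<alpha>" "\<alpha> \<le> \<beta>" and k: "test_family {\<alpha>..\<beta>} k k'"
    and \<Phi>: "continuous_on {\<alpha>..\<beta>} \<Phi>" "\<And>s. \<alpha> < s \<Longrightarrow> s < \<beta> \<Longrightarrow> (\<Phi> has_real_derivative \<phi> s) (at s)"
    and le: "\<And>s. \<alpha> < s \<Longrightarrow> s < \<beta> \<Longrightarrow>
      (LINT x|lebesgue. k' s x * u x s) + (LINT x|lebesgue. indicator (- H) x * k s x * nonlocal_op J (\<lambda>y. u y s) x) \<le> \<phi> s"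
  shows "(LINT x|lebesgue. k \<beta> x * u x \<beta>) \<le> (LINT x|lebesgue. k \<alpha> x * u x \<alpha>) + (\<Phi> \<beta> - \<Phi> \<alpha>)"
proof -
  define F where "F s = (LINT x|lebesgue. k s x * u x s) - \<Phi> s" for s
  have S: "{\<alpha>..\<beta>} \<subseteq> {0..}" using ab by auto
  have "F \<beta> \<le> F \<alpha>"
  proof (rule DERIV_nonpos_imp_decreasing_open[OF ab(2)])
    fix s assume s: "\<alpha> < s" "s < \<beta>"
    have "((\<lambda>s. LINT x|lebesgue. k s x * u x s) has_real_derivative
      (LINT x|lebesgue. k' s x * u x s) + (LINT x|lebesgue. indicator (- H) x * k s x * nonlocal_op J (\<lambda>y. u y s) x)) (at s)"
      using testing_derivative[OF k S, of s] s ab by (simp add: at_within_Icc_at)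
    from DERIV_diff[OF this \<Phi>(2)[OF s]] le[OF s]
    show "\<exists>y. (F has_real_derivative y) (at s) \<and> y \<le> 0"
      unfolding F_def by (intro exI conjI) auto
  next
    show "continuous_on {\<alpha>..\<beta>} F"
      unfolding F_def
      by (intro continuous_on_diff \<Phi>) (auto simp: continuous_on_def intro!: testing_continuous[OF k S])
  qed
  then show ?thesis by (simp add: F_def)
qed

lemma sets_Compl_H [measurable]: "- H \<in> sets lebesgue"
  using sets.compl_sets[OF sets_H] by (simp add: Compl_eq_Diff_UNIV)

section \<open>Duhamel bounds and positivity\<close>

text \<open>Testing with exp r times an indicator cancels the -u in L and leaves exp r times the
  convolution as the only source; \<open>A0\<close> lies off the hole, where the equation holds. The
  sign of \<open>c\<close> selects upper or lower bounds.\<close>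

lemma duhamel_bound:
  assumes st: "0 \<le> s" "s \<le> t" and A0: "A0 \<in> sets lebesgue" "A0 \<subseteq> - H"
    and \<Phi>: "continuous_on {s..t} \<Phi>" "\<And>r. s < r \<Longrightarrow> r < t \<Longrightarrow> (\<Phi> has_real_derivative \<phi> r) (at r)"
    and le: "\<And>r x. s < r \<Longrightarrow> r < t \<Longrightarrow> x \<in> A0 \<Longrightarrow> exp r * (c * conv (\<lambda>y. u y r) x) \<le> \<phi> r"
    and init: "AE x in lebesgue. x \<in> A0 \<longrightarrow> c * exp s * u x s \<le> D"
  shows "AE x in lebesgue. x \<in> A0 \<longrightarrow> c * exp t * u x t \<le> D + (\<Phi> t - \<Phi> s)"
proof -
  have t0: "0 \<le> t" using st by simp
  define E where "E = D + (\<Phi> t - \<Phi> s)"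
  \<comment> \<open>A bounded piece of the set where the claim fails at time t; boundedness gives it
    finite measure.\<close>
  define A where "A n = {x \<in> A0. \<bar>x\<bar> \<le> real n \<and> E < c * exp t * u x t}" for n
  have null: "AE x in lebesgue. x \<notin> A n" for n
  proof -
    note u_measurable[OF t0, measurable] A0(1)[measurable]
    have [measurable]: "(\<lambda>x::real. x) \<in> borel_measurable lebesgue"
      by (rule measurable_completion) measurable
    have "A n = {x \<in> space lebesgue. x \<in> A0 \<and> \<bar>x\<bar> \<le> real n \<and> E < c * exp t * u x t}"
      by (auto simp: A_def)
    also have "\<dots> \<in> sets lebesgue" by measurable
    finally have A_sets [measurable]: "A n \<in> sets lebesgue" .
    have "bounded (A n)" by (rule bounded_subset[OF bounded_cball[of 0 "real n"]]) (auto simp: A_def)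
    then have "A n \<in> lmeasurable" using A_sets by (rule bounded_set_imp_lmeasurable)
    then have ind_int: "integrable lebesgue (indicator (A n) :: real \<Rightarrow> real)"
      by (simp add: fmeasurable_def)
    have ind_le: "\<bar>c * indicator (A n) x\<bar> \<le> \<bar>c\<bar> * (1 + x^2)" for x
      by (auto simp: indicator_def distrib_left)
    have ind_u: "integrable lebesgue (\<lambda>x. c * indicator (A n) x * u x r)" if "0 \<le> r" for r
      by (rule integrable_lebesgue_weight_bound[OF u_integrable[OF that] _ ind_le]) measurable
    have "(LINT x|lebesgue. exp t * (c * indicator (A n) x) * u x t)
      \<le> (LINT x|lebesgue. exp s * (c * indicator (A n) x) * u x s)
        + (measure lebesgue (A n) * \<Phi> t - measure lebesgue (A n) * \<Phi> s)"
    proof (rule testing_mono[where k = "\<lambda>r x. exp r * (c * indicator (A n) x)"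
          and k' = "\<lambda>r x. exp r * (c * indicator (A n) x)" and \<Phi> = "\<lambda>r. measure lebesgue (A n) * \<Phi> r"
          and \<phi> = "\<lambda>r. measure lebesgue (A n) * \<phi> r"])
      show "test_family {s..t} (\<lambda>r x. exp r * (c * indicator (A n) x)) (\<lambda>r x. exp r * (c * indicator (A n) x))"
        unfolding test_family_def
      proof (intro exI[of _ "exp t * \<bar>c\<bar>"] conjI ballI allI)
        fix r x assume r: "r \<in> {s..t}"
        have "exp r * \<bar>c * indicator (A n) x\<bar> \<le> exp t * (\<bar>c\<bar> * (1 + x^2))"
          using r by (intro mult_mono ind_le) auto
        then show "\<bar>exp r * (c * indicator (A n) x)\<bar> \<le> exp t * \<bar>c\<bar> * (1 + x^2)"
          "\<bar>exp r * (c * indicator (A n) x)\<bar> \<le> exp t * \<bar>c\<bar> * (1 + x^2)"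
          by (simp_all add: abs_mult mult.assoc)
      next
        fix q r x assume q: "q \<in> {s..t}" and r: "r \<in> {s..t}"
        \<comment> \<open>The growing exponential is brought under \<open>exp_taylor1_bound\<close>
          by writing it with the nonnegative arguments t - q and t - r; the factor exp t undoes the
          shift.\<close>
        have "\<bar>exp (- (t - q)) - exp (- (t - r)) + ((t - q) - (t - r)) * exp (- (t - r))\<bar> \<le> ((t - q) - (t - r))^2"
          using q r by (intro exp_taylor1_bound) auto
        then have "exp t * \<bar>exp (q - t) - exp (r - t) - (q - r) * exp (r - t)\<bar> \<le> exp t * (q - r)^2"
          by (intro mult_left_mono) (simp_all add: algebra_simps power2_commute)
        moreover have "exp t * \<bar>exp (q - t) - exp (r - t) - (q - r) * exp (r - t)\<bar>
            = \<bar>exp t * (exp (q - t) - exp (r - t) - (q - r) * exp (r - t))\<bar>"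
          by (simp add: abs_mult)
        moreover have "exp t * (exp (q - t) - exp (r - t) - (q - r) * exp (r - t))
            = exp q - exp r - (q - r) * exp r"
          by (simp add: exp_diff field_simps)
        ultimately have T: "\<bar>exp q - exp r - (q - r) * exp r\<bar> \<le> exp t * (q - r)^2" by simp
        have "exp q * (c * indicator (A n) x) - exp r * (c * indicator (A n) x) - (q - r) * (exp r * (c * indicator (A n) x))
          = (exp q - exp r - (q - r) * exp r) * (c * indicator (A n) x)"
          by (simp add: algebra_simps)
        also have "\<bar>\<dots>\<bar> \<le> (exp t * (q - r)^2) * (\<bar>c\<bar> * (1 + x^2))"
          unfolding abs_mult[of "exp q - exp r - (q - r) * exp r"] by (intro mult_mono T ind_le) auto
        finally show "\<bar>exp q * (c * indicator (A n) x) - exp r * (c * indicator (A n) x) - (q - r) * (exp r * (c * indicator (A n) x))\<bar>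
          \<le> exp t * \<bar>c\<bar> * (q - r)^2 * (1 + x^2)" by (simp add: mult_ac)
      qed measurable
      show "continuous_on {s..t} (\<lambda>r. measure lebesgue (A n) * \<Phi> r)"
        by (intro continuous_intros \<Phi>)
      fix r assume r: "s < r" "r < t"
      then have r0: "0 \<le> r" using st by simp
      show "((\<lambda>r. measure lebesgue (A n) * \<Phi> r) has_real_derivative measure lebesgue (A n) * \<phi> r) (at r)"
        by (intro DERIV_cmult \<Phi> r)
      have conv_int: "integrable lebesgue (\<lambda>x. c * indicator (A n) x * conv (\<lambda>y. u y r) x)"
        by (rule integrable_mult_conv[OF u_integrable[OF r0] _ ind_le]) measurable
      have "(LINT x|lebesgue. indicator (- H) x * (exp r * (c * indicator (A n) x)) * nonlocal_op J (\<lambda>y. u y r) x)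
        = (LINT x|lebesgue. exp r * (c * indicator (A n) x * conv (\<lambda>y. u y r) x) - exp r * (c * indicator (A n) x * u x r))"
        using A0(2) by (intro Bochner_Integration.integral_cong refl)
          (auto simp: A_def indicator_def nonlocal_op_def right_diff_distrib)
      also have "\<dots> = (LINT x|lebesgue. exp r * (c * indicator (A n) x * conv (\<lambda>y. u y r) x))
          - (LINT x|lebesgue. exp r * (c * indicator (A n) x * u x r))"
        using conv_int ind_u[OF r0] by (intro Bochner_Integration.integral_diff integrable_mult_right)
      finally have "(LINT x|lebesgue. exp r * (c * indicator (A n) x) * u x r)
        + (LINT x|lebesgue. indicator (- H) x * (exp r * (c * indicator (A n) x)) * nonlocal_op J (\<lambda>y. u y r) x)
        = (LINT x|lebesgue. exp r * (c * indicator (A n) x * conv (\<lambda>y. u y r) x))"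
        by (simp add: mult.assoc)
      also have "\<dots> \<le> (LINT x|lebesgue. indicator (A n) x * \<phi> r)"
      proof (rule integral_mono)
        show "integrable lebesgue (\<lambda>x. exp r * (c * indicator (A n) x * conv (\<lambda>y. u y r) x))"
          using conv_int by simp
        show "integrable lebesgue (\<lambda>x. indicator (A n) x * \<phi> r)" using ind_int by simp
        show "exp r * (c * indicator (A n) x * conv (\<lambda>y. u y r) x) \<le> indicator (A n) x * \<phi> r" for x
          using le[OF r, of x] by (auto simp: A_def indicator_def)
      qed
      also have "\<dots> = measure lebesgue (A n) * \<phi> r" by simp
      finally show "(LINT x|lebesgue. exp r * (c * indicator (A n) x) * u x r)
        + (LINT x|lebesgue. indicator (- H) x * (exp r * (c * indicator (A n) x)) * nonlocal_op J (\<lambda>y. u y r) x)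
        \<le> measure lebesgue (A n) * \<phi> r" .
    qed (use st in auto)
    also have "(LINT x|lebesgue. exp s * (c * indicator (A n) x) * u x s) \<le> (LINT x|lebesgue. indicator (A n) x * D)"
    proof (rule integral_mono_AE)
      show "integrable lebesgue (\<lambda>x. exp s * (c * indicator (A n) x) * u x s)"
        using ind_u[OF st(1)] by (simp add: mult.assoc)
      show "integrable lebesgue (\<lambda>x. indicator (A n) x * D)" using ind_int by simp
      show "AE x in lebesgue. exp s * (c * indicator (A n) x) * u x s \<le> indicator (A n) x * D"
        using init by eventually_elim (auto simp: A_def indicator_def mult_ac)
    qed
    finally have "(LINT x|lebesgue. exp t * (c * indicator (A n) x) * u x t)
        \<le> (LINT x|lebesgue. indicator (A n) x * D) + (measure lebesgue (A n) * \<Phi> t - measure lebesgue (A n) * \<Phi> s)"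
      by simp
    also have "\<dots> = measure lebesgue (A n) * E" by (simp add: E_def algebra_simps)
    finally have le_E: "(LINT x|lebesgue. exp t * (c * indicator (A n) x) * u x t) \<le> measure lebesgue (A n) * E" .
    \<comment> \<open>The excess over \<open>E\<close>: zero off \<open>A n\<close>, strictly
      positive on it, with integral at most 0; hence \<open>A n\<close> is null.\<close>
    define f where "f x = exp t * (c * indicator (A n) x) * u x t - indicator (A n) x * E" for x
    have f_int: "integrable lebesgue f"
      unfolding f_def using ind_u[OF t0] ind_int by (simp add: mult.assoc)
    have f_nonneg: "0 \<le> f x" for x by (auto simp: f_def A_def indicator_def mult_ac)
    have "integral\<^sup>L lebesgue f = (LINT x|lebesgue. exp t * (c * indicator (A n) x) * u x t) - measure lebesgue (A n) * E"
      unfolding f_def using ind_u[OF t0] ind_int by (simp add: mult.assoc)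
    then have "integral\<^sup>L lebesgue f \<le> 0" using le_E by simp
    then have "integral\<^sup>L lebesgue f = 0"
      using f_nonneg by (intro antisym integral_nonneg_AE) auto
    then have "AE x in lebesgue. f x = 0"
      using integral_nonneg_eq_0_iff_AE[OF f_int] f_nonneg by simp
    then show ?thesis by eventually_elim (auto simp: f_def A_def indicator_def mult_ac)
  qed
  have "AE x in lebesgue. \<forall>n. x \<notin> A n" using null by (simp add: AE_all_countable)
  then show ?thesis
  proof eventually_elim
    case (elim x)
    obtain n where "\<bar>x\<bar> \<le> real n" using real_arch_simple by blast
    with elim show ?case by (auto simp: A_def E_def not_less)
  qed
qed

text \<open>Compactness upgrades the local bounds: times with norms exceeding n would accumulate at
  some l, against \<open>weighted_norm_bounded\<close> at l.\<close>

lemma weighted_norm_bounded_on: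
  obtains N where "\<And>s. 0 \<le> s \<Longrightarrow> s \<le> t \<Longrightarrow> (LINT x|lebesgue. (1 + x^2) * \<bar>u x s\<bar>) \<le> N"
proof (cases "0 \<le> t")
  case True
  define N where "N s = (LINT x|lebesgue. (1 + x^2) * \<bar>u x s\<bar>)" for s
  have "\<exists>M. \<forall>s\<in>{0..t}. N s \<le> M"
  proof (rule ccontr)
    assume "\<nexists>M. \<forall>s\<in>{0..t}. N s \<le> M"
    then have "\<forall>n. \<exists>s. s \<in> {0..t} \<and> real n < N s" by (meson not_le)
    then obtain \<sigma> where \<sigma>: "\<And>n. \<sigma> n \<in> {0..t}" "\<And>n. real n < N (\<sigma> n)" by metis
    obtain l r where lr: "l \<in> {0..t}" "strict_mono r" "(\<sigma> \<circ> r) \<longlonglongrightarrow> l"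
      using compact_Icc[of 0 t] \<sigma>(1) unfolding compact_def by blast
    have "\<forall>\<^sub>F s in nhds l. s \<in> {0..} \<longrightarrow> N s \<le> N l + 1"
    proof -
      have "\<forall>\<^sub>F s in at l within {0..}. N s \<le> N l + 1"
        unfolding N_def using lr by (intro weighted_norm_bounded) auto
      then show ?thesis by (auto simp: eventually_at_filter elim!: eventually_mono)
    qed
    then have "\<forall>\<^sub>F n in sequentially. (\<sigma> \<circ> r) n \<in> {0..} \<longrightarrow> N ((\<sigma> \<circ> r) n) \<le> N l + 1"
      using lr(3) unfolding filterlim_def le_filter_def eventually_filtermap by blast
    moreover have "\<forall>\<^sub>F n in sequentially. N l + 1 < real n"
      using filterlim_real_sequentially by (simp add: filterlim_at_top_dense)
    ultimately have "\<forall>\<^sub>F n in sequentially. False"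
    proof eventually_elim
      case (elim n)
      have "N ((\<sigma> \<circ> r) n) \<le> N l + 1" using elim(1) \<sigma>(1)[of "r n"] by auto
      moreover have "real n \<le> real (r n)" using seq_suble[OF lr(2), of n] by simp
      ultimately show ?case using elim(2) \<sigma>(2)[of "r n"] by simp
    qed
    then show False by simp
  qed
  then obtain M where M: "\<forall>s\<in>{0..t}. N s \<le> M" by blast
  show ?thesis by (rule that[of M]) (use M in \<open>auto simp: N_def\<close>)
next
  case False
  then show ?thesis using that[of 0] by simp
qed

lemma conv_u_bounded_on:
  obtains B where "\<And>s x. 0 \<le> s \<Longrightarrow> s \<le> t \<Longrightarrow> \<bar>exp s * conv (\<lambda>y. u y s) x\<bar> \<le> B"
proof -
  obtain N where N: "\<And>s. 0 \<le> s \<Longrightarrow> s \<le> t \<Longrightarrow> (LINT x|lebesgue. (1 + x^2) * \<bar>u x s\<bar>) \<le> N"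
    by (rule weighted_norm_bounded_on[of t]) blast
  show ?thesis
  proof (rule that[of "exp t * (J 0 * N)"])
    fix s x assume s: "0 \<le> s" "s \<le> t"
    have "\<bar>conv (\<lambda>y. u y s) x\<bar> \<le> J 0 * (LINT x|lebesgue. \<bar>u x s\<bar>)"
      using integrable_weighted_lebesgue_integrable[OF u_integrable[OF s(1)]] by (rule abs_conv_le)
    also have "\<dots> \<le> J 0 * (LINT x|lebesgue. (1 + x^2) * \<bar>u x s\<bar>)"
    proof (intro mult_left_mono integral_mono)
      show "integrable lebesgue (\<lambda>x. \<bar>u x s\<bar>)"
        using integrable_weighted_lebesgue_integrable[OF u_integrable[OF s(1)]] by simp
      show "integrable lebesgue (\<lambda>x. (1 + x^2) * \<bar>u x s\<bar>)"
        using integrable_abs[OF u_integrable[OF s(1)]] by (simp add: integrable_weighted_lebesgue_iff)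
    qed (use J0_pos in \<open>auto simp: distrib_right\<close>)
    also have "\<dots> \<le> J 0 * N" using N[OF s] J0_pos by (intro mult_left_mono) auto
    finally show "\<bar>exp s * conv (\<lambda>y. u y s) x\<bar> \<le> exp t * (J 0 * N)"
      unfolding abs_mult using s by (intro mult_mono) auto
  qed
qed

text \<open>
  Starting from the crude bound \<^term>\<open>exp s * conv (\<lambda>y. u y s) x \<ge> - B\<close>, Duhamel's formula and
  convolution with the probability density \<^term>\<open>J\<close> improve it to \<open>- B s^n / n!\<close> for every \<open>n\<close>.
\<close>

lemma conv_u_nonneg:
  assumes t: "0 \<le> t"
  shows "0 \<le> conv (\<lambda>y. u y t) x"
proof -
  obtain B where B: "\<And>s x. 0 \<le> s \<Longrightarrow> s \<le> t \<Longrightarrow> \<bar>exp s * conv (\<lambda>y. u y s) x\<bar> \<le> B"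
    by (rule conv_u_bounded_on[of t]) blast
  have B0: "0 \<le> B" using B[OF order_refl t, of 0] by linarith
  have bound: "- (B * (s ^ n / fact n)) \<le> exp s * conv (\<lambda>y. u y s) x" if "0 \<le> s" "s \<le> t" for s n x
    using that
  proof (induction n arbitrary: s x)
    case 0
    then show ?case using B[of s x] by simp
  next
    case (Suc n)
    note s = Suc.prems
    define b where "b = B * (s ^ Suc n / fact (Suc n))"
    have b: "0 \<le> b" using B0 s by (simp add: b_def)
    \<comment> \<open>Duhamel with c = -1: the induction hypothesis is the source bound, and its
      primitive raises n by one. Nonnegativity of \<open>b\<close> then covers the hole, where
      \<open>u\<close> vanishes.\<close>
    have "AE x in lebesgue. x \<in> - H \<longrightarrow> - 1 * exp s * u x s
        \<le> 0 + (B * (s ^ Suc n / fact (Suc n)) - B * (0 ^ Suc n / fact (Suc n)))"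
    proof (rule duhamel_bound[where \<Phi> = "\<lambda>s. B * (s ^ Suc n / fact (Suc n))" and \<phi> = "\<lambda>s. B * (s ^ n / fact n)"])
      show "- H \<in> sets lebesgue" by (rule sets_Compl_H)
      show "continuous_on {0..s} (\<lambda>s. B * (s ^ Suc n / fact (Suc n)))"
        by (intro continuous_intros) simp
      show "((\<lambda>s. B * (s ^ Suc n / fact (Suc n))) has_real_derivative B * (r ^ n / fact n)) (at r)" for r
        by (intro DERIV_cmult DERIV_power_over_fact)
      show "exp r * (- 1 * conv (\<lambda>y. u y r) x) \<le> B * (r ^ n / fact n)" if "0 < r" "r < s" for r x
        using Suc.IH[of r x] that s by simp
      show "AE x in lebesgue. x \<in> - H \<longrightarrow> - 1 * exp 0 * u x 0 \<le> 0"
      proof -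
        have "AE x in lebesgue. 0 \<le> u0 x" using datum by (simp add: admissible_datum_def)
        with u_initial show ?thesis by eventually_elim simp
      qed
    qed (use s in auto)
    then have "AE x in lebesgue. - exp s * u x s \<le> b"
      using u_hole[OF s(1)] by eventually_elim (use b in \<open>auto simp: b_def\<close>)
    then have "conv (\<lambda>y. - exp s * u y s) x \<le> b"
      using u_integrable[OF s(1)] by (intro conv_le_AE) auto
    moreover have "conv (\<lambda>y. - exp s * u y s) x = - (exp s * conv (\<lambda>y. u y s) x)"
    proof -
      have "conv (\<lambda>y. - exp s * u y s) x = (LINT y|lebesgue. - exp s * (J (x - y) * u y s))"
        unfolding Defs.convolution_def by (intro Bochner_Integration.integral_cong refl) simp
      then show ?thesis by (simp add: Defs.convolution_def)
    qed
    ultimately show ?case by (simp add: b_def)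
  qed
  have "(\<lambda>n. - (B * (t^n / fact n))) \<longlonglongrightarrow> - (B * 0)"
    using summable_LIMSEQ_zero[OF summable_exp[of t]]
    by (intro tendsto_intros) (simp add: divide_inverse mult.commute)
  then have "- (B * 0) \<le> exp t * conv (\<lambda>y. u y t) x"
    by (rule LIMSEQ_le_const2) (use bound[OF t order_refl] in auto)
  then show ?thesis by (simp add: zero_le_mult_iff)
qed

text \<open>The source in Duhamel's formula now has a sign, so the primitive 0 suffices. The
  convolution is treated first because it is defined pointwise and is itself the source.\<close>

lemma u_nonneg:
  assumes t: "0 \<le> t"
  shows "AE x in lebesgue. 0 \<le> u x t"
proof -
  have "AE x in lebesgue. x \<in> - H \<longrightarrow> - 1 * exp t * u x t \<le> 0 + (0 - 0)"
  proof (rule duhamel_bound[where \<Phi> = "\<lambda>_. 0" and \<phi> = "\<lambda>_. 0"])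
    show "exp r * (- 1 * conv (\<lambda>y. u y r) x) \<le> 0" if "0 < r" for r x
      using conv_u_nonneg[of r x] that by simp
    show "AE x in lebesgue. x \<in> - H \<longrightarrow> - 1 * exp 0 * u x 0 \<le> 0"
    proof -
      have "AE x in lebesgue. 0 \<le> u0 x" using datum by (simp add: admissible_datum_def)
      with u_initial show ?thesis by eventually_elim simp
    qed
  qed (use t sets_Compl_H in auto)
  then show ?thesis using u_hole[OF t]
    by eventually_elim (auto simp: zero_le_mult_iff)
qed

text \<open>Symmetry of the convolution moves it onto \<open>k\<close>, so the pairing has
  derivative at most the integral of (k' + conv k - k) u. The inequality is asked only off the hole
  because \<open>u\<close> lives there, and u >= 0 fixes the sign.\<close>

lemma supersolution_test:
  assumes ab: "0 \<le> \<alpha>" "\<alpha> \<le> \<beta>" and k: "test_family {\<alpha>..\<beta>} k k'"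
    and nonneg: "\<And>s x. s \<in> {\<alpha>..\<beta>} \<Longrightarrow> 0 \<le> k s x"
    and super: "\<And>s x. \<alpha> < s \<Longrightarrow> s < \<beta> \<Longrightarrow> x \<notin> H \<Longrightarrow> k' s x + conv (k s) x - k s x \<le> 0"
  shows "(LINT x|lebesgue. k \<beta> x * u x \<beta>) \<le> (LINT x|lebesgue. k \<alpha> x * u x \<alpha>)"
proof -
  obtain C where C: "\<And>s. s \<in> {\<alpha>..\<beta>} \<Longrightarrow> k s \<in> borel_measurable lebesgue" "\<And>s. s \<in> {\<alpha>..\<beta>} \<Longrightarrow> k' s \<in> borel_measurable lebesgue"
    "\<And>s x. s \<in> {\<alpha>..\<beta>} \<Longrightarrow> \<bar>k s x\<bar> \<le> C * (1 + x^2)" "\<And>s x. s \<in> {\<alpha>..\<beta>} \<Longrightarrow> \<bar>k' s x\<bar> \<le> C * (1 + x^2)"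
    using k unfolding test_family_def by blast
  have "(LINT x|lebesgue. k \<beta> x * u x \<beta>) \<le> (LINT x|lebesgue. k \<alpha> x * u x \<alpha>) + (0 - 0)"
  proof (rule testing_mono[OF ab k, where \<Phi> = "\<lambda>_. 0" and \<phi> = "\<lambda>_. 0"])
    fix s assume s: "\<alpha> < s" "s < \<beta>"
    then have s0: "0 \<le> s" and sI: "s \<in> {\<alpha>..\<beta>}" using ab by auto
    note us = u_integrable[OF s0]
    have ku: "integrable lebesgue (\<lambda>x. k s x * u x s)" "integrable lebesgue (\<lambda>x. k' s x * u x s)"
      by (rule integrable_lebesgue_weight_bound[OF us C(1)[OF sI] C(3)[OF sI]],
          rule integrable_lebesgue_weight_bound[OF us C(2)[OF sI] C(4)[OF sI]])
    have kc: "integrable lebesgue (\<lambda>x. k s x * conv (\<lambda>y. u y s) x)"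
      by (rule integrable_mult_conv[OF us C(1)[OF sI] C(3)[OF sI]])
    have conv_k_le: "\<bar>conv (k s) x\<bar> \<le> (C * (2 + 2 * d^2)) * (1 + x^2)" for x
      by (rule conv_weight_le[OF C(1)[OF sI] C(3)[OF sI]])
    have conv_ku: "integrable lebesgue (\<lambda>x. conv (k s) x * u x s)"
    proof (rule integrable_lebesgue_weight_bound[OF us _ conv_k_le])
      interpret sigma_finite_measure "lebesgue :: real measure" by (rule sigma_finite_lebesgue)
      note C(1)[OF sI, measurable]
      have [measurable]: "(\<lambda>x::real. x) \<in> borel_measurable lebesgue"
        by (rule measurable_completion) measurable
      show "conv (k s) \<in> borel_measurable lebesgue"
        unfolding Defs.convolution_def[abs_def] by measurable
    qed
    \<comment> \<open>Dropping the indicator adds k times the convolution of \<open>u\<close> on the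
      hole, which is nonnegative: what would jump into the hole is lost, and ignoring the loss only
      raises the bound.\<close>
    have "(LINT x|lebesgue. indicator (- H) x * k s x * nonlocal_op J (\<lambda>y. u y s) x)
       \<le> (LINT x|lebesgue. k s x * conv (\<lambda>y. u y s) x - k s x * u x s)"
    proof (rule integral_mono_AE)
      show "integrable lebesgue (\<lambda>x. k s x * conv (\<lambda>y. u y s) x - k s x * u x s)"
        using ku kc by simp
      have "integrable lebesgue (\<lambda>x. k s x * nonlocal_op J (\<lambda>y. u y s) x)"
        by (rule integrable_mult_nonlocal_op[OF us C(1)[OF sI] C(3)[OF sI]])
      then have "integrable lebesgue (\<lambda>x. indicator (- H) x *\<^sub>R (k s x * nonlocal_op J (\<lambda>y. u y s) x))"
        by (intro integrable_mult_indicator sets_Compl_H)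
      then show "integrable lebesgue (\<lambda>x. indicator (- H) x * k s x * nonlocal_op J (\<lambda>y. u y s) x)"
        by (simp add: mult.assoc)
      show "AE x in lebesgue. indicator (- H) x * k s x * nonlocal_op J (\<lambda>y. u y s) x
          \<le> k s x * conv (\<lambda>y. u y s) x - k s x * u x s"
        using u_hole[OF s0]
      proof eventually_elim
        case (elim x)
        have "0 \<le> k s x * conv (\<lambda>y. u y s) x" using nonneg[OF sI] conv_u_nonneg[OF s0] by simp
        then show ?case using elim
          by (cases "x \<in> H") (auto simp: nonlocal_op_def right_diff_distrib)
      qed
    qed
    also have "\<dots> = (LINT x|lebesgue. conv (k s) x * u x s) - (LINT x|lebesgue. k s x * u x s)"
      using ku kc integral_mult_conv[OF us C(1)[OF sI] C(3)[OF sI]] by simp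
    finally have "(LINT x|lebesgue. k' s x * u x s) + (LINT x|lebesgue. indicator (- H) x * k s x * nonlocal_op J (\<lambda>y. u y s) x)
      \<le> (LINT x|lebesgue. k' s x * u x s + conv (k s) x * u x s - k s x * u x s)"
      using ku conv_ku by simp
    also have "\<dots> \<le> (LINT x|(lebesgue :: real measure). (0::real))"
    proof (rule integral_mono_AE)
      show "integrable lebesgue (\<lambda>x. k' s x * u x s + conv (k s) x * u x s - k s x * u x s)"
        using ku conv_ku by simp
      show "AE x in lebesgue. k' s x * u x s + conv (k s) x * u x s - k s x * u x s \<le> 0"
        using u_hole[OF s0] u_nonneg[OF s0]
      proof eventually_elim
        case (elim x)
        show ?case
        proof (cases "x \<in> H")
          case False
          have "(k' s x + conv (k s) x - k s x) * u x s \<le> 0"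
            using super[OF s False] elim by (intro mult_nonpos_nonneg) auto
          then show ?thesis by (simp add: algebra_simps)
        qed (use elim in simp)
      qed
    qed simp
    finally show "(LINT x|lebesgue. k' s x * u x s) + (LINT x|lebesgue. indicator (- H) x * k s x * nonlocal_op J (\<lambda>y. u y s) x) \<le> 0"
      by simp
  qed auto
  then show ?thesis by simp
qed

section \<open>Mass and first moment\<close>

definition mass :: "real \<Rightarrow> real" where
  "mass t = (LINT x|lebesgue. u x t)"

lemma mass_nonneg: "0 \<le> t \<Longrightarrow> 0 \<le> mass t"
  unfolding mass_def by (intro integral_nonneg_AE u_nonneg)

text \<open>Constants solve the adjoint equation exactly, since \<open>J\<close> has integral
  1.\<close>

lemma mass_antimono:
  assumes "0 \<le> s" "s \<le> t"
  shows "mass t \<le> mass s"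
proof -
  have "(LINT x|lebesgue. 1 * u x t) \<le> (LINT x|lebesgue. 1 * u x s)"
    by (rule supersolution_test[OF assms test_family_const[where f = "\<lambda>_. 1" and C = 1]])
      (auto simp: Defs.convolution_def integral_J_shift)
  then show ?thesis by (simp add: mass_def)
qed

lemma u_first_moment_integrable: "0 \<le> t \<Longrightarrow> integrable lebesgue (\<lambda>x. \<bar>x\<bar> * u x t)"
  by (rule integrable_lebesgue_weight_bound[where C = 1, OF u_integrable])
    (auto simp: abs_le_one_plus_square intro!: measurable_completion)

text \<open>The cut is made at a0 rather than along \<open>H\<close> because (-a0, a0) is the
  interval known to lie in the hole. As \<open>u\<close> vanishes there, the cut costs nothing in
  pairings, while it lowers the convolution near the origin by an amount set by
  \<open>B\<close>.\<close>

definition barrier :: "real \<Rightarrow> real \<Rightarrow> real" where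
  "barrier B y = (B + \<bar>y\<bar>) * indicator {y. a0 \<le> \<bar>y\<bar>} y"

lemma measurable_barrier: "barrier B \<in> borel_measurable lebesgue"
  unfolding barrier_def[abs_def] by (rule measurable_completion) measurable

lemma abs_barrier_le:
  assumes "0 < B"
  shows "\<bar>barrier B y\<bar> \<le> (B + 1) * (1 + y^2)"
proof -
  have "\<bar>barrier B y\<bar> \<le> B + \<bar>y\<bar>" using assms by (auto simp: barrier_def indicator_def)
  also have "\<dots> \<le> B * (1 + y^2) + 1 * (1 + y^2)"
    using assms abs_le_one_plus_square[of y] by (intro add_mono) (auto simp: distrib_left)
  finally show ?thesis by (simp add: algebra_simps)
qed

text \<open>
  The barrier is a supersolution for large \<open>B\<close>: \<^term>\<open>conv abs x = \<bar>x\<bar>\<close> for \<^term>\<open>d \<le> \<bar>x\<bar>\<close>, and from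
  every point with \<^term>\<open>\<bar>x\<bar> < d\<close> the kernel charges the hole with a mass bounded below.
\<close>

lemma first_moment_supersolution:
  obtains B where "0 < B"
    "\<And>x. a0 \<le> \<bar>x\<bar> \<Longrightarrow> conv (barrier B) x \<le> B + \<bar>x\<bar>"
proof -
  \<comment> \<open>A quarter leaves room, on the side of x, for an interval of length e inside
    (-a0, a0); for a0 <= |x| < d all its points are within d - e of x.\<close>
  define e where "e = min a0 d / 4"
  have e: "0 < e" "4 * e \<le> a0" "4 * e \<le> d" using a0_pos d_pos by (auto simp: e_def)
  have Je: "0 < J (d - e)" using e d_pos by (simp add: J_pos_iff)
  \<comment> \<open>Tuned so that B times e J(d - e), the least charge of that interval, equals d,
    the largest excess in \<open>conv_abs_le\<close>.\<close>
  define B where "B = d / (e * J (d - e))"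
  have B: "0 < B" "B * (e * J (d - e)) = d" using e Je d_pos by (auto simp: B_def)
  define k where "k = barrier B"
  have k_meas: "k \<in> borel_measurable lebesgue"
    and k_le: "\<bar>k y\<bar> \<le> (B + 1) * (1 + y^2)" for y
    unfolding k_def by (rule measurable_barrier, rule abs_barrier_le[OF B(1)])
  have abs_meas: "(abs :: real \<Rightarrow> real) \<in> borel_measurable lebesgue" by (rule measurable_completion) measurable
  have int_k: "integrable lebesgue (\<lambda>y. J (x - y) * k y)" for x
    using k_meas k_le by (rule integrable_J_weight)
  have int_abs: "integrable lebesgue (\<lambda>y. J (x - y) * \<bar>y\<bar>)" for x
    using abs_meas by (rule integrable_J_weight[where C = 1]) (simp add: abs_le_one_plus_square)
  have "conv k x \<le> B + \<bar>x\<bar>" if x: "a0 \<le> \<bar>x\<bar>" for x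
  proof (cases "d \<le> \<bar>x\<bar>")
    case True
    have "conv k x \<le> (LINT y|lebesgue. B * J (x - y) + J (x - y) * \<bar>y\<bar>)"
      unfolding Defs.convolution_def
    proof (rule integral_mono[OF int_k])
      show "integrable lebesgue (\<lambda>y. B * J (x - y) + J (x - y) * \<bar>y\<bar>)"
        using int_abs integrable_J_shift by simp
      fix y
      have "J (x - y) * k y \<le> J (x - y) * (B + \<bar>y\<bar>)"
        using B by (intro mult_left_mono J_nonneg) (auto simp: k_def barrier_def indicator_def)
      then show "J (x - y) * k y \<le> B * J (x - y) + J (x - y) * \<bar>y\<bar>" by (simp add: algebra_simps)
    qed
    also have "\<dots> = B + conv abs x"
      using int_abs integrable_J_shift by (simp add: integral_J_shift Defs.convolution_def)
    finally show ?thesis using conv_abs_eq[OF True] by simp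
  next
    case False
    define I where "I = (if 0 \<le> x then {e..2*e} else {-2*e..-e})"
    have I: "I \<in> lmeasurable" "measure lebesgue I = e" using e by (auto simp: I_def)
    have I_int: "integrable lebesgue (indicator I :: real \<Rightarrow> real)" using I by (auto simp: fmeasurable_def)
    have I_J: "J (d - e) \<le> J (x - y)" "k y = 0" if "y \<in> I" for y
    proof -
      have "\<bar>x - y\<bar> \<le> d - e" "\<bar>y\<bar> < a0" using that False e by (auto simp: I_def abs_if split: if_splits)
      then show "J (d - e) \<le> J (x - y)" "k y = 0"
        using J_antimono[of "\<bar>x - y\<bar>" "d - e"] by (auto simp: J_abs k_def barrier_def)
    qed
    have "conv k x \<le> (LINT y|lebesgue. B * J (x - y) + J (x - y) * \<bar>y\<bar> - B * J (d - e) * indicator I y)"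
      unfolding Defs.convolution_def
    proof (rule integral_mono[OF int_k])
      show "integrable lebesgue (\<lambda>y. B * J (x - y) + J (x - y) * \<bar>y\<bar> - B * J (d - e) * indicator I y)"
        using int_abs integrable_J_shift I_int by simp
      fix y
      show "J (x - y) * k y \<le> B * J (x - y) + J (x - y) * \<bar>y\<bar> - B * J (d - e) * indicator I y"
      proof (cases "y \<in> I")
        case True
        have "B * J (d - e) \<le> B * J (x - y)" using B I_J[OF True] by (intro mult_left_mono) auto
        moreover have "0 \<le> J (x - y) * \<bar>y\<bar>" using J_nonneg[of "x - y"] by simp
        ultimately show ?thesis using True I_J[OF True] by simp
      next
        case False
        have "J (x - y) * k y \<le> J (x - y) * (B + \<bar>y\<bar>)"
          using B by (intro mult_left_mono J_nonneg) (auto simp: k_def barrier_def indicator_def)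
        then show ?thesis using False by (simp add: algebra_simps)
      qed
    qed
    also have "\<dots> = B + conv abs x - d"
      using int_abs integrable_J_shift I_int I B
      by (simp add: integral_J_shift Defs.convolution_def mult_ac)
    finally show ?thesis using conv_abs_le[of x] by simp
  qed
  then show ?thesis using that[OF B(1)] by (simp add: k_def)
qed

text \<open>The barrier dominates |x| wherever \<open>u\<close> can be nonzero, and its pairing with
  \<open>u\<close> never exceeds the value at time 0.\<close>

lemma first_moment_bound:
  obtains P where "0 \<le> P" "\<And>t. 0 \<le> t \<Longrightarrow> (LINT x|lebesgue. \<bar>x\<bar> * u x t) \<le> P"
proof -
  obtain B where B: "0 < B"
    "\<And>x. a0 \<le> \<bar>x\<bar> \<Longrightarrow> conv (barrier B) x \<le> B + \<bar>x\<bar>"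
    by (rule first_moment_supersolution) blast
  define k where "k = barrier B"
  have k_meas: "k \<in> borel_measurable lebesgue"
    and k_le: "\<bar>k y\<bar> \<le> (B + 1) * (1 + y^2)" for y
    unfolding k_def by (rule measurable_barrier, rule abs_barrier_le[OF B(1)])
  have k_nonneg: "0 \<le> k y" for y using B by (simp add: k_def barrier_def)
  have int_k: "integrable lebesgue (\<lambda>x. k x * u x t)" if "0 \<le> t" for t
    using u_integrable[OF that] k_meas k_le by (rule integrable_lebesgue_weight_bound)
  show ?thesis
  proof (rule that[of "LINT x|lebesgue. k x * u x 0"])
    have "AE x in lebesgue. 0 \<le> k x * u x 0"
      using u_nonneg[OF order_refl] by eventually_elim (simp add: k_nonneg)
    then show "0 \<le> (LINT x|lebesgue. k x * u x 0)" by (rule integral_nonneg_AE)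
    fix t :: real assume t: "0 \<le> t"
    have "(LINT x|lebesgue. \<bar>x\<bar> * u x t) \<le> (LINT x|lebesgue. k x * u x t)"
    proof (rule integral_mono_AE[OF u_first_moment_integrable[OF t] int_k[OF t]])
      show "AE x in lebesgue. \<bar>x\<bar> * u x t \<le> k x * u x t"
        using u_hole[OF t] u_nonneg[OF t]
      proof eventually_elim
        case (elim x)
        show ?case
        proof (cases "\<bar>x\<bar> < a0")
          case True
          then show ?thesis using elim hole_superset by simp
        next
          case False
          then show ?thesis using elim B by (intro mult_right_mono) (auto simp: k_def barrier_def)
        qed
      qed
    qed
    also have "\<dots> \<le> (LINT x|lebesgue. k x * u x 0)"
    proof (rule supersolution_test[OF order_refl t test_family_const[OF k_meas k_le] k_nonneg])
      fix x assume "x \<notin> H"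
      then have x: "a0 \<le> \<bar>x\<bar>" using hole_superset[of x] by linarith
      show "0 + conv k x - k x \<le> 0"
        using B(2)[OF x] x by (simp add: k_def barrier_def)
    qed
    finally show "(LINT x|lebesgue. \<bar>x\<bar> * u x t) \<le> (LINT x|lebesgue. k x * u x 0)" .
  qed
qed

section \<open>Comparison with the whole line, mass decay and the far bound\<close>

lemma measurable_heat_shift: "(\<lambda>y. heat (y - x) t) \<in> borel_measurable lebesgue"
  by (rule measurable_completion) measurable

lemma integrable_heat_u:
  assumes "0 \<le> s" "0 \<le> t"
  shows "integrable lebesgue (\<lambda>y. heat (y - x) t * u y s)"
proof (rule integrable_lebesgue_weight_bound[OF u_integrable[OF assms(1)] measurable_heat_shift])
  show "\<bar>heat (y - x) t\<bar> \<le> 1 * (1 + y^2)" for y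
    using heat_le_1[OF assms(2), of "y - x"] by (simp add: add_increasing2)
qed

text \<open>
  Testing with the backward heat kernel \<^term>\<open>\<lambda>s y. heat (y - x) (t - s)\<close> compares with the Cauchy
  problem on the whole line.
\<close>

lemma conv_u_le_heat:
  assumes "0 \<le> s" "s \<le> t"
  shows "conv (\<lambda>y. u y t) x \<le> J 0 * exp (d^2 / 2) * (LINT y|lebesgue. heat (y - x) (t - s) * u y s)"
proof -
  have t: "0 \<le> t" using assms by simp
  have op_meas: "(\<lambda>y. nonlocal_op J (\<lambda>y. heat y r) (y - x)) \<in> borel_measurable lebesgue" if "0 \<le> r" for r
    unfolding nonlocal_op_def conv_heat[OF that] by (rule measurable_completion) measurable
  have conv_heat_le: "\<bar>conv (\<lambda>y. heat y r) z\<bar> \<le> 1" if "0 \<le> r" for r z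
  proof -
    have "conv (\<lambda>y. heat y r) z = (LINT w|lborel. J w * heat (z - w) r)"
      unfolding Defs.convolution_def by (rule integral_J_shift_lborel) measurable
    also have "\<bar>\<dots>\<bar> \<le> 1" by (rule integral_J_mult_le) (use heat_le_1[OF that] in auto)
    finally show ?thesis .
  qed
  \<comment> \<open>The backward kernel solves the adjoint equation exactly, so the supersolution
    condition holds with equality.\<close>
  have "(LINT y|lebesgue. heat (y - x) (t - t) * u y t) \<le> (LINT y|lebesgue. heat (y - x) (t - s) * u y s)"
  proof (rule supersolution_test[OF assms, where k = "\<lambda>r y. heat (y - x) (t - r)"
        and k' = "\<lambda>r y. - nonlocal_op J (\<lambda>y. heat y (t - r)) (y - x)"])
    show "test_family {s..t} (\<lambda>r y. heat (y - x) (t - r)) (\<lambda>r y. - nonlocal_op J (\<lambda>y. heat y (t - r)) (y - x))"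
      unfolding test_family_def
    \<comment> \<open>The remainder constant of \<open>heat_taylor1_bound\<close>; the bounds 1 for
      the kernel and 2 for its time derivative fit below it.\<close>
    proof (intro exI[of _ 4] conjI ballI allI)
      fix r y :: real assume "r \<in> {s..t}"
      then have r: "0 \<le> t - r" by simp
      show "(\<lambda>y. heat (y - x) (t - r)) \<in> borel_measurable lebesgue" by (rule measurable_heat_shift)
      show "(\<lambda>y. - nonlocal_op J (\<lambda>y. heat y (t - r)) (y - x)) \<in> borel_measurable lebesgue"
        using op_meas[OF r] by simp
      have y: "2 \<le> 4 * (1 + y^2)" using zero_le_power2[of y] unfolding distrib_left by linarith
      have "\<bar>heat (y - x) (t - r)\<bar> \<le> 2" using heat_le_1[OF r, of "y - x"] by linarith
      then show "\<bar>heat (y - x) (t - r)\<bar> \<le> 4 * (1 + y^2)" using y by (rule order_trans)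
      have "\<bar>- nonlocal_op J (\<lambda>y. heat y (t - r)) (y - x)\<bar> \<le> 2"
        using heat_le_1[OF r, of "y - x"] conv_heat_le[OF r, of "y - x"]
        unfolding nonlocal_op_def by linarith
      then show "\<bar>- nonlocal_op J (\<lambda>y. heat y (t - r)) (y - x)\<bar> \<le> 4 * (1 + y^2)"
        using y by (rule order_trans)
    next
      fix q r y :: real assume "q \<in> {s..t}" "r \<in> {s..t}"
      then have "\<bar>heat (y - x) (t - q) - heat (y - x) (t - r)
          - ((t - q) - (t - r)) * nonlocal_op J (\<lambda>y. heat y (t - r)) (y - x)\<bar> \<le> 4 * ((t - q) - (t - r))^2"
        by (intro heat_taylor1_bound) auto
      also have "\<dots> \<le> 4 * (q - r)^2 * (1 + y^2)"
        by (simp add: power2_commute[of q r] distrib_left)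
      finally show "\<bar>heat (y - x) (t - q) - heat (y - x) (t - r)
          - (q - r) * - nonlocal_op J (\<lambda>y. heat y (t - r)) (y - x)\<bar> \<le> 4 * (q - r)^2 * (1 + y^2)"
        by (simp add: algebra_simps)
    qed
    show "0 \<le> heat (y - x) (t - r)" if "r \<in> {s..t}" for r y
      using that by (intro heat_nonneg) auto
    show "- nonlocal_op J (\<lambda>y. heat y (t - r)) (y - x) + conv (\<lambda>y. heat (y - x) (t - r)) y - heat (y - x) (t - r) \<le> 0" for r y
      using conv_translate[of "\<lambda>y. heat y (t - r)" x y] by (simp add: nonlocal_op_def)
  qed
  \<comment> \<open>\<open>J\<close> is replaced by a multiple of the Gaussian, which is the final
    value of the backward kernel; this joins the convolution to the tested pairing.\<close>
  moreover have "conv (\<lambda>y. u y t) x \<le> (LINT y|lebesgue. J 0 * exp (d^2 / 2) * (heat (y - x) (t - t) * u y t))"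
    unfolding Defs.convolution_def
  proof (rule integral_mono_AE)
    show "integrable lebesgue (\<lambda>y. J (x - y) * u y t)"
    proof (rule integrable_lebesgue_weight_bound[OF u_integrable[OF t]])
      show "\<bar>J (x - y)\<bar> \<le> J 0 * (1 + y^2)" for y
        using J_le[of "x - y"] J_nonneg[of "x - y"] J0_pos
        by (simp add: distrib_left add_increasing2)
    qed measurable
    have "integrable lebesgue (\<lambda>y. heat (y - x) (t - t) * u y t)"
      using t by (intro integrable_heat_u) auto
    then show "integrable lebesgue (\<lambda>y. J 0 * exp (d^2 / 2) * (heat (y - x) (t - t) * u y t))" by simp
    show "AE y in lebesgue. J (x - y) * u y t \<le> J 0 * exp (d^2 / 2) * (heat (y - x) (t - t) * u y t)"
      using u_nonneg[OF t]
    proof eventually_elim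
      case (elim y)
      have "J (x - y) * u y t \<le> J 0 * exp (d^2 / 2) * exp (- ((y - x)^2) / 2) * u y t"
        using J_le_gaussian[of "y - x"] elim by (intro mult_right_mono) (auto simp: J_diff_commute)
      then show ?case by (simp add: heat_0 mult.assoc)
    qed
  qed
  ultimately show ?thesis
    using J0_pos by (simp add: mult_left_mono order_trans)
qed

text \<open>The source exp r b has primitive b exp r, so dividing by exp t leaves b plus the
  unsmoothed share of u(s). On the hole the bound is trivial, as both constants are
  nonnegative.\<close>

lemma u_le_conv_bound:
  assumes st: "0 \<le> s" "s \<le> t" and A: "A \<in> sets lebesgue" and nonneg: "0 \<le> b" "0 \<le> D"
    and init: "AE x in lebesgue. x \<in> A \<longrightarrow> u x s \<le> D"
    and le: "\<And>r x. s < r \<Longrightarrow> r < t \<Longrightarrow> x \<in> A \<Longrightarrow> conv (\<lambda>y. u y r) x \<le> b"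
  shows "AE x in lebesgue. x \<in> A \<longrightarrow> u x t \<le> exp (- (t - s)) * D + b"
proof -
  have "AE x in lebesgue. x \<in> A \<inter> - H \<longrightarrow> 1 * exp t * u x t \<le> exp s * D + (b * exp t - b * exp s)"
  proof (rule duhamel_bound[where \<Phi> = "\<lambda>r. b * exp r" and \<phi> = "\<lambda>r. b * exp r"])
    show "A \<inter> - H \<in> sets lebesgue" using A sets_Compl_H by (rule sets.Int)
    show "continuous_on {s..t} (\<lambda>r. b * exp r)" by (intro continuous_intros)
    show "((\<lambda>r. b * exp r) has_real_derivative b * exp r) (at r)" for r
      by (intro DERIV_cmult DERIV_exp)
    show "exp r * (1 * conv (\<lambda>y. u y r) x) \<le> b * exp r" if "s < r" "r < t" "x \<in> A \<inter> - H" for r x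
      using le[of r x] that by simp
    show "AE x in lebesgue. x \<in> A \<inter> - H \<longrightarrow> 1 * exp s * u x s \<le> exp s * D"
      using init by eventually_elim simp
  qed (use st in auto)
  then show ?thesis using u_hole[OF order_trans[OF st]]
  proof eventually_elim
    case (elim x)
    show ?case
    proof (cases "x \<in> H")
      case True
      then show ?thesis using elim st nonneg by simp
    next
      case False
      show ?thesis
      proof
        assume "x \<in> A"
        then have "exp t * u x t \<le> exp s * D + (b * exp t - b * exp s)" using elim False by simp
        also have "\<dots> \<le> exp s * D + b * exp t" using nonneg by simp
        also have "\<dots> = exp t * (exp (- (t - s)) * D + b)"
          by (simp add: exp_diff field_simps)
        finally show "u x t \<le> exp (- (t - s)) * D + b" by simp
      qed
    qed
  qed
qed

lemma conv_u_le_mass: "0 \<le> t \<Longrightarrow> conv (\<lambda>y. u y t) x \<le> J 0 * mass t"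
proof -
  assume t: "0 \<le> t"
  have "(LINT y|lebesgue. \<bar>u y t\<bar>) = mass t"
    unfolding mass_def
  proof (rule integral_cong_AE)
    show "AE y in lebesgue. \<bar>u y t\<bar> = u y t" using u_nonneg[OF t] by eventually_elim simp
  qed (use u_measurable[OF t] in auto)
  then show ?thesis
    using abs_conv_le[OF integrable_weighted_lebesgue_integrable[OF u_integrable[OF t]], of x] by simp
qed

text \<open>The source is at most J 0 times the initial mass at all times, since J <= J 0 and the
  mass decreases. The bound later feeds the unsmoothed term in Duhamel's formula.\<close>

lemma u_bounded:
  obtains U where "0 \<le> U" "\<And>t. 0 \<le> t \<Longrightarrow> AE x in lebesgue. u x t \<le> U"
proof -
  have fin: "esssup lebesgue (\<lambda>x. ereal \<bar>u0 x\<bar>) < \<infinity>" using datum by (simp add: admissible_datum_def)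
  \<comment> \<open>The extended-real \<open>esssup\<close> becomes a real bound, kept nonnegative
    as \<open>u_le_conv_bound\<close> requires.\<close>
  obtain D where D: "0 \<le> D" "esssup lebesgue (\<lambda>x. ereal \<bar>u0 x\<bar>) \<le> ereal D"
  proof (cases "esssup lebesgue (\<lambda>x. ereal \<bar>u0 x\<bar>)")
    case (real r)
    then show ?thesis using that[of "max 0 r"] by simp
  next
    case MInf
    then show ?thesis using that[of 0] by simp
  qed (use fin in simp)
  have "AE x in lebesgue. ereal \<bar>u0 x\<bar> \<le> esssup lebesgue (\<lambda>x. ereal \<bar>u0 x\<bar>)" by (rule esssup_AE)
  with u_initial have init: "AE x in lebesgue. u x 0 \<le> D"
  proof eventually_elim
    case (elim x)
    then have "ereal \<bar>u0 x\<bar> \<le> ereal D" using D(2) by (metis order_trans)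
    then show ?case using elim(1) by simp
  qed
  show ?thesis
  proof (rule that[of "D + J 0 * mass 0"])
    show "0 \<le> D + J 0 * mass 0" using D(1) J0_pos mass_nonneg[of 0] by simp
    fix t :: real assume t: "0 \<le> t"
    have "AE x in lebesgue. x \<in> UNIV \<longrightarrow> u x t \<le> exp (- (t - 0)) * D + J 0 * mass 0"
    proof (rule u_le_conv_bound)
      show "0 \<le> J 0 * mass 0" using J0_pos mass_nonneg[of 0] by simp
      fix r x assume r: "0 < r" "r < t"
      have "conv (\<lambda>y. u y r) x \<le> J 0 * mass r" using r by (intro conv_u_le_mass) simp
      also have "\<dots> \<le> J 0 * mass 0" using r J0_pos by (intro mult_left_mono mass_antimono) auto
      finally show "conv (\<lambda>y. u y r) x \<le> J 0 * mass 0" .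
    qed (use t D init in auto)
    moreover have "exp (- (t - 0)) * D \<le> D" using t D(1) by (simp add: mult_left_le_one_le)
    ultimately show "AE x in lebesgue. u x t \<le> D + J 0 * mass 0" by (auto elim!: eventually_mono)
  qed
qed

text \<open>
  For \<^term>\<open>R = \<epsilon> * sqrt t\<close> the mass in \<^term>\<open>{-R..R}\<close> is at most \<open>2R\<close> times the supremum of \<open>u\<close>, which by
  smoothing is controlled by the mass at time \<open>t/4\<close>, and the mass outside is at most \<open>P/R\<close>.  For small
  \<open>\<epsilon>\<close> this makes \<^term>\<open>sqrt t * mass t\<close> contract along \<open>t \<mapsto> t/4\<close>.
\<close>

lemma mass_decay:
  obtains Q where "0 \<le> Q" "\<And>t. 0 < t \<Longrightarrow> sqrt t * mass t \<le> Q"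
proof -
  obtain C where C: "0 < C" "\<And>x t. 0 < t \<Longrightarrow> heat x t \<le> C / sqrt t"
    by (rule heat_bounds) blast
  obtain U where U: "0 \<le> U" "\<And>t. 0 \<le> t \<Longrightarrow> AE x in lebesgue. u x t \<le> U"
    by (rule u_bounded) blast
  obtain P where P: "0 \<le> P" "\<And>t. 0 \<le> t \<Longrightarrow> (LINT x|lebesgue. \<bar>x\<bar> * u x t) \<le> P"
    by (rule first_moment_bound) blast
  define G where "G = J 0 * exp (d^2 / 2) * C"
  have G: "0 < G" using C J0_pos by (simp add: G_def)
  have smoothing: "conv (\<lambda>y. u y t) x \<le> G / sqrt (t - s) * mass s" if st: "0 \<le> s" "s < t" for s t x
  proof -
    have "(LINT y|lebesgue. heat (y - x) (t - s) * u y s) \<le> (LINT y|lebesgue. C / sqrt (t - s) * u y s)"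
    proof (rule integral_mono_AE)
      show "integrable lebesgue (\<lambda>y. C / sqrt (t - s) * u y s)"
        using integrable_weighted_lebesgue_integrable[OF u_integrable[OF st(1)]] by simp
      show "integrable lebesgue (\<lambda>y. heat (y - x) (t - s) * u y s)"
        using st by (intro integrable_heat_u) auto
      show "AE y in lebesgue. heat (y - x) (t - s) * u y s \<le> C / sqrt (t - s) * u y s"
        using u_nonneg[OF st(1)]
      proof eventually_elim
        case (elim y)
        show ?case by (rule mult_right_mono[OF C(2) elim]) (use st in simp)
      qed
    qed
    also have "\<dots> = C / sqrt (t - s) * mass s" by (simp add: mass_def)
    finally have "J 0 * exp (d^2 / 2) * (LINT y|lebesgue. heat (y - x) (t - s) * u y s)
        \<le> J 0 * exp (d^2 / 2) * (C / sqrt (t - s) * mass s)"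
      using J0_pos by (intro mult_left_mono) auto
    then show ?thesis using conv_u_le_heat[of s t x] st by (simp add: G_def)
  qed
  \<comment> \<open>With this choice 4 G \<epsilon> = 1/4, and sqrt t = 2 sqrt (t/4) turns 1/4 into
    the contraction factor 1/2.\<close>
  define \<epsilon> where "\<epsilon> = 1 / (16 * G)"
  have \<epsilon>: "0 < \<epsilon>" using G by (simp add: \<epsilon>_def)
  define B where "B = 4 * \<epsilon> * U + P / \<epsilon>"
  have B: "0 \<le> B" using \<epsilon> U P by (simp add: B_def)
  have step: "sqrt t * mass t \<le> B + sqrt (t / 4) * mass (t / 4) / 2" if t: "0 < t" for t
  proof -
    define R where "R = \<epsilon> * sqrt t"
    have R: "0 < R" using \<epsilon> t by (simp add: R_def)
    \<comment> \<open>Duhamel starts at t/2 and smoothing at t/4, so the smoothing time is at least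
      t/4; its square root accounts for the 2.\<close>
    define b where "b = 2 * G / sqrt t * mass (t / 4)"
    have b: "0 \<le> b" using G t mass_nonneg[of "t/4"] by (simp add: b_def)
    have "AE x in lebesgue. x \<in> UNIV \<longrightarrow> u x t \<le> exp (- (t - t / 2)) * U + b"
    proof (rule u_le_conv_bound)
      show "AE x in lebesgue. x \<in> UNIV \<longrightarrow> u x (t / 2) \<le> U" using U(2)[of "t/2"] t by simp
      fix r x assume r: "t / 2 < r" "r < t"
      have "conv (\<lambda>y. u y r) x \<le> G / sqrt (r - t / 4) * mass (t / 4)"
        using smoothing[of "t/4" r x] r t by simp
      also have "\<dots> \<le> G / sqrt (t / 4) * mass (t / 4)"
        using r t G mass_nonneg[of "t/4"] by (intro mult_right_mono divide_left_mono) auto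
      also have "\<dots> = b" by (simp add: b_def real_sqrt_divide)
      finally show "conv (\<lambda>y. u y r) x \<le> b" .
    qed (use t b U in auto)
    then have sup: "AE x in lebesgue. u x t \<le> exp (- (t / 2)) * U + b" by simp
    define V where "V = exp (- (t / 2)) * U + b"
    have V: "0 \<le> V" using U b by (simp add: V_def)
    have "{-R..R} \<in> lmeasurable" by simp
    then have ind: "integrable lebesgue (indicator {-R..R} :: real \<Rightarrow> real)"
      by (auto simp: fmeasurable_def)
    have "mass t \<le> (LINT x|lebesgue. indicator {-R..R} x * V + \<bar>x\<bar> * u x t / R)"
      unfolding mass_def
    proof (rule integral_mono_AE)
      show "integrable lebesgue (\<lambda>x. u x t)"
        using integrable_weighted_lebesgue_integrable[OF u_integrable[of t]] t by simp
      show "integrable lebesgue (\<lambda>x. indicator {-R..R} x * V + \<bar>x\<bar> * u x t / R)"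
        using ind u_first_moment_integrable[of t] t by simp
      show "AE x in lebesgue. u x t \<le> indicator {-R..R} x * V + \<bar>x\<bar> * u x t / R"
        using sup u_nonneg[OF less_imp_le[OF t]]
      proof eventually_elim
        case (elim x)
        show ?case
        proof (cases "x \<in> {-R..R}")
          case True
          have "0 \<le> \<bar>x\<bar> * u x t / R" using R elim by simp
          from add_mono[OF elim(1) this] show ?thesis
            unfolding indicator_simps(1)[OF True] V_def by (simp only: add_0_right mult_1_left)
        next
          case False
          then have "R * u x t \<le> \<bar>x\<bar> * u x t" using elim by (intro mult_right_mono) (auto simp: abs_if)
          then show ?thesis using False R by (simp add: field_simps)
        qed
      qed
    qed
    also have "\<dots> = 2 * R * V + (LINT x|lebesgue. \<bar>x\<bar> * u x t) / R"
      using ind u_first_moment_integrable[of t] t R by simp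
    also have "\<dots> \<le> 2 * R * V + P / R"
      using P(2)[of t] t R by (intro add_left_mono divide_right_mono) auto
    finally have "sqrt t * mass t \<le> sqrt t * (2 * R * V + P / R)"
      using t by (intro mult_left_mono) auto
    also have "\<dots> = 2 * \<epsilon> * U * (t * exp (- (t / 2))) + 4 * G * \<epsilon> * (sqrt t * mass (t / 4)) + P / \<epsilon>"
      using t \<epsilon> by (simp add: R_def V_def b_def field_simps)
    also have "\<dots> \<le> 2 * \<epsilon> * U * 2 + 4 * G * \<epsilon> * (sqrt t * mass (t / 4)) + P / \<epsilon>"
    proof -
      have "t / 2 \<le> exp (t / 2)" using exp_ge_add_one_self[of "t / 2"] by linarith
      then have "t * exp (- (t / 2)) \<le> 2" by (simp add: exp_minus field_simps)
      then show ?thesis using \<epsilon> U by (intro add_right_mono mult_left_mono) auto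
    qed
    also have "\<dots> = B + sqrt (t / 4) * mass (t / 4) / 2"
      using G by (simp add: B_def \<epsilon>_def real_sqrt_divide)
    finally show ?thesis .
  qed
  \<comment> \<open>2B is the fixed point of q = B + q/2; 2 mass 0 covers the initial range t <=
    4.\<close>
  define Q where "Q = max (2 * B) (2 * mass 0)"
  \<comment> \<open>Induction over scales: t/4 falls into the previous range, and
    \<open>step\<close> keeps the bound once 2B <= Q.\<close>
  have "sqrt t * mass t \<le> Q" if "0 < t" "t \<le> 4 ^ Suc n" for t n
    using that
  proof (induction n arbitrary: t)
    case 0
    then have "sqrt t \<le> 2" using real_sqrt_le_mono[of t 4] by simp
    then have "sqrt t * mass t \<le> 2 * mass 0"
      using 0 mass_nonneg[of t] by (intro mult_mono mass_antimono) auto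
    then show ?case by (simp add: Q_def)
  next
    case (Suc n)
    then have "sqrt (t / 4) * mass (t / 4) \<le> Q" by (intro Suc.IH) auto
    then show ?case using step[OF Suc.prems(1)] by (simp add: Q_def)
  qed
  moreover have "\<exists>n. t \<le> 4 ^ Suc n" for t :: real
  proof -
    obtain n where n: "t < 4 ^ n" using real_arch_pow[of 4 t] by auto
    have "(4::real) ^ n \<le> 4 ^ Suc n" by simp
    with n have "t \<le> 4 ^ Suc n" by (rule less_imp_le[OF less_le_trans])
    then show ?thesis by blast
  qed
  ultimately have "sqrt t * mass t \<le> Q" if "0 < t" for t using that by blast
  moreover have "0 \<le> Q" using B by (simp add: Q_def)
  ultimately show ?thesis using that by blast
qed

text \<open>Uniform in t and R, with R left free until the rate g is inserted. The exponential term
  is the share of u(t/2) left unsmoothed; \<open>mass_decay\<close> gives the near part the same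
  factor 1 / (sqrt t R) that the first moment gives the far part.\<close>

lemma u_far_bound:
  obtains K U where "0 \<le> K" "0 \<le> U"
    "\<And>t R. 4 \<le> t \<Longrightarrow> 0 < R \<Longrightarrow> AE x in lebesgue. R \<le> \<bar>x\<bar> \<longrightarrow> u x t \<le> exp (- (t / 2)) * U + K / (sqrt t * R)"
proof -
  obtain C where C: "0 < C" "\<And>x t. 0 < t \<Longrightarrow> heat x t \<le> C / sqrt t" "\<And>x t. 1 \<le> t \<Longrightarrow> \<bar>x\<bar> * heat x t \<le> C"
    by (rule heat_bounds) blast
  obtain U where U: "0 \<le> U" "\<And>t. 0 \<le> t \<Longrightarrow> AE x in lebesgue. u x t \<le> U"
    by (rule u_bounded) blast
  obtain P where P: "0 \<le> P" "\<And>t. 0 \<le> t \<Longrightarrow> (LINT x|lebesgue. \<bar>x\<bar> * u x t) \<le> P"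
    by (rule first_moment_bound) blast
  obtain Q where Q: "0 \<le> Q" "\<And>t. 0 < t \<Longrightarrow> sqrt t * mass t \<le> Q"
    by (rule mass_decay) blast
  define K where "K = J 0 * exp (d^2 / 2) * (4 * C * (Q + P))"
  have K: "0 \<le> K" using J0_pos C P Q by (simp add: K_def)
  show ?thesis
  proof (rule that[OF K U(1)])
    fix t R :: real assume t: "4 \<le> t" and R: "0 < R"
    have "AE x in lebesgue. x \<in> {x. R \<le> \<bar>x\<bar>} \<longrightarrow> u x t \<le> exp (- (t - t / 2)) * U + K / (sqrt t * R)"
    proof (rule u_le_conv_bound)
      show "AE x in lebesgue. x \<in> {x. R \<le> \<bar>x\<bar>} \<longrightarrow> u x (t / 2) \<le> U"
        using U(2)[of "t / 2"] t by (auto elim!: eventually_mono)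
      have "closed {x::real. R \<le> \<bar>x\<bar>}" by (intro closed_Collect_le continuous_intros)
      then show "{x. R \<le> \<bar>x\<bar>} \<in> sets lebesgue" by auto
      fix r x assume r: "t / 2 < r" "r < t" and "x \<in> {x. R \<le> \<bar>x\<bar>}"
      then have x: "R \<le> \<bar>x\<bar>" by simp
      \<comment> \<open>Time elapsed since t/4: from r > t/2 and t >= 4 it is at least 1, where the
        spatial decay in \<open>heat_bounds\<close> holds, and at least t/4.\<close>
      define \<tau> where "\<tau> = r - t / 4"
      have \<tau>: "1 \<le> \<tau>" "t / 4 \<le> \<tau>" using r t by (auto simp: \<tau>_def)
      \<comment> \<open>An affine majorant in |y| covers both regions at once: the constant is the
        bound at distance R/2, the slope turns 2 C / sqrt t into a multiple of |y| >= R/2. Its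
        pairing with \<open>u\<close> involves just mass and first moment.\<close>
      define c where "c y = 2 * C / R + 4 * C / (sqrt t * R) * \<bar>y\<bar>" for y
      have heat_le: "heat (y - x) \<tau> \<le> c y" for y
      proof (cases "\<bar>y\<bar> < R / 2")
        case True
        then have "R / 2 \<le> \<bar>y - x\<bar>" using x by linarith
        then have "R / 2 * heat (y - x) \<tau> \<le> \<bar>y - x\<bar> * heat (y - x) \<tau>"
          using \<tau> by (intro mult_right_mono heat_nonneg) auto
        also have "\<dots> \<le> C" using \<tau> by (intro C)
        finally have "heat (y - x) \<tau> \<le> 2 * C / R" using R by (simp add: field_simps)
        moreover have "0 \<le> 4 * C / (sqrt t * R) * \<bar>y\<bar>" using C R t by simp
        ultimately show ?thesis by (simp add: c_def)
      next
        case False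
        have "heat (y - x) \<tau> \<le> C / sqrt \<tau>" using \<tau> by (intro C) auto
        also have "\<dots> \<le> C / sqrt (t / 4)" using \<tau> t C by (intro divide_left_mono) auto
        also have "\<dots> = 4 * C / (sqrt t * R) * (R / 2)" using R t by (simp add: real_sqrt_divide)
        also have "\<dots> \<le> 4 * C / (sqrt t * R) * \<bar>y\<bar>"
          using False R t C by (intro mult_left_mono) auto
        finally show ?thesis using C R by (simp add: c_def add_increasing)
      qed
      have t4: "0 \<le> t / 4" using t by simp
      note int = integrable_weighted_lebesgue_integrable[OF u_integrable[OF t4]] u_first_moment_integrable[OF t4]
      have "(LINT y|lebesgue. heat (y - x) \<tau> * u y (t / 4))
          \<le> (LINT y|lebesgue. 2 * C / R * u y (t / 4) + 4 * C / (sqrt t * R) * (\<bar>y\<bar> * u y (t / 4)))"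
      proof (rule integral_mono_AE)
        show "integrable lebesgue (\<lambda>y. 2 * C / R * u y (t / 4) + 4 * C / (sqrt t * R) * (\<bar>y\<bar> * u y (t / 4)))"
          using int by simp
        show "integrable lebesgue (\<lambda>y. heat (y - x) \<tau> * u y (t / 4))"
          using t4 \<tau> by (intro integrable_heat_u) auto
        show "AE y in lebesgue. heat (y - x) \<tau> * u y (t / 4)
            \<le> 2 * C / R * u y (t / 4) + 4 * C / (sqrt t * R) * (\<bar>y\<bar> * u y (t / 4))"
          using u_nonneg[OF t4]
        proof eventually_elim
          case (elim y)
          show ?case using mult_right_mono[OF heat_le[of y] elim] by (simp add: c_def algebra_simps)
        qed
      qed
      also have "\<dots> = 2 * C / R * mass (t / 4) + 4 * C / (sqrt t * R) * (LINT y|lebesgue. \<bar>y\<bar> * u y (t / 4))"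
        using int by (simp add: mass_def)
      also have "\<dots> \<le> 2 * C / R * (2 * Q / sqrt t) + 4 * C / (sqrt t * R) * P"
      proof (intro add_mono mult_left_mono P t4)
        show "mass (t / 4) \<le> 2 * Q / sqrt t"
          using Q(2)[of "t / 4"] t by (simp add: real_sqrt_divide field_simps)
      qed (use C R t in auto)
      also have "\<dots> = 4 * C * (Q + P) / (sqrt t * R)" using R t by (simp add: field_simps)
      finally have "J 0 * exp (d^2 / 2) * (LINT y|lebesgue. heat (y - x) \<tau> * u y (t / 4))
          \<le> J 0 * exp (d^2 / 2) * (4 * C * (Q + P) / (sqrt t * R))"
        using J0_pos by (intro mult_left_mono) auto
      then show "conv (\<lambda>y. u y r) x \<le> K / (sqrt t * R)"
        using conv_u_le_heat[of "t / 4" r x] r t by (simp add: K_def \<tau>_def)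
    qed (use t R K U in auto)
    then show "AE x in lebesgue. R \<le> \<bar>x\<bar> \<longrightarrow> u x t \<le> exp (- (t / 2)) * U + K / (sqrt t * R)" by simp
  qed
qed

end

section \<open>The main result\<close>

text \<open>On a null space \<open>esssup\<close> would be minus infinity; positive measure of the
  region is what makes 0 a lower bound for it.\<close>

lemma emeasure_lebesgue_outside_interval: "emeasure lebesgue {x::real. R \<le> \<bar>x\<bar>} \<noteq> 0"
proof
  assume "emeasure lebesgue {x::real. R \<le> \<bar>x\<bar>} = 0"
  moreover have "closed {x::real. R \<le> \<bar>x\<bar>}" by (intro closed_Collect_le continuous_intros)
  moreover have "{max R 0..max R 0 + 1} \<subseteq> {x. R \<le> \<bar>x\<bar>}" by auto
  ultimately have "emeasure lebesgue {max R 0..max R 0 + 1} \<le> 0"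
    by (metis emeasure_mono borel_closed sets_completionI_sets sets_lborel)
  then show False by simp
qed

theorem theorem8p1:
  fixes a0 a d :: real and H :: "real set" and J u0 :: "real \<Rightarrow> real"
    and u :: "real \<Rightarrow> real \<Rightarrow> real" and g :: "real \<Rightarrow> real"
  assumes "admissible_hole a0 a H"
    and "admissible_kernel d J"
    and "admissible_datum H u0"
    and "exterior_Dirichlet_solution H J u0 u"
    and "filterlim g at_top at_top"
  shows "((\<lambda>t. esssup (restrict_space lebesgue {x. g t * t powr (1/2) \<le> \<bar>x\<bar>})
                 (\<lambda>x. ereal (t * u x t))) \<longlongrightarrow> 0) at_top"
proof -
  interpret exterior_problem d J a0 a H u0 u
    by unfold_locales (rule assms)+
  obtain K U where K: "0 \<le> K" "0 \<le> U"
    and far: "\<And>t R. 4 \<le> t \<Longrightarrow> 0 < R \<Longrightarrow> AE x in lebesgue. R \<le> \<bar>x\<bar> \<longrightarrow> u x t \<le> exp (- (t / 2)) * U + K / (sqrt t * R)"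
    by (rule u_far_bound) blast
  \<comment> \<open>t times the far bound at R = g t sqrt t, namely t exp(-(t/2)) U + K / g t; the
    first term is rewritten as a power over an exponential in t/2 to expose its limit.\<close>
  define b where "b t = 2 * U * ((t / 2) ^ 1 / exp (t / 2)) + K * inverse (g t)" for t
  have "filterlim (\<lambda>t::real. 1/2 * t) at_top at_top"
    by (rule filterlim_tendsto_pos_mult_at_top[OF tendsto_const _ filterlim_ident]) simp
  then have half: "filterlim (\<lambda>t::real. t / 2) at_top at_top" by simp
  have "(b \<longlongrightarrow> 2 * U * 0 + K * 0) at_top"
    unfolding b_def
    by (intro tendsto_intros filterlim_compose[OF tendsto_power_div_exp_0 half]
        filterlim_compose[OF tendsto_inverse_0_at_top[OF filterlim_ident] assms(5)])
  then have upper_lim: "((\<lambda>t. ereal (b t)) \<longlongrightarrow> 0) at_top"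
    by (simp add: zero_ereal_def)
  have ev: "\<forall>\<^sub>F t in at_top. 4 \<le> t \<and> 0 < g t"
    using assms(5) by (intro eventually_conj eventually_ge_at_top) (auto simp: filterlim_at_top_dense)
  have bounds: "0 \<le> esssup (restrict_space lebesgue {x. g t * t powr (1/2) \<le> \<bar>x\<bar>}) (\<lambda>x. ereal (t * u x t))
      \<and> esssup (restrict_space lebesgue {x. g t * t powr (1/2) \<le> \<bar>x\<bar>}) (\<lambda>x. ereal (t * u x t)) \<le> ereal (b t)"
    if t: "4 \<le> t \<and> 0 < g t" for t
  proof -
    define R where "R = g t * sqrt t"
    have R: "0 < R" using t by (simp add: R_def)
    have R_eq: "g t * t powr (1/2) = R" using t by (simp add: R_def powr_half_sqrt)
    let ?M = "restrict_space lebesgue {x. R \<le> \<bar>x\<bar>}"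
    have "closed {x::real. R \<le> \<bar>x\<bar>}" by (intro closed_Collect_le continuous_intros)
    then have sets: "{x::real. R \<le> \<bar>x\<bar>} \<in> sets lebesgue" by auto
    have meas: "(\<lambda>x. ereal (t * u x t)) \<in> borel_measurable ?M"
      using u_measurable[of t] t by (intro measurable_restrict_space1) auto
    have AE_iff: "(AE x in ?M. Q x) \<longleftrightarrow> (AE x in lebesgue. R \<le> \<bar>x\<bar> \<longrightarrow> Q x)" for Q
      using sets by (subst AE_restrict_space_iff) auto
    have "esssup ?M (\<lambda>x. ereal (t * u x t)) \<le> ereal (b t)"
    proof (rule esssup_I[OF meas])
      show "AE x in ?M. ereal (t * u x t) \<le> ereal (b t)"
        unfolding AE_iff using far[OF conjunct1[OF t] R]
      proof eventually_elim
        case (elim x)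
        have "t * (exp (- (t / 2)) * U + K / (sqrt t * R)) = b t"
        proof -
          have "t * (K / (sqrt t * R)) = K * inverse (g t)"
            using t by (simp add: R_def field_simps)
          moreover have "t * (exp (- (t / 2)) * U) = 2 * U * ((t / 2) ^ 1 / exp (t / 2))"
            by (simp add: exp_minus field_simps)
          ultimately show ?thesis unfolding b_def distrib_left by (simp only:)
        qed
        moreover have "t * u x t \<le> t * (exp (- (t / 2)) * U + K / (sqrt t * R))" if "R \<le> \<bar>x\<bar>"
          using elim that t by (intro mult_left_mono) auto
        ultimately show ?case by simp
      qed
    qed
    \<comment> \<open>The lower half of the sandwich: \<open>u\<close> is nonnegative almost
      everywhere and the region is not null.\<close>
    moreover have "(0::ereal) = esssup ?M (\<lambda>x. 0)"
      using emeasure_lebesgue_outside_interval[of R] sets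
      by (intro esssup_const[symmetric]) (simp add: emeasure_restrict_space space_restrict_space)
    moreover have "esssup ?M (\<lambda>x. 0) \<le> esssup ?M (\<lambda>x. ereal (t * u x t))"
    proof (rule esssup_AE_mono)
      show "AE x in ?M. 0 \<le> ereal (t * u x t)"
        unfolding AE_iff using u_nonneg[of t] t by (auto elim!: eventually_mono)
    qed simp
    ultimately show ?thesis unfolding R_eq by simp
  qed
  show ?thesis
    by (rule tendsto_sandwich[OF _ _ tendsto_const upper_lim];
        rule eventually_mono[OF ev]; use bounds in blast)
qed

end
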